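(* Let $(\mathcal{R},\eta_{\mathcal{R}})$ and $(\mathcal{B},\eta_{\mathcal{B}})$ be two marked point processes on $\mathbb{R}^d$, jointly ergodic under translations, whose ground processes $\mathcal{R}$ and $\mathcal{B}$ are simple with finite positive intensities $\lambda_{\mathcal{R}}$ and $\lambda_{\mathcal{B}}$, and with i.i.d. marks taking values in the strictly positive integers, distributed as the random variables $X$ (marks of $\mathcal{R}$) and $Y$ (marks of $\mathcal{B}$), respectively. Suppose that almost surely $[\mathcal{R}]\cup[\mathcal{B}]$ is non-equidistant and has no descending chains. Then there exists a (translation-invariant, simple) two-color multi-matching scheme for $(\mathcal{R},\eta_{\mathcal{R}})$ and $(\mathcal{B},\eta_{\mathcal{B}})$ if and only if $$\lambda_{\mathcal{R}}\,\mathbb{E}(X)=\lambda_{\mathcal{B}}\,\mathbb{E}(Y),$$ where the value $\infty$ on both sides is allowed, meaning that $\mathbb{E}(X)=\mathbb{E}(Y)=\infty$.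
   Context: For a random point measure $\Lambda$ on $\mathbb{R}^d$, $[\Lambda]=\{x:\Lambda(\{x\})>0\}$ is its support. Points of $[\mathcal{R}]$ are called red and points of $[\mathcal{B}]$ blue; each point has exactly one color, i.e. $[\mathcal{R}]\cap[\mathcal{B}]=\emptyset$ almost surely. The intensity of a translation-invariant point process is the expected number of points in a set of unit volume. Joint ergodicity includes joint translation-invariance in law. Marks: $\eta_{\mathcal{R}}$ (resp. $\eta_{\mathcal{B}}$) is an integer-valued random measure with the same support as $\mathcal{R}$ (resp. $\mathcal{B}$); given $(\mathcal{R},\mathcal{B})$, the marks $X_x:=\eta_{\mathcal{R}}(\{x\})$, $x\in[\mathcal{R}]$, and $Y_y:=\eta_{\mathcal{B}}(\{y\})$, $y\in[\mathcal{B}]$, are all independent, the $X_x$ having the law of $X$ and the $Y_y$ the law of $Y$. $X_x$ (resp. $Y_y$) is the number of stubs at $x$ (resp. $y$). A two-color multi-matching scheme for $(\mathcal{R},\eta_{\mathcal{R}})$ and $(\mathcal{B},\eta_{\mathcal{B}})$ is a point process $\mathcal{M}$ on the space of unordered pairs of points of $\mathbb{R}^d$ (defined on a probability space supporting the marked processes, possibly with extra randomness) such that almost surely every pair in $[\mathcal{M}]$ consists of one point of $[\mathcal{R}]$ and one point of $[\mathcal{B}]$, and in the bipartite graph with vertex set $[\mathcal{R}]\cup[\mathcal{B}]$ and edge set $[\mathcal{M}]$ every $x\in[\mathcal{R}]$ has degree exactly $X_x$ and every $y\in[\mathcal{B}]$ has degree exactly $Y_y$. Only simple schemes (no self-loops,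 no multiple edges) that are translation-invariant are considered, where translation-invariant means that the joint law of $(\mathcal{R},\eta_{\mathcal{R}},\mathcal{B},\eta_{\mathcal{B}},\mathcal{M})$ is invariant under all translations of $\mathbb{R}^d$. A set $S\subset\mathbb{R}^d$ is non-equidistant if there are no distinct points $x,y,z\in S$ with $|x-y|=|x-z|$ and no distinct points $x,y,u,w\in S$ with $|x-y|=|u-w|$, where $|\cdot|$ is the Euclidean norm. A descending chain in $S$ is an infinite sequence $\{x_i\}_{i\ge1}\subset S$ such that $|x_i-x_{i-1}|$ is strictly decreasing in $i$. *)

theory Defs
  imports "HOL-Probability.Probability" "HOL-Library.Uprod"
begin

section \<open>Point processes\<close>

text \<open>
  A point measure is integer-valued and finite on bounded measurable sets. The space of point
  measures carries the \<open>\<sigma>\<close>-algebra generated by the evaluations \<open>\<mu> \<mapsto> \<mu> A\<close>. Boundedness is a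
  parameter, because the construction is used for points and for unordered pairs of points.
\<close>

definition point_measures :: "'s measure \<Rightarrow> ('s set \<Rightarrow> bool) \<Rightarrow> 's measure set" where
  "point_measures S bdd =
     {\<mu>. sets \<mu> = sets S \<and> (\<forall>A\<in>sets S. bdd A \<longrightarrow> (\<exists>n::nat. emeasure \<mu> A = of_nat n))}"

definition point_measure_space :: "'s measure \<Rightarrow> ('s set \<Rightarrow> bool) \<Rightarrow> 's measure measure" where
  "point_measure_space S bdd = sigma (point_measures S bdd)
     {{\<mu> \<in> point_measures S bdd. emeasure \<mu> A \<in> U} | A U. A \<in> sets S \<and> U \<in> sets borel}"

abbreviation configs :: "('a::euclidean_space) measure measure" where
  "configs \<equiv> point_measure_space borel bounded"

text \<open>The Borel sets of unordered pairs are those of the quotient of the space of ordered pairs.\<close>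

definition uprod_borel :: "('a::euclidean_space) uprod measure" where
  "uprod_borel = sigma UNIV {E. (\<lambda>(x, y). Upair x y) -` E \<in> sets borel}"

definition bounded_pairs :: "('a::euclidean_space) uprod set \<Rightarrow> bool" where
  "bounded_pairs E \<longleftrightarrow> bounded (\<Union>e\<in>E. set_uprod e)"

abbreviation pair_configs :: "('a::euclidean_space) uprod measure measure" where
  "pair_configs \<equiv> point_measure_space uprod_borel bounded_pairs"

definition atoms :: "'s measure \<Rightarrow> 's set" where
  "atoms \<mu> = {x. emeasure \<mu> {x} > 0}"

definition simple_measure :: "'s measure \<Rightarrow> bool" where
  "simple_measure \<mu> \<longleftrightarrow> (\<forall>x. emeasure \<mu> {x} \<le> 1)"

text \<open>
  The unit cube serves as the set of unit volume; for a translation-invariant process every Borel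
  set of unit volume gives the same value.
\<close>

definition intensity :: "'w measure \<Rightarrow> ('w \<Rightarrow> ('a::euclidean_space) measure) \<Rightarrow> ennreal" where
  "intensity P \<Lambda> = (\<integral>\<^sup>+\<omega>. emeasure (\<Lambda> \<omega>) (cbox 0 One) \<partial>P)"


section \<open>Translations and ergodicity\<close>

definition translate :: "'a \<Rightarrow> ('a::euclidean_space) measure \<Rightarrow> 'a measure" where
  "translate t \<mu> = distr \<mu> borel (\<lambda>x. x + t)"

definition translate_pairs :: "'a \<Rightarrow> ('a::euclidean_space) uprod measure \<Rightarrow> 'a uprod measure" where
  "translate_pairs t \<mu> = distr \<mu> uprod_borel (map_uprod (\<lambda>x. x + t))"

definition translation_invariant ::
    "'w measure \<Rightarrow> 's measure \<Rightarrow> ('a \<Rightarrow> 's \<Rightarrow> 's) \<Rightarrow> ('w \<Rightarrow> 's) \<Rightarrow> bool" where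
  "translation_invariant P S T Z \<longleftrightarrow>
     Z \<in> P \<rightarrow>\<^sub>M S \<and> (\<forall>t. distr P S (\<lambda>\<omega>. T t (Z \<omega>)) = distr P S Z)"

definition ergodic ::
    "'w measure \<Rightarrow> 's measure \<Rightarrow> ('a \<Rightarrow> 's \<Rightarrow> 's) \<Rightarrow> ('w \<Rightarrow> 's) \<Rightarrow> bool" where
  "ergodic P S T Z \<longleftrightarrow> translation_invariant P S T Z \<and>
     (\<forall>A\<in>sets S. (\<forall>t. \<forall>z\<in>space S. T t z \<in> A \<longleftrightarrow> z \<in> A) \<longrightarrow>
        measure P {\<omega> \<in> space P. Z \<omega> \<in> A} \<in> {0, 1})"

abbreviation configs4 where
  "configs4 \<equiv> configs \<Otimes>\<^sub>M configs \<Otimes>\<^sub>M configs \<Otimes>\<^sub>M configs"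

definition translate4 where
  "translate4 t = (\<lambda>(r, hr, b, hb). (translate t r, translate t hr, translate t b, translate t hb))"

abbreviation configs5 where
  "configs5 \<equiv> configs \<Otimes>\<^sub>M configs \<Otimes>\<^sub>M configs \<Otimes>\<^sub>M configs \<Otimes>\<^sub>M pair_configs"

definition translate5 where
  "translate5 t =
     (\<lambda>(r, hr, b, hb, m).
       (translate t r, translate t hr, translate t b, translate t hb, translate_pairs t m))"


section \<open>Independent marks\<close>

text \<open>The measure \<open>\<Sum>x\<in>atoms \<mu>. f x \<cdot> \<delta>\<^sub>x\<close>.\<close>

definition attach_marks :: "('a::euclidean_space) measure \<Rightarrow> ('a \<Rightarrow> nat) \<Rightarrow> 'a measure" where
  "attach_marks \<mu> f = distr (density (count_space (atoms \<mu>)) (\<lambda>x. of_nat (f x))) borel (\<lambda>x. x)"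

text \<open>
  The law of the pair of mark measures on deterministic ground configurations \<open>r\<close> and \<open>b\<close> when all
  marks are independent, those on \<open>r\<close> with law \<open>p\<close> and those on \<open>b\<close> with law \<open>q\<close>.
\<close>

definition mark_law ::
    "nat pmf \<Rightarrow> nat pmf \<Rightarrow> ('a::euclidean_space) measure \<Rightarrow> 'a measure
      \<Rightarrow> ('a measure \<times> 'a measure) measure" where
  "mark_law p q r b =
     distr ((\<Pi>\<^sub>M x\<in>atoms r. measure_pmf p) \<Otimes>\<^sub>M (\<Pi>\<^sub>M y\<in>atoms b. measure_pmf q))
       (configs \<Otimes>\<^sub>M configs) (\<lambda>(f, g). (attach_marks r f, attach_marks b g))"

text \<open>The conditional law of \<open>(\<eta>R, \<eta>B)\<close> given \<open>(R, B)\<close> is \<open>mark_law p q R B\<close>.\<close>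

definition iid_marks ::
    "'w measure \<Rightarrow> nat pmf \<Rightarrow> nat pmf \<Rightarrow> ('w \<Rightarrow> ('a::euclidean_space) measure) \<Rightarrow> ('w \<Rightarrow> 'a measure)
      \<Rightarrow> ('w \<Rightarrow> 'a measure) \<Rightarrow> ('w \<Rightarrow> 'a measure) \<Rightarrow> bool" where
  "iid_marks P p q R \<eta>R B \<eta>B \<longleftrightarrow>
     (AE \<omega> in P. atoms (\<eta>R \<omega>) = atoms (R \<omega>) \<and> atoms (\<eta>B \<omega>) = atoms (B \<omega>)) \<and>
     (\<forall>A\<in>sets (configs \<Otimes>\<^sub>M configs). \<forall>D\<in>sets (configs \<Otimes>\<^sub>M configs).
        emeasure P {\<omega> \<in> space P. (R \<omega>, B \<omega>) \<in> A \<and> (\<eta>R \<omega>, \<eta>B \<omega>) \<in> D} =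
        (\<integral>\<^sup>+\<omega>\<in>{\<omega> \<in> space P. (R \<omega>, B \<omega>) \<in> A}. emeasure (mark_law p q (R \<omega>) (B \<omega>)) D \<partial>P))"


section \<open>Non-equidistance and descending chains\<close>

definition non_equidistant :: "('a::euclidean_space) set \<Rightarrow> bool" where
  "non_equidistant S \<longleftrightarrow>
     \<not> (\<exists>x\<in>S. \<exists>y\<in>S. \<exists>z\<in>S. distinct [x, y, z] \<and> norm (x - y) = norm (x - z)) \<and>
     \<not> (\<exists>x\<in>S. \<exists>y\<in>S. \<exists>u\<in>S. \<exists>w\<in>S. distinct [x, y, u, w] \<and> norm (x - y) = norm (u - w))"

definition descending_chain :: "('a::euclidean_space) set \<Rightarrow> (nat \<Rightarrow> 'a) \<Rightarrow> bool" where
  "descending_chain S x \<longleftrightarrow> range x \<subseteq> S \<and>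
     (\<forall>i. norm (x (Suc (Suc i)) - x (Suc i)) < norm (x (Suc i) - x i))"


section \<open>Two-color multi-matching schemes\<close>

definition vertex_degree :: "'a uprod set \<Rightarrow> 'a \<Rightarrow> ennreal" where
  "vertex_degree E x = emeasure (count_space UNIV) {e \<in> E. x \<in> set_uprod e}"

definition two_color_multi_matching ::
    "'a uprod measure \<Rightarrow> ('a::euclidean_space) measure \<Rightarrow> 'a measure \<Rightarrow> 'a measure \<Rightarrow> 'a measure
      \<Rightarrow> bool" where
  "two_color_multi_matching m r hr b hb \<longleftrightarrow>
     (\<forall>e\<in>atoms m. \<exists>x\<in>atoms r. \<exists>y\<in>atoms b. e = Upair x y) \<and>
     (\<forall>x\<in>atoms r. vertex_degree (atoms m) x = emeasure hr {x}) \<and>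
     (\<forall>y\<in>atoms b. vertex_degree (atoms m) y = emeasure hb {y})"

text \<open>
  Simple, translation-invariant schemes. Self-loops need no separate exclusion: the colors are
  disjoint almost surely.
\<close>

definition scheme ::
    "'v measure \<Rightarrow> ('v \<Rightarrow> ('a::euclidean_space) measure) \<Rightarrow> ('v \<Rightarrow> 'a measure)
      \<Rightarrow> ('v \<Rightarrow> 'a measure) \<Rightarrow> ('v \<Rightarrow> 'a measure) \<Rightarrow> ('v \<Rightarrow> 'a uprod measure) \<Rightarrow> bool" where
  "scheme Q R \<eta>R B \<eta>B M \<longleftrightarrow>
     M \<in> Q \<rightarrow>\<^sub>M pair_configs \<and>
     (AE v in Q. two_color_multi_matching (M v) (R v) (\<eta>R v) (B v) (\<eta>B v)) \<and>
     (AE v in Q. simple_measure (M v)) \<and>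
     translation_invariant Q configs5 translate5 (\<lambda>v. (R v, \<eta>R v, B v, \<eta>B v, M v))"

text \<open>
  A probability space over \<open>P\<close> with extra randomness. In the existence of a scheme the sample type
  \<open>'w \<times> 'a uprod measure\<close> is no restriction: if \<open>\<pi>\<close> maps a probability space onto \<open>P\<close>, preserving
  measure, and carries a scheme \<open>M\<close>, then the joint law of \<open>(\<pi>, M)\<close> carries the scheme \<open>snd\<close>.
\<close>

definition extension :: "'w measure \<Rightarrow> ('w \<times> 'x) measure \<Rightarrow> bool" where
  "extension P Q \<longleftrightarrow> prob_space Q \<and> fst \<in> Q \<rightarrow>\<^sub>M P \<and> distr Q P fst = P"

definition scheme_exists ::
    "'w measure \<Rightarrow> ('w \<Rightarrow> ('a::euclidean_space) measure) \<Rightarrow> ('w \<Rightarrow> 'a measure)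
      \<Rightarrow> ('w \<Rightarrow> 'a measure) \<Rightarrow> ('w \<Rightarrow> 'a measure) \<Rightarrow> bool" where
  "scheme_exists P R \<eta>R B \<eta>B \<longleftrightarrow>
     (\<exists>(Q :: ('w \<times> 'a uprod measure) measure) M.
        extension P Q \<and> scheme Q (R \<circ> fst) (\<eta>R \<circ> fst) (B \<circ> fst) (\<eta>B \<circ> fst) M)"

end

theory Submission
  imports Defs
begin

text \<open>
  \<^emph>\<open>Only if.\<close> By mass transport the mean number of edge ends at the red points of a unit cube equals
  the mean number at its blue points; these means are \<open>lamR * E(X)\<close> and \<open>lamB * E(Y)\<close>.

  \<^emph>\<open>If.\<close> In successive rounds join all pairs of points of different colors that are mutually closest
  among the pairs of points with free stubs that are not joined yet. In the limit, since there are no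
  descending chains, an unsaturated red point \<open>x\<close> and a blue point \<open>y\<close> that are not joined can only
  exist if \<open>y\<close> is saturated and all its partners are at least as close to \<open>y\<close> as \<open>x\<close>.

  If the means are finite, mass transport shows that saturation of one color implies that of the
  other. If both colors had unsaturated points, then by ergodicity they would have them almost surely;
  all of these would be joined to each other, so that there would be only finitely many, which
  contradicts stationarity.

  If \<open>E(Y)\<close> is infinite, then by the second Borel-Cantelli lemma infinitely many blue points \<open>y\<close>
  have, with positive probability, more stubs than there are red points in a ball of radius
  \<open>3 * norm y\<close> around the origin. All but finitely many of them must be joined to a given
  unsaturated red point, which is absurd. By ergodicity the red points are saturated almost surely.
\<close>

section \<open>Point measures\<close>

text \<open>The matching is a measurable, translation-equivariant function of the four point
  measures, so joint invariance is inherited and no randomness is added. The obstacle is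
  measurability of a construction with infinitely many rounds; therefore degrees, closeness and
  saturation are written as masses under \<open>r\<close> and \<open>b\<close>, which are counts
  when these measures are simple. If the means are infinite, mean degrees cannot be compared by
  subtraction, and the sizes of single marks have to decide. The number of red points in a ball
  around the origin is of the order of its volume, with controlled probability. So a blue point with
  mark \<open>k\<close> exceeds its threshold in a region of volume about \<open>k\<close>, and
  averaging over \<open>k\<close> gives about \<open>E(Y)\<close> such points, that is, infinitely
  many. Hence an infinite mean of one color saturates the other color, and the marks of one color
  have to be studied conditionally on both ground processes. The conditional law of the marks is
  given by an identity in which the kernel is not assumed measurable, so integrals against it are
  justified through measurable versions.\<close>

lemma space_point_measure_space [simp]:
  "space (point_measure_space S bdd) = point_measures S bdd"
  unfolding point_measure_space_def by (intro space_measure_of) auto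

lemma sets_point_measure:
  "\<mu> \<in> point_measures S bdd \<Longrightarrow> sets \<mu> = sets S"
  by (simp add: point_measures_def)

lemma measurable_emeasure_point_measure_space:
  assumes "A \<in> sets S"
  shows "(\<lambda>\<mu>. emeasure \<mu> A) \<in> borel_measurable (point_measure_space S bdd)"
proof (rule measurableI)
  fix U :: "ennreal set" assume "U \<in> sets borel"
  then have "{\<mu> \<in> point_measures S bdd. emeasure \<mu> A \<in> U} \<in>
      {{\<mu> \<in> point_measures S bdd. emeasure \<mu> A \<in> U} | A U. A \<in> sets S \<and> U \<in> sets borel}"
    using assms by blast
  moreover have "(\<lambda>\<mu>. emeasure \<mu> A) -` U \<inter> space (point_measure_space S bdd) =
      {\<mu> \<in> point_measures S bdd. emeasure \<mu> A \<in> U}"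
    by auto
  ultimately show "(\<lambda>\<mu>. emeasure \<mu> A) -` U \<inter> space (point_measure_space S bdd)
      \<in> sets (point_measure_space S bdd)"
    unfolding point_measure_space_def by (subst sets_measure_of) auto
qed simp

lemma measurable_point_measure_spaceI:
  assumes "\<And>\<omega>. \<omega> \<in> space N \<Longrightarrow> f \<omega> \<in> point_measures S bdd"
    and "\<And>A. A \<in> sets S \<Longrightarrow> (\<lambda>\<omega>. emeasure (f \<omega>) A) \<in> borel_measurable N"
  shows "f \<in> N \<rightarrow>\<^sub>M point_measure_space S bdd"
  unfolding point_measure_space_def
proof (rule measurable_measure_of)
  show "f \<in> space N \<rightarrow> point_measures S bdd"
    using assms(1) by auto
  fix E assume "E \<in> {{\<mu> \<in> point_measures S bdd. emeasure \<mu> A \<in> U} |A U. A \<in> sets S \<and> U \<in> sets borel}"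
  then obtain A U where E: "E = {\<mu> \<in> point_measures S bdd. emeasure \<mu> A \<in> U}"
    and A: "A \<in> sets S" and U: "U \<in> sets borel" by blast
  have "f -` E \<inter> space N = (\<lambda>\<omega>. emeasure (f \<omega>) A) -` U \<inter> space N"
    using assms(1) by (auto simp: E)
  also have "\<dots> \<in> sets N"
    using assms(2)[OF A] U by (rule measurable_sets)
  finally show "f -` E \<inter> space N \<in> sets N" .
qed auto

section \<open>Masses and integrals that depend on a parameter\<close>

lemma measurable_emeasure_kernel:
  assumes K: "K \<in> N \<rightarrow>\<^sub>M point_measure_space S bdd"
    and C: "\<And>k::nat. C k \<in> sets S" "\<And>k. bdd (C k)" "incseq C" "(\<Union>k. C k) = space S"
    and W: "W \<in> sets (N \<Otimes>\<^sub>M S)"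
  shows "(\<lambda>\<omega>. emeasure (K \<omega>) (Pair \<omega> -` W)) \<in> borel_measurable N"
proof -
  have Ksets: "sets (K \<omega>) = sets S" if "\<omega> \<in> space N" for \<omega>
    using measurable_space[OF K that] by (simp add: sets_point_measure)
  have Kfin: "emeasure (K \<omega>) (C k) \<noteq> \<infinity>" if "\<omega> \<in> space N" for \<omega> k
    using measurable_space[OF K that] C(1,2)[of k] by (force simp: point_measures_def)
  have KA: "(\<lambda>\<omega>. emeasure (K \<omega>) A) \<in> borel_measurable N" if "A \<in> sets S" for A
    using measurable_compose[OF K measurable_emeasure_point_measure_space[OF that]] .
  have sec: "Pair \<omega> -` V \<in> sets S" if "V \<in> sets (N \<Otimes>\<^sub>M S)" for \<omega> V
    using that by (rule sets_Pair1)
  \<comment> \<open>The complement case of the induction subtracts masses and needs them finite;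
    hence the sections are cut off at the bounded sets \<open>C k\<close>, and the cut is removed by
    monotone convergence.\<close>
  have *: "(\<lambda>\<omega>. emeasure (K \<omega>) (Pair \<omega> -` W \<inter> C k)) \<in> borel_measurable N" for k
  proof -
    have "Int_stable {a \<times> b | a b. a \<in> sets N \<and> b \<in> sets S}"
      by (rule Int_stable_pair_measure_generator)
    moreover have "{a \<times> b | a b. a \<in> sets N \<and> b \<in> sets S} \<subseteq> Pow (space N \<times> space S)"
      by (rule pair_measure_closed)
    moreover have "W \<in> sigma_sets (space N \<times> space S) {a \<times> b | a b. a \<in> sets N \<and> b \<in> sets S}"
      using W by (simp add: sets_pair_measure)
    ultimately show ?thesis
    proof (induction rule: sigma_sets_induct_disjoint)
      case (basic V)
      then obtain a b where V: "V = a \<times> b" and a: "a \<in> sets N" and b: "b \<in> sets S" by blast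
      have "emeasure (K \<omega>) (Pair \<omega> -` V \<inter> C k) = indicator a \<omega> * emeasure (K \<omega>) (b \<inter> C k)" for \<omega>
        by (auto simp: V indicator_def)
      moreover have "b \<inter> C k \<in> sets S" using b C(1) by auto
      ultimately show ?case
        using KA a by (auto intro!: borel_measurable_times_ennreal)
    next
      case empty
      then show ?case by simp
    next
      case (compl V)
      have V: "V \<in> sets (N \<Otimes>\<^sub>M S)" using compl by (simp add: sets_pair_measure)
      have "emeasure (K \<omega>) (Pair \<omega> -` (space N \<times> space S - V) \<inter> C k) =
          emeasure (K \<omega>) (C k) - emeasure (K \<omega>) (Pair \<omega> -` V \<inter> C k)" if "\<omega> \<in> space N" for \<omega>
      proof -
        have "Pair \<omega> -` (space N \<times> space S - V) \<inter> C k = C k - Pair \<omega> -` V \<inter> C k"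
          using that sets.sets_into_space[OF C(1)[of k]] by auto
        moreover have "emeasure (K \<omega>) (Pair \<omega> -` V \<inter> C k) \<le> emeasure (K \<omega>) (C k)"
          using C(1) that by (intro emeasure_mono) (auto simp: Ksets)
        ultimately show ?thesis
          using Kfin[OF that, of k] sec[OF V, of \<omega>] C(1)[of k] that
          by (subst emeasure_Diff[symmetric]) (auto simp: Ksets top_unique)
      qed
      moreover have "(\<lambda>\<omega>. emeasure (K \<omega>) (C k) - emeasure (K \<omega>) (Pair \<omega> -` V \<inter> C k))
          \<in> borel_measurable N"
        using compl KA[OF C(1)] by (intro borel_measurable_minus_ennreal) auto
      ultimately show ?case
        by (subst measurable_cong) auto
    next
      case (union V)
      have V: "V i \<in> sets (N \<Otimes>\<^sub>M S)" for i using union by (auto simp: sets_pair_measure)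
      have "emeasure (K \<omega>) (Pair \<omega> -` (\<Union>i. V i) \<inter> C k) =
          (\<Sum>i. emeasure (K \<omega>) (Pair \<omega> -` V i \<inter> C k))" if "\<omega> \<in> space N" for \<omega>
      proof -
        have "Pair \<omega> -` (\<Union>i. V i) \<inter> C k = (\<Union>i. Pair \<omega> -` V i \<inter> C k)" by auto
        moreover have "disjoint_family (\<lambda>i. Pair \<omega> -` V i \<inter> C k)"
          using union(1) by (auto simp: disjoint_family_on_def)
        ultimately show ?thesis
          using sec[OF V] C(1)[of k] that by (subst suminf_emeasure) (auto simp: Ksets)
      qed
      moreover have "(\<lambda>\<omega>. \<Sum>i. emeasure (K \<omega>) (Pair \<omega> -` V i \<inter> C k)) \<in> borel_measurable N"
        using union(3) by (intro borel_measurable_suminf_order)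
      ultimately show ?case
        by (subst measurable_cong) auto
    qed
  qed
  have "emeasure (K \<omega>) (Pair \<omega> -` W) = (SUP k. emeasure (K \<omega>) (Pair \<omega> -` W \<inter> C k))"
    if "\<omega> \<in> space N" for \<omega>
  proof -
    have "Pair \<omega> -` W = (\<Union>k. Pair \<omega> -` W \<inter> C k)"
      using C(4) sets.sets_into_space[OF sec[OF W, of \<omega>]] by auto
    moreover have "incseq (\<lambda>k. Pair \<omega> -` W \<inter> C k)"
      using C(3) by (auto simp: incseq_def)
    moreover have "range (\<lambda>k. Pair \<omega> -` W \<inter> C k) \<subseteq> sets (K \<omega>)"
      using sec[OF W, of \<omega>] C(1) that by (auto simp: Ksets)
    ultimately show ?thesis
      using SUP_emeasure_incseq[of "\<lambda>k. Pair \<omega> -` W \<inter> C k" "K \<omega>"] by simp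
  qed
  moreover have "(\<lambda>\<omega>. SUP k. emeasure (K \<omega>) (Pair \<omega> -` W \<inter> C k)) \<in> borel_measurable N"
    using * by (intro borel_measurable_SUP) auto
  ultimately show ?thesis
    by (subst measurable_cong) auto
qed

text \<open>The integrand may depend on the parameter as well, so integrals over one random point
  measure can be nested inside integrals over another.\<close>

lemma measurable_nn_integral_kernel:
  assumes K: "K \<in> N \<rightarrow>\<^sub>M point_measure_space S bdd"
    and C: "\<And>k::nat. C k \<in> sets S" "\<And>k. bdd (C k)" "incseq C" "(\<Union>k. C k) = space S"
    and f: "f \<in> borel_measurable (N \<Otimes>\<^sub>M S)"
  shows "(\<lambda>\<omega>. \<integral>\<^sup>+x. f (\<omega>, x) \<partial>K \<omega>) \<in> borel_measurable N"
  using f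
proof induction
  have Ksets: "sets (K \<omega>) = sets S" if "\<omega> \<in> space N" for \<omega>
    using measurable_space[OF K that] by (simp add: sets_point_measure)
  have sec: "(\<lambda>x. u (\<omega>, x)) \<in> borel_measurable (K \<omega>)"
    if "\<omega> \<in> space N" "u \<in> borel_measurable (N \<Otimes>\<^sub>M S)" for \<omega> and u :: "_ \<Rightarrow> ennreal"
    using measurable_Pair2[OF that(2,1)] Ksets[OF that(1)] by (simp cong: measurable_cong_sets)
  {
    case (cong f g)
    have "(\<integral>\<^sup>+x. f (\<omega>, x) \<partial>K \<omega>) = (\<integral>\<^sup>+x. g (\<omega>, x) \<partial>K \<omega>)" if "\<omega> \<in> space N" for \<omega>
      using cong(3) that sets_eq_imp_space_eq[OF Ksets[OF that]]
      by (intro nn_integral_cong) (auto simp: space_pair_measure)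
    with cong show ?case by (simp cong: measurable_cong)
  next
    case (set A)
    have "(\<integral>\<^sup>+x. indicator A (\<omega>, x) \<partial>K \<omega>) = emeasure (K \<omega>) (Pair \<omega> -` A)" if "\<omega> \<in> space N" for \<omega>
    proof -
      have "(\<integral>\<^sup>+x. indicator A (\<omega>, x) \<partial>K \<omega>) = (\<integral>\<^sup>+x. indicator (Pair \<omega> -` A) x \<partial>K \<omega>)"
        by (intro nn_integral_cong) (auto simp: indicator_def)
      then show ?thesis
        using sets_Pair1[OF set, of \<omega>] Ksets[OF that] by simp
    qed
    then show ?case
      using measurable_emeasure_kernel[OF K C set] by (simp cong: measurable_cong)
  next
    case (mult u c)
    then have "(\<integral>\<^sup>+x. c * u (\<omega>, x) \<partial>K \<omega>) = c * (\<integral>\<^sup>+x. u (\<omega>, x) \<partial>K \<omega>)" if "\<omega> \<in> space N" for \<omega>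
      using sec[OF that] by (intro nn_integral_cmult) auto
    with mult show ?case by (simp cong: measurable_cong)
  next
    case (add u v)
    then have "(\<integral>\<^sup>+x. v (\<omega>, x) + u (\<omega>, x) \<partial>K \<omega>) =
        (\<integral>\<^sup>+x. v (\<omega>, x) \<partial>K \<omega>) + (\<integral>\<^sup>+x. u (\<omega>, x) \<partial>K \<omega>)" if "\<omega> \<in> space N" for \<omega>
      using sec[OF that] by (intro nn_integral_add) auto
    with add show ?case by (simp cong: measurable_cong)
  next
    case (seq U)
    then have "(\<integral>\<^sup>+x. (SUP i. U i) (\<omega>, x) \<partial>K \<omega>) = (SUP i. \<integral>\<^sup>+x. U i (\<omega>, x) \<partial>K \<omega>)"
      if "\<omega> \<in> space N" for \<omega>
      using sec[OF that] unfolding SUP_apply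
      by (intro nn_integral_monotone_convergence_SUP) (auto simp: incseq_def le_fun_def)
    with seq show ?case by (simp cong: measurable_cong)
  }
qed

lemma Union_cball_nat: "(\<Union>k. cball (0::'a::real_normed_vector) (real k)) = UNIV"
  using real_arch_simple by (force simp: dist_norm)

lemma incseq_cball_nat: "incseq (\<lambda>k. cball (0::'a::real_normed_vector) (real k))"
  by (auto simp: incseq_def)

lemma measurable_nn_integral_configs:
  fixes K :: "'w \<Rightarrow> ('a::euclidean_space) measure"
  assumes "K \<in> N \<rightarrow>\<^sub>M configs" "f \<in> borel_measurable (N \<Otimes>\<^sub>M borel)"
  shows "(\<lambda>\<omega>. \<integral>\<^sup>+x. f (\<omega>, x) \<partial>K \<omega>) \<in> borel_measurable N"
  by (rule measurable_nn_integral_kernel[OF assms(1) _ _ _ _ assms(2),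
        where C="\<lambda>k. cball 0 (real k)"])
     (auto simp: Union_cball_nat incseq_cball_nat)

lemma measurable_nn_integral_configs' [measurable (raw)]:
  fixes K :: "'w \<Rightarrow> ('a::euclidean_space) measure"
  assumes "K \<in> N \<rightarrow>\<^sub>M configs" "(\<lambda>(\<omega>, x). f \<omega> x) \<in> borel_measurable (N \<Otimes>\<^sub>M borel)"
  shows "(\<lambda>\<omega>. \<integral>\<^sup>+x. f \<omega> x \<partial>K \<omega>) \<in> borel_measurable N"
  using measurable_nn_integral_configs[OF assms] by simp

text \<open>A random set enters as a predicate in the parameter and the point. A condition such as
  having no closer partner can then be stated as a vanishing mass, instead of a quantifier over
  uncountably many points.\<close>

lemma measurable_emeasure_configs [measurable (raw)]:
  fixes K :: "'w \<Rightarrow> ('a::euclidean_space) measure"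
  assumes "K \<in> N \<rightarrow>\<^sub>M configs" "Measurable.pred (N \<Otimes>\<^sub>M borel) (\<lambda>(\<omega>, x). Q \<omega> x)"
  shows "(\<lambda>\<omega>. emeasure (K \<omega>) {x. Q \<omega> x}) \<in> borel_measurable N"
proof -
  have "(\<lambda>\<omega>. emeasure (K \<omega>) (Pair \<omega> -` {p \<in> space (N \<Otimes>\<^sub>M borel). (\<lambda>(\<omega>, x). Q \<omega> x) p}))
      \<in> borel_measurable N"
    by (rule measurable_emeasure_kernel[OF assms(1), where C="\<lambda>k. cball 0 (real k)"])
       (use assms(2) in \<open>auto simp: Union_cball_nat incseq_cball_nat\<close>)
  then show ?thesis
    by (rule measurable_cong[THEN iffD1, rotated]) (auto intro!: arg_cong2[where f=emeasure] simp: space_pair_measure)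
qed

section \<open>Atoms of a point measure\<close>

lemma configsD:
  fixes \<mu> :: "('a::euclidean_space) measure"
  assumes "\<mu> \<in> point_measures borel bounded"
  shows sets_configs: "sets \<mu> = sets borel" and space_configs: "space \<mu> = UNIV"
  using assms sets_eq_imp_space_eq[of \<mu> borel] by (auto simp: point_measures_def)

lemma configs_nat:
  assumes "\<mu> \<in> point_measures borel bounded" "A \<in> sets borel" "bounded A"
  shows "\<exists>n::nat. emeasure \<mu> A = of_nat n"
  using assms by (auto simp: point_measures_def)

lemma configs_finite:
  assumes "\<mu> \<in> point_measures borel bounded" "A \<in> sets borel" "bounded A"
  shows "emeasure \<mu> A < \<infinity>"
proof -
  obtain n::nat where "emeasure \<mu> A = of_nat n" using configs_nat[OF assms(1)] assms by blast
  then show ?thesis by (simp add: of_nat_less_top)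
qed

lemma sigma_finite_configs:
  fixes \<mu> :: "('a::euclidean_space) measure"
  assumes "\<mu> \<in> point_measures borel bounded"
  shows "sigma_finite_measure \<mu>"
proof
  show "\<exists>A. countable A \<and> A \<subseteq> sets \<mu> \<and> \<Union> A = space \<mu> \<and> (\<forall>a\<in>A. emeasure \<mu> a \<noteq> \<infinity>)"
    using Union_cball_nat[where 'a='a] configs_finite[OF assms]
    by (intro exI[of _ "range (\<lambda>k. cball 0 (real k))"])
       (auto simp: sets_configs[OF assms] space_configs[OF assms] less_top[symmetric])
qed

text \<open>An atom has a positive integer mass, hence mass at least 1; so \<open>Suc n\<close>
  atoms do not fit into a ball of mass \<open>n\<close>.\<close>

lemma finite_atoms_bounded:
  fixes \<mu> :: "('a::euclidean_space) measure"
  assumes \<mu>: "\<mu> \<in> point_measures borel bounded" and "bounded A"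
  shows "finite (atoms \<mu> \<inter> A)"
proof (rule ccontr)
  assume inf: "infinite (atoms \<mu> \<inter> A)"
  obtain k where k: "A \<subseteq> cball 0 k" using \<open>bounded A\<close> by (auto simp: bounded_iff subset_iff)
  obtain n::nat where n: "emeasure \<mu> (cball 0 k) = of_nat n"
    using configs_nat[OF \<mu> borel_closed[OF closed_cball] bounded_cball] by blast
  have one: "1 \<le> emeasure \<mu> {x}" if "x \<in> atoms \<mu>" for x
  proof -
    obtain j::nat where "emeasure \<mu> {x} = of_nat j" using configs_nat[OF \<mu> borel_singleton[OF sets.empty_sets] bounded_insert[THEN iffD2, OF bounded_empty]] by blast
    with that show ?thesis by (cases j) (auto simp: atoms_def)
  qed
  obtain F where F: "F \<subseteq> atoms \<mu> \<inter> A" "finite F" "card F = Suc n"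
    using infinite_arbitrarily_large[OF inf, of "Suc n"] by blast
  have "of_nat (Suc n) = (\<Sum>x\<in>F. 1::ennreal)" using F by simp
  also have "\<dots> \<le> (\<Sum>x\<in>F. emeasure \<mu> {x})"
    using F one by (intro sum_mono) auto
  also have "\<dots> = emeasure \<mu> F"
    using F by (subst emeasure_eq_sum_singleton) (auto simp: sets_configs[OF \<mu>])
  also have "\<dots> \<le> emeasure \<mu> (cball 0 k)"
    using F k by (intro emeasure_mono) (auto simp: sets_configs[OF \<mu>])
  finally have "(of_nat (Suc n) :: ennreal) \<le> of_nat n" by (simp add: n)
  then have "Suc n \<le> n" by (simp only: of_nat_le_iff)
  then show False by simp
qed

lemma countable_atoms:
  fixes \<mu> :: "('a::euclidean_space) measure"
  assumes \<mu>: "\<mu> \<in> point_measures borel bounded"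
  shows "countable (atoms \<mu>)"
proof -
  have "atoms \<mu> = (\<Union>k. atoms \<mu> \<inter> cball 0 (real k))" 
    using Union_cball_nat[where 'a='a] by blast
  also have "countable \<dots>"
    using countable_finite[OF finite_atoms_bounded[OF \<mu> bounded_cball]] by (intro countable_UN) auto
  finally show ?thesis .
qed

text \<open>For a fixed configuration this makes partner sets and sets of unsaturated points Borel
  without any look at their definitions.\<close>

lemma borel_subset_atoms:
  fixes \<mu> :: "('a::euclidean_space) measure"
  assumes "\<mu> \<in> point_measures borel bounded" "A \<subseteq> atoms \<mu>"
  shows "A \<in> sets borel"
  by (rule sets.countable[OF borel_singleton[OF sets.empty_sets] countable_subset[OF assms(2) countable_atoms[OF assms(1)]]])

text \<open>
  Since its values are integers, a point measure vanishes on a small ball around every non-atom;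
  by Lindeloef's theorem countably many of these balls suffice.
\<close>

lemma emeasure_Compl_atoms:
  fixes \<mu> :: "('a::euclidean_space) measure"
  assumes \<mu>: "\<mu> \<in> point_measures borel bounded"
  shows "emeasure \<mu> (- atoms \<mu>) = 0"
proof -
  have ball: "\<exists>e>0. emeasure \<mu> (ball x e) = 0" if x: "x \<notin> atoms \<mu>" for x
  proof -
    have dec: "decseq (\<lambda>n. ball x (1 / real (Suc n)))"
      by (auto simp: decseq_def intro!: subset_ball divide_left_mono elim!: order_less_le_trans)
    have "(\<Inter>n. ball x (1 / real (Suc n))) = {x}"
    proof (intro equalityI subsetI)
      fix y assume y: "y \<in> (\<Inter>n. ball x (1 / real (Suc n)))"
      show "y \<in> {x}"
      proof (rule ccontr)
        assume "y \<notin> {x}"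
        then have "dist x y > 0" by auto
        then obtain n where "1 / real (Suc n) < dist x y"
          using nat_approx_posE by blast
        with y show False by (auto simp: dest!: spec[of _ n])
      qed
    qed auto
    then have "(\<lambda>n. emeasure \<mu> (ball x (1 / real (Suc n)))) \<longlonglongrightarrow> emeasure \<mu> {x}"
      using Lim_emeasure_decseq[of "\<lambda>n. ball x (1 / real (Suc n))" \<mu>] dec
        configs_finite[OF \<mu> borel_open[OF open_ball] bounded_ball, of x]
      by (auto simp: sets_configs[OF \<mu>] less_top[symmetric] image_subset_iff)
    moreover have "emeasure \<mu> {x} = 0" using x by (simp add: atoms_def)
    ultimately have "eventually (\<lambda>n. emeasure \<mu> (ball x (1 / real (Suc n))) < 1) sequentially"
      by (auto intro: order_tendstoD(2))
    then obtain n where n: "emeasure \<mu> (ball x (1 / real (Suc n))) < 1"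
      by (auto simp: eventually_sequentially)
    obtain j::nat where "emeasure \<mu> (ball x (1 / real (Suc n))) = of_nat j"
      using configs_nat[OF \<mu> borel_open[OF open_ball] bounded_ball] by blast
    with n have "emeasure \<mu> (ball x (1 / real (Suc n))) = 0" by (cases j) auto
    then show ?thesis by (intro exI[of _ "1 / real (Suc n)"]) auto
  qed
  then obtain e where e: "\<And>x. x \<notin> atoms \<mu> \<Longrightarrow> e x > 0 \<and> emeasure \<mu> (ball x (e x)) = 0"
    by metis
  obtain F where F: "F \<subseteq> (\<lambda>x. ball x (e x)) ` (- atoms \<mu>)" "countable F"
      "\<Union>F = \<Union>((\<lambda>x. ball x (e x)) ` (- atoms \<mu>))"
    using Lindelof[of "(\<lambda>x. ball x (e x)) ` (- atoms \<mu>)"] by auto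
  have "(\<Union>f\<in>F. f) \<in> null_sets \<mu>"
    using F(1,2) e by (intro null_sets_UN') (auto simp: null_sets_def sets_configs[OF \<mu>])
  moreover have "- atoms \<mu> \<subseteq> \<Union>F" using e F(3) by force
  moreover have "- atoms \<mu> \<in> sets \<mu>"
    using borel_subset_atoms[OF \<mu> order_refl] by (simp add: sets_configs[OF \<mu>] borel_comp)
  ultimately show ?thesis
    by (auto simp: null_sets_def intro: emeasure_eq_0)
qed

lemma AE_atoms:
  fixes \<mu> :: "('a::euclidean_space) measure"
  assumes \<mu>: "\<mu> \<in> point_measures borel bounded"
  shows "AE x in \<mu>. x \<in> atoms \<mu>"
  using emeasure_Compl_atoms[OF \<mu>] borel_subset_atoms[OF \<mu> order_refl]
  by (intro AE_I'[of "- atoms \<mu>"]) (auto simp: null_sets_def sets_configs[OF \<mu>])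

text \<open>Almost every point is an atom, so a point measure is a countable sum of weighted point
  masses; the sum and the integral are exchanged.\<close>

lemma nn_integral_point_measure:
  fixes \<mu> :: "('a::euclidean_space) measure"
  assumes \<mu>: "\<mu> \<in> point_measures borel bounded" and f: "f \<in> borel_measurable borel"
  shows "(\<integral>\<^sup>+x. f x \<partial>\<mu>) = (\<integral>\<^sup>+x. f x * emeasure \<mu> {x} \<partial>count_space (atoms \<mu>))"
proof -
  have c: "countable (atoms \<mu>)" by (rule countable_atoms[OF \<mu>])
  have f': "f \<in> borel_measurable \<mu>" using f by (simp add: measurable_cong_sets[OF sets_configs[OF \<mu>] refl])
  have "(\<integral>\<^sup>+x. f x \<partial>\<mu>) = (\<integral>\<^sup>+x\<in>atoms \<mu>. f x \<partial>\<mu>)"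
    using AE_atoms[OF \<mu>] by (intro nn_integral_cong_AE) (auto elim!: eventually_mono)
  also have "\<dots> = (\<integral>\<^sup>+x. (\<integral>\<^sup>+i. f x * indicator {i} x \<partial>count_space (atoms \<mu>)) \<partial>\<mu>)"
  proof (intro nn_integral_cong)
    fix x
    have "(\<integral>\<^sup>+i. f x * indicator {i} x \<partial>count_space (atoms \<mu>)) =
        (\<integral>\<^sup>+i. f x * indicator {x} i \<partial>count_space (atoms \<mu>))"
      by (intro nn_integral_cong) (auto simp: indicator_def)
    also have "\<dots> = f x * indicator (atoms \<mu>) x"
    proof (cases "x \<in> atoms \<mu>")
      case True
      then show ?thesis by (subst nn_integral_cmult_indicator) auto
    next
      case False
      then have "(\<integral>\<^sup>+i. f x * indicator {x} i \<partial>count_space (atoms \<mu>)) = (\<integral>\<^sup>+i. 0 \<partial>count_space (atoms \<mu>))"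
        by (intro nn_integral_cong) (auto simp: indicator_def)
      with False show ?thesis by simp
    qed
    finally show "f x * indicator (atoms \<mu>) x = (\<integral>\<^sup>+i. f x * indicator {i} x \<partial>count_space (atoms \<mu>))" ..
  qed
  also have "\<dots> = (\<integral>\<^sup>+i. (\<integral>\<^sup>+x\<in>{i}. f x \<partial>\<mu>) \<partial>count_space (atoms \<mu>))"
    using c f' by (intro nn_integral_count_space_nn_integral borel_measurable_times_ennreal borel_measurable_indicator)
       (auto simp: sets_configs[OF \<mu>])
  also have "\<dots> = (\<integral>\<^sup>+x. f x * emeasure \<mu> {x} \<partial>count_space (atoms \<mu>))"
  proof (rule nn_integral_cong)
    fix i
    have "(\<integral>\<^sup>+x\<in>{i}. f x \<partial>\<mu>) = (\<integral>\<^sup>+x. f i * indicator {i} x \<partial>\<mu>)"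
      by (intro nn_integral_cong) (auto simp: indicator_def)
    then show "(\<integral>\<^sup>+x\<in>{i}. f x \<partial>\<mu>) = f i * emeasure \<mu> {i}"
      by (simp add: nn_integral_cmult_indicator sets_configs[OF \<mu>])
  qed
  finally show ?thesis .
qed

section \<open>Translations and unordered pairs\<close>

text \<open>For a set that is not Borel both sides are 0, because translation is a Borel
  isomorphism. Being valid for every \<open>A\<close>, the rule rewrites masses of sets given by
  comprehension without side conditions.\<close>

lemma emeasure_translate:
  fixes \<mu> :: "('a::euclidean_space) measure"
  assumes "sets \<mu> = sets borel"
  shows "emeasure (translate t \<mu>) A = emeasure \<mu> ((\<lambda>x. x + t) -` A)"
proof -
  have sp: "space \<mu> = UNIV" using sets_eq_imp_space_eq[OF assms] by simp
  have m: "(\<lambda>x. x + t) \<in> \<mu> \<rightarrow>\<^sub>M borel"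
    by (simp add: measurable_cong_sets[OF assms refl])
  show ?thesis
  proof (cases "A \<in> sets borel")
    case True
    with m show ?thesis by (simp add: translate_def emeasure_distr sp)
  next
    case False
    have "(\<lambda>x. x + t) -` A \<notin> sets \<mu>"
    proof
      assume "(\<lambda>x. x + t) -` A \<in> sets \<mu>"
      then have "(\<lambda>x. x - t) -` ((\<lambda>x. x + t) -` A) \<inter> space borel \<in> sets borel"
        by (intro measurable_sets[of _ borel borel]) (auto simp: assms)
      moreover have "(\<lambda>x. x - t) -` ((\<lambda>x. x + t) -` A) \<inter> space borel = A" by auto
      ultimately show False using False by simp
    qed
    with False show ?thesis by (simp add: translate_def emeasure_notin_sets)
  qed
qed

lemma nn_integral_translate:
  fixes \<mu> :: "('a::euclidean_space) measure"
  assumes "sets \<mu> = sets borel" "f \<in> borel_measurable borel"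
  shows "(\<integral>\<^sup>+x. f x \<partial>translate t \<mu>) = (\<integral>\<^sup>+x. f (x + t) \<partial>\<mu>)"
  unfolding translate_def
  by (subst nn_integral_distr) (use assms in \<open>auto simp: measurable_cong_sets[OF assms(1) refl]\<close>)

lemma emeasure_translate_singleton:
  fixes \<mu> :: "('a::euclidean_space) measure"
  assumes "sets \<mu> = sets borel"
  shows "emeasure (translate t \<mu>) {x + t} = emeasure \<mu> {x}"
proof -
  have "(\<lambda>x. x + t) -` {x + t} = {x}" by auto
  then show ?thesis by (simp add: emeasure_translate[OF assms])
qed

lemma atoms_translate:
  fixes \<mu> :: "('a::euclidean_space) measure"
  assumes "sets \<mu> = sets borel"
  shows "x + t \<in> atoms (translate t \<mu>) \<longleftrightarrow> x \<in> atoms \<mu>"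
  by (simp add: atoms_def emeasure_translate_singleton[OF assms])

lemma vimage_translate: "(\<lambda>x. x + t) -` A = (\<lambda>x. x - t) ` (A::('a::ab_group_add) set)"
  by (force simp: image_iff)

lemma translate_configs:
  fixes \<mu> :: "('a::euclidean_space) measure"
  assumes \<mu>: "\<mu> \<in> point_measures borel bounded"
  shows "translate t \<mu> \<in> point_measures borel bounded"
proof -
  have "\<exists>n::nat. emeasure \<mu> ((\<lambda>x. x + t) -` A) = of_nat n" if "A \<in> sets borel" "bounded A" for A
  proof (rule configs_nat[OF \<mu>])
    show "(\<lambda>x. x + t) -` A \<in> sets borel"
      using measurable_sets[of "\<lambda>x. x + t" borel borel A] that by simp
    show "bounded ((\<lambda>x. x + t) -` A)"
      unfolding vimage_translate using that(2) by (rule bounded_translation_minus)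
  qed
  then show ?thesis
    by (simp add: point_measures_def emeasure_translate[OF sets_configs[OF \<mu>]] translate_def[of t \<mu>, THEN arg_cong[where f=sets]])
qed

lemma measurable_translate: "translate t \<in> configs \<rightarrow>\<^sub>M configs"
proof (rule measurable_point_measure_spaceI)
  fix A :: "'a set" assume A: "A \<in> sets borel"
  have "(\<lambda>x. x + t) -` A \<in> sets borel"
    using measurable_sets[of "\<lambda>x. x + t" borel borel A] A by simp
  from measurable_emeasure_point_measure_space[OF this]
  show "(\<lambda>\<mu>. emeasure (translate t \<mu>) A) \<in> borel_measurable configs"
    by (rule measurable_cong[THEN iffD1, rotated])
       (simp add: emeasure_translate[OF sets_configs])
qed (simp add: translate_configs)

section \<open>Unordered pairs and their translations\<close>

lemma sets_uprod_borel:
  "sets (uprod_borel :: ('a::euclidean_space) uprod measure) =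
    {E. (\<lambda>(x, y). Upair x y) -` E \<in> sets borel}"
  unfolding uprod_borel_def
proof (subst sets_measure_of)
  \<comment> \<open>The sets with Borel preimage already form a \<sigma>-algebra, so generating from
    them adds nothing.\<close>
  interpret sigma_algebra UNIV "{E::'a uprod set. (\<lambda>(x, y). Upair x y) -` E \<in> sets borel}"
  proof (unfold sigma_algebra_iff2, intro conjI ballI allI impI)
    fix E :: "'a uprod set" assume "E \<in> {E. (\<lambda>(x, y). Upair x y) -` E \<in> sets borel}"
    then show "UNIV - E \<in> {E. (\<lambda>(x, y). Upair x y) -` E \<in> sets borel}"
      by (simp add: vimage_Diff sets.Diff)
  next
    fix E :: "nat \<Rightarrow> 'a uprod set" assume "range E \<subseteq> {E. (\<lambda>(x, y). Upair x y) -` E \<in> sets borel}"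
    then show "\<Union> (range E) \<in> {E. (\<lambda>(x, y). Upair x y) -` E \<in> sets borel}"
      by (auto simp: vimage_Union intro!: sets.countable_UN')
  qed auto
  show "sigma_sets UNIV {E::'a uprod set. (\<lambda>(x, y). Upair x y) -` E \<in> sets borel} =
      {E. (\<lambda>(x, y). Upair x y) -` E \<in> sets borel}"
    by (rule sigma_sets_eq)
qed auto

lemma space_uprod_borel [simp]: "space uprod_borel = UNIV"
  unfolding uprod_borel_def by (intro space_measure_of) auto

lemma measurable_Upair [measurable]:
  "(\<lambda>(x, y). Upair x y) \<in> borel \<Otimes>\<^sub>M borel \<rightarrow>\<^sub>M (uprod_borel :: ('a::euclidean_space) uprod measure)"
  unfolding borel_prod by (rule measurableI) (auto simp: sets_uprod_borel)

lemma singleton_uprod_borel: "{e} \<in> sets (uprod_borel :: ('a::euclidean_space) uprod measure)"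
proof (cases e)
  case (Upair x y)
  then have "(\<lambda>(x, y). Upair x y) -` {e} = {(x, y), (y, x)}" by auto
  then show ?thesis by (simp add: sets_uprod_borel)
qed

lemma measurable_map_uprod_translate:
  "map_uprod (\<lambda>x. x + t) \<in> uprod_borel \<rightarrow>\<^sub>M (uprod_borel :: ('a::euclidean_space) uprod measure)"
proof (rule measurableI)
  fix E :: "'a uprod set" assume "E \<in> sets uprod_borel"
  then have "(\<lambda>(x, y). Upair x y) -` E \<in> sets (borel \<Otimes>\<^sub>M borel)"
    unfolding borel_prod by (simp add: sets_uprod_borel)
  then have "(\<lambda>(x, y). (x + t, y + t)) -` ((\<lambda>(x, y). Upair x y) -` E) \<inter> space (borel \<Otimes>\<^sub>M borel)
      \<in> sets (borel \<Otimes>\<^sub>M borel :: ('a \<times> 'a) measure)"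
    by (rule measurable_sets[rotated]) measurable
  moreover have "(\<lambda>(x, y). (x + t, y + t)) -` ((\<lambda>(x, y). Upair x y) -` E) \<inter> space (borel \<Otimes>\<^sub>M borel) =
      (\<lambda>(x, y). Upair x y) -` (map_uprod (\<lambda>x. x + t) -` E)"
    by (auto simp: space_pair_measure)
  ultimately show "map_uprod (\<lambda>x. x + t) -` E \<inter> space uprod_borel \<in> sets uprod_borel"
    unfolding borel_prod by (simp add: sets_uprod_borel)
qed simp

lemma emeasure_translate_pairs:
  assumes "sets m = sets uprod_borel" "E \<in> sets uprod_borel"
  shows "emeasure (translate_pairs t m) E = emeasure m (map_uprod (\<lambda>x. x + t) -` E)"
  unfolding translate_pairs_def using assms measurable_map_uprod_translate sets_eq_imp_space_eq[OF assms(1)]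
  by (subst emeasure_distr) (auto simp: measurable_cong_sets[OF assms(1) refl])

lemma translate_pairs_configs:
  assumes m: "m \<in> point_measures uprod_borel bounded_pairs"
  shows "translate_pairs t m \<in> point_measures uprod_borel bounded_pairs"
proof -
  have "\<exists>n::nat. emeasure m (map_uprod (\<lambda>x. x + t) -` E) = of_nat n"
    if E: "E \<in> sets uprod_borel" "bounded_pairs E" for E
  proof -
    have "map_uprod (\<lambda>x. x + t) -` E \<in> sets uprod_borel"
      using measurable_sets[OF measurable_map_uprod_translate E(1)] by simp
    moreover have "bounded_pairs (map_uprod (\<lambda>x. x + t) -` E)"
      unfolding bounded_pairs_def
    proof (rule bounded_subset)
      show "bounded ((\<lambda>x. x - t) ` (\<Union>e\<in>E. set_uprod e))"
        using E(2) unfolding bounded_pairs_def by (rule bounded_translation_minus)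
      show "\<Union> (set_uprod ` map_uprod (\<lambda>x. x + t) -` E) \<subseteq> (\<lambda>x. x - t) ` (\<Union>e\<in>E. set_uprod e)"
      proof
        fix x assume "x \<in> \<Union> (set_uprod ` map_uprod (\<lambda>x. x + t) -` E)"
        then obtain e where e: "map_uprod (\<lambda>x. x + t) e \<in> E" "x \<in> set_uprod e" by auto
        then have "x + t \<in> set_uprod (map_uprod (\<lambda>x. x + t) e)" by (simp add: uprod.set_map)
        with e(1) show "x \<in> (\<lambda>x. x - t) ` (\<Union>e\<in>E. set_uprod e)" by force
      qed
    qed
    ultimately show ?thesis using m by (auto simp: point_measures_def)
  qed
  then show ?thesis
    using sets_point_measure[OF m]
    by (simp add: point_measures_def emeasure_translate_pairs translate_pairs_def[of t m, THEN arg_cong[where f=sets]])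
qed

lemma measurable_translate_pairs: "translate_pairs t \<in> pair_configs \<rightarrow>\<^sub>M pair_configs"
proof (rule measurable_point_measure_spaceI)
  fix E :: "'a uprod set" assume E: "E \<in> sets uprod_borel"
  have "map_uprod (\<lambda>x. x + t) -` E \<in> sets uprod_borel"
    using measurable_sets[OF measurable_map_uprod_translate E] by simp
  from measurable_emeasure_point_measure_space[OF this]
  show "(\<lambda>m. emeasure (translate_pairs t m) E) \<in> borel_measurable pair_configs"
    by (rule measurable_cong[THEN iffD1, rotated])
       (simp add: emeasure_translate_pairs[OF sets_point_measure] E)
qed (simp add: translate_pairs_configs)

text \<open>
  The diagonal of \<^term>\<open>uprod_borel\<close> is measurable because a pair is separated from any other pair
  by a product of basic open sets.
\<close>

lemma pred_eq_Upair:
  "Measurable.pred ((borel \<Otimes>\<^sub>M borel) \<Otimes>\<^sub>M (uprod_borel :: ('a::euclidean_space) uprod measure))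
    (\<lambda>((x, y), e). e = Upair x y)"
proof -
  obtain D :: "'a set set" where D: "countable D" "topological_basis D"
    using ex_countable_basis by blast
  have Dopen: "open U" if "U \<in> D" for U using topological_basis_open[OF D(2) that] .
  define pairs where "pairs U V = {e. \<exists>x\<in>U. \<exists>y\<in>V. e = Upair x y}" for U V :: "'a set"
  have pairs: "pairs U V \<in> sets uprod_borel" if "open U" "open V" for U V
  proof -
    have "(\<lambda>(x, y). Upair x y) -` pairs U V = U \<times> V \<union> V \<times> U" by (auto simp: pairs_def) blast+
    with that show ?thesis by (auto simp: sets_uprod_borel intro!: borel_open open_Times)
  qed
  have eq: "e = Upair x y \<longleftrightarrow> (\<forall>U\<in>D. \<forall>V\<in>D. x \<in> U \<and> y \<in> V \<longrightarrow> e \<in> pairs U V)" for e x y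
  proof
    assume "e = Upair x y" then show "\<forall>U\<in>D. \<forall>V\<in>D. x \<in> U \<and> y \<in> V \<longrightarrow> e \<in> pairs U V"
      by (auto simp: pairs_def)
  next
    assume *: "\<forall>U\<in>D. \<forall>V\<in>D. x \<in> U \<and> y \<in> V \<longrightarrow> e \<in> pairs U V"
    show "e = Upair x y"
    proof (rule ccontr)
      assume ne: "e \<noteq> Upair x y"
      obtain u v where e: "e = Upair u v" by (cases e)
      have "(x, y) \<in> - {(u, v), (v, u)}" using ne by (auto simp: e)
      moreover have "open (- {(u, v), (v, u)})" by (intro open_Compl) auto
      ultimately obtain U V where UV: "open U" "open V" "x \<in> U" "y \<in> V" "U \<times> V \<subseteq> - {(u, v), (v, u)}"
        unfolding open_prod_def by (meson mem_Sigma_iff)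
      obtain U' where U': "U' \<in> D" "x \<in> U'" "U' \<subseteq> U"
        using topological_basisE[OF D(2) UV(1,3)] by blast
      obtain V' where V': "V' \<in> D" "y \<in> V'" "V' \<subseteq> V"
        using topological_basisE[OF D(2) UV(2,4)] by blast
      have "e \<in> pairs U' V'" using * U' V' by blast
      then have "(u, v) \<in> U \<times> V \<or> (v, u) \<in> U \<times> V" using U' V' by (auto simp: pairs_def e)
      with UV(5) show False by auto
    qed
  qed
  have "Measurable.pred ((borel \<Otimes>\<^sub>M borel) \<Otimes>\<^sub>M (uprod_borel :: 'a uprod measure))
      (\<lambda>p. \<forall>U\<in>D. \<forall>V\<in>D. fst (fst p) \<in> U \<and> snd (fst p) \<in> V \<longrightarrow> snd p \<in> pairs U V)"
    unfolding pred_def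
  proof (intro sets.sets_Collect_countable_All'[OF _ D(1)], fold pred_def, intro pred_intros_logic)
    fix U V assume UV: "U \<in> D" "V \<in> D"
    have [measurable]: "U \<in> sets borel" "V \<in> sets borel" "pairs U V \<in> sets uprod_borel"
      using UV by (auto intro!: pairs borel_open Dopen)
    show "Measurable.pred ((borel \<Otimes>\<^sub>M borel) \<Otimes>\<^sub>M (uprod_borel :: 'a uprod measure)) (\<lambda>p. fst (fst p) \<in> U)"
      "Measurable.pred ((borel \<Otimes>\<^sub>M borel) \<Otimes>\<^sub>M (uprod_borel :: 'a uprod measure)) (\<lambda>p. snd (fst p) \<in> V)"
      "Measurable.pred ((borel \<Otimes>\<^sub>M borel) \<Otimes>\<^sub>M (uprod_borel :: 'a uprod measure)) (\<lambda>p. snd p \<in> pairs U V)"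
      by measurable
  qed
  then show ?thesis by (simp add: eq case_prod_beta')
qed

text \<open>The singleton varies with \<open>x\<close> and \<open>y\<close>, so measurability of the
  evaluations at fixed sets does not suffice. It is a section of the measurable relation
  \<open>pred_eq_Upair\<close>, and the pairs inside growing balls are the bounded
  exhaustion.\<close>

lemma measurable_emeasure_Upair:
  "(\<lambda>(m, x, y). emeasure m {Upair x y}) \<in>
    borel_measurable ((pair_configs :: ('a::euclidean_space) uprod measure measure) \<Otimes>\<^sub>M borel \<Otimes>\<^sub>M borel)"
    (is "_ \<in> borel_measurable ?N")
proof -
  let ?W = "{p \<in> space (?N \<Otimes>\<^sub>M uprod_borel). snd p = Upair (fst (snd (fst p))) (snd (snd (fst p)))}"
  define C where "C k = {e. set_uprod e \<subseteq> cball (0::'a) (real k)}" for k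
  have C: "(\<lambda>(x, y). Upair x y) -` C k = cball 0 (real k) \<times> cball 0 (real k)" for k
    by (auto simp: C_def)
  have "(\<lambda>p. (snd (fst p), snd p)) \<in> ?N \<Otimes>\<^sub>M uprod_borel \<rightarrow>\<^sub>M
      (borel \<Otimes>\<^sub>M borel) \<Otimes>\<^sub>M (uprod_borel :: 'a uprod measure)"
    by measurable
  from measurable_compose[OF this pred_eq_Upair]
  have "Measurable.pred (?N \<Otimes>\<^sub>M uprod_borel) (\<lambda>p. snd p = Upair (fst (snd (fst p))) (snd (snd (fst p))))"
    by (simp add: case_prod_beta')
  then have "?W \<in> sets (?N \<Otimes>\<^sub>M uprod_borel)" by (simp add: case_prod_beta' pred_def)
  moreover have "C k \<in> sets uprod_borel" "bounded_pairs (C k)" for k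
    unfolding bounded_pairs_def
    by (auto simp: sets_uprod_borel C intro!: borel_closed closed_Times bounded_subset[OF bounded_cball, of _ 0 "real k"])
       (auto simp: C_def)
  moreover have "incseq C" by (force simp: incseq_def C_def)
  moreover have "(\<Union>k. C k) = space uprod_borel"
  proof -
    have "\<exists>k. e \<in> C k" for e
    proof (cases e)
      case (Upair x y)
      obtain k::nat where "max (norm x) (norm y) \<le> real k" using real_arch_simple by blast
      then show ?thesis by (auto simp: C_def Upair)
    qed
    then show ?thesis by auto
  qed
  ultimately have "(\<lambda>\<omega>. emeasure (fst \<omega>) (Pair \<omega> -` ?W)) \<in> borel_measurable ?N"
    by (intro measurable_emeasure_kernel[where C=C and bdd=bounded_pairs]) auto
  then show ?thesis
    by (rule measurable_cong[THEN iffD1, rotated])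
       (auto intro!: arg_cong2[where f=emeasure] simp: space_pair_measure)
qed

section \<open>Mass transport\<close>

lemma nn_integral_lborel_unit_cube:
  fixes y :: "'a::euclidean_space"
  shows "(\<integral>\<^sup>+t. indicator (cbox 0 One) (y - t) \<partial>lborel) = 1"
    and "(\<integral>\<^sup>+t. indicator (cbox 0 One) (y + t) \<partial>lborel) = 1"
proof -
  have "(\<integral>\<^sup>+t. indicator (cbox 0 One) (y - t) \<partial>lborel) = (\<integral>\<^sup>+t. indicator (cbox (y - One) y) t \<partial>lborel)"
  proof (rule nn_integral_cong)
    fix t :: 'a
    have "y - t \<in> cbox 0 One \<longleftrightarrow> t \<in> cbox (y - One) y"
      unfolding mem_box by (intro ball_cong refl) (auto simp: inner_diff_left)
    then show "indicator (cbox 0 One) (y - t) = (indicator (cbox (y - One) y) t :: ennreal)"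
      by (simp add: indicator_def)
  qed
  also have "\<dots> = 1" by (simp add: emeasure_lborel_cbox_eq inner_diff_left)
  finally show "(\<integral>\<^sup>+t. indicator (cbox 0 One) (y - t) \<partial>lborel) = 1" .
  have "(\<integral>\<^sup>+t. indicator (cbox 0 One) (y + t) \<partial>lborel) = (\<integral>\<^sup>+t. indicator (cbox (- y) (One - y)) t \<partial>lborel)"
  proof (rule nn_integral_cong)
    fix t :: 'a
    have "y + t \<in> cbox 0 One \<longleftrightarrow> t \<in> cbox (- y) (One - y)"
      unfolding mem_box by (intro ball_cong refl) (auto simp: inner_diff_left inner_add_left)
    then show "indicator (cbox 0 One) (y + t) = (indicator (cbox (- y) (One - y)) t :: ennreal)"
      by (simp add: indicator_def)
  qed
  also have "\<dots> = 1" by (simp add: emeasure_lborel_cbox_eq inner_diff_left)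
  finally show "(\<integral>\<^sup>+t. indicator (cbox 0 One) (y + t) \<partial>lborel) = 1" .
qed

text \<open>\<open>M'\<close> and \<open>N'\<close> are reference spaces with the same measurable
  sets. Measurability can thus be checked over \<open>borel\<close>, although the measures
  themselves come from a random configuration.\<close>

lemma nn_integral_swap:
  assumes "sigma_finite_measure M" "sigma_finite_measure N" "sets M = sets M'" "sets N = sets N'"
    and "(\<lambda>(x, y). f x y) \<in> borel_measurable (M' \<Otimes>\<^sub>M N')"
  shows "(\<integral>\<^sup>+x. \<integral>\<^sup>+y. f x y \<partial>N \<partial>M) = (\<integral>\<^sup>+y. \<integral>\<^sup>+x. f x y \<partial>M \<partial>N)"
proof -
  interpret pair_sigma_finite M N using assms by (simp add: pair_sigma_finite_def)
  have "(\<lambda>(x, y). f x y) \<in> borel_measurable (M \<Otimes>\<^sub>M N)"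
    using assms by (simp add: measurable_cong_sets[OF sets_pair_measure_cong[OF assms(3,4)] refl])
  then show ?thesis by (rule Fubini'[symmetric])
qed

text \<open>The state space stays abstract because it is used both for the four marked components
  and for the five components that include a scheme. All that matters is a pair of point measures
  depending equivariantly on an invariant state.\<close>

locale stationary_kernels = prob_space P for P :: "'w measure" +
  fixes S :: "'s measure" and T :: "'a::euclidean_space \<Rightarrow> 's \<Rightarrow> 's" and Z :: "'w \<Rightarrow> 's"
    and R B :: "'s \<Rightarrow> 'a measure"
  assumes inv: "translation_invariant P S T Z"
    and measurable_T [measurable]: "T t \<in> S \<rightarrow>\<^sub>M S"
    and measurable_R [measurable]: "R \<in> S \<rightarrow>\<^sub>M configs"
    and measurable_B [measurable]: "B \<in> S \<rightarrow>\<^sub>M configs"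
    and R_T: "z \<in> space S \<Longrightarrow> R (T t z) = translate t (R z)"
    and B_T: "z \<in> space S \<Longrightarrow> B (T t z) = translate t (B z)"
begin

lemma measurable_Z [measurable]: "Z \<in> P \<rightarrow>\<^sub>M S"
  using inv by (simp add: translation_invariant_def)

lemma nn_integral_invariant:
  assumes [measurable]: "F \<in> borel_measurable S"
  shows "(\<integral>\<^sup>+\<omega>. F (T t (Z \<omega>)) \<partial>P) = (\<integral>\<^sup>+\<omega>. F (Z \<omega>) \<partial>P)"
proof -
  have "(\<integral>\<^sup>+\<omega>. F (T t (Z \<omega>)) \<partial>P) = (\<integral>\<^sup>+z. F z \<partial>distr P S (\<lambda>\<omega>. T t (Z \<omega>)))"
    by (subst nn_integral_distr) auto
  also have "\<dots> = (\<integral>\<^sup>+z. F z \<partial>distr P S Z)"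
    using inv by (simp add: translation_invariant_def)
  also have "\<dots> = (\<integral>\<^sup>+\<omega>. F (Z \<omega>) \<partial>P)"
    by (subst nn_integral_distr) auto
  finally show ?thesis .
qed

lemma R_configs: "z \<in> space S \<Longrightarrow> R z \<in> point_measures borel bounded"
  and B_configs: "z \<in> space S \<Longrightarrow> B z \<in> point_measures borel bounded"
  using measurable_space[OF measurable_R] measurable_space[OF measurable_B] by auto

text \<open>
  Both lemmas below insert \<open>1 = \<integral> indicator (cbox 0 One) (x - t) dt\<close>, exchange the integrals, and
  use invariance for each fixed \<open>t\<close>, instead of tiling the space by unit cubes.
\<close>

lemma stationary_total:
  assumes f [measurable]: "f \<in> borel_measurable (S \<Otimes>\<^sub>M borel)"
    and f_T: "\<And>z x t. z \<in> space S \<Longrightarrow> f (T t z, x + t) = f (z, x)"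
  shows "(\<integral>\<^sup>+\<omega>. (\<integral>\<^sup>+x. f (Z \<omega>, x) \<partial>R (Z \<omega>)) \<partial>P) =
    \<infinity> * (\<integral>\<^sup>+\<omega>. (\<integral>\<^sup>+x. indicator (cbox 0 One) x * f (Z \<omega>, x) \<partial>R (Z \<omega>)) \<partial>P)"
proof -
  let ?A = "cbox (0::'a) One"
  have Zs: "Z \<omega> \<in> space S" if "\<omega> \<in> space P" for \<omega>
    using measurable_space[OF measurable_Z that] .
  define F where "F t z = (\<integral>\<^sup>+x. indicator ?A (x - t) * f (z, x) \<partial>R z)" for t z
  have F [measurable]: "(\<lambda>(\<omega>, t). F t (Z \<omega>)) \<in> borel_measurable (P \<Otimes>\<^sub>M lborel)"
    unfolding F_def by measurable
  have F' [measurable]: "F t \<in> borel_measurable S" for t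
    unfolding F_def[abs_def] by measurable
  have "(\<integral>\<^sup>+x. f (z, x) \<partial>R z) = (\<integral>\<^sup>+t. F t z \<partial>lborel)" if z: "z \<in> space S" for z
  proof -
    have [measurable]: "(\<lambda>x. f (z, x)) \<in> borel_measurable borel"
      using z by measurable
    have "(\<integral>\<^sup>+x. f (z, x) \<partial>R z) = (\<integral>\<^sup>+x. (\<integral>\<^sup>+t. indicator ?A (x - t) * f (z, x) \<partial>lborel) \<partial>R z)"
      by (subst nn_integral_multc) (auto simp: nn_integral_lborel_unit_cube)
    also have "\<dots> = (\<integral>\<^sup>+t. F t z \<partial>lborel)"
      unfolding F_def
      by (rule nn_integral_swap[OF sigma_finite_configs[OF R_configs[OF z]] lborel.sigma_finite_measure_axioms
            sets_configs[OF R_configs[OF z]] refl]) measurable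
    finally show ?thesis .
  qed
  then have "(\<integral>\<^sup>+\<omega>. (\<integral>\<^sup>+x. f (Z \<omega>, x) \<partial>R (Z \<omega>)) \<partial>P) = (\<integral>\<^sup>+\<omega>. (\<integral>\<^sup>+t. F t (Z \<omega>) \<partial>lborel) \<partial>P)"
    using Zs by (intro nn_integral_cong) auto
  also have "\<dots> = (\<integral>\<^sup>+t. (\<integral>\<^sup>+\<omega>. F t (Z \<omega>) \<partial>P) \<partial>lborel)"
    by (rule nn_integral_swap[OF sigma_finite_measure_axioms lborel.sigma_finite_measure_axioms refl refl]) measurable
  also have "\<dots> = (\<integral>\<^sup>+t. (\<integral>\<^sup>+\<omega>. F 0 (Z \<omega>) \<partial>P) \<partial>(lborel :: 'a measure))"
  proof (rule nn_integral_cong)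
    fix t
    have "F t (T t z) = F 0 z" if z: "z \<in> space S" for z
    proof -
      have [measurable]: "(\<lambda>x. f (T t z, x)) \<in> borel_measurable borel"
        using measurable_space[OF measurable_T z] by measurable
      show ?thesis
        unfolding F_def R_T[OF z]
        by (subst nn_integral_translate[OF sets_configs[OF R_configs[OF z]]]) (auto simp: f_T[OF z])
    qed
    then have "(\<integral>\<^sup>+\<omega>. F 0 (Z \<omega>) \<partial>P) = (\<integral>\<^sup>+\<omega>. F t (T t (Z \<omega>)) \<partial>P)"
      using Zs by (intro nn_integral_cong) auto
    then show "(\<integral>\<^sup>+\<omega>. F t (Z \<omega>) \<partial>P) = (\<integral>\<^sup>+\<omega>. F 0 (Z \<omega>) \<partial>P)"
      using nn_integral_invariant[OF F', of t t] by simp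
  qed
  \<comment> \<open>The inner integral no longer depends on \<open>t\<close>, and the whole space
    has infinite volume.\<close>
  also have "\<dots> = \<infinity> * (\<integral>\<^sup>+\<omega>. F 0 (Z \<omega>) \<partial>P)"
    by (simp add: emeasure_lborel_UNIV mult.commute)
  finally show ?thesis by (simp add: F_def)
qed

lemma mass_transport:
  assumes f [measurable]: "f \<in> borel_measurable (S \<Otimes>\<^sub>M borel \<Otimes>\<^sub>M borel)"
    and f_T: "\<And>z x y t. z \<in> space S \<Longrightarrow> f (T t z, x + t, y + t) = f (z, x, y)"
  shows "(\<integral>\<^sup>+\<omega>. (\<integral>\<^sup>+x. indicator (cbox 0 One) x * (\<integral>\<^sup>+y. f (Z \<omega>, x, y) \<partial>B (Z \<omega>)) \<partial>R (Z \<omega>)) \<partial>P) =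
    (\<integral>\<^sup>+\<omega>. (\<integral>\<^sup>+y. indicator (cbox 0 One) y * (\<integral>\<^sup>+x. f (Z \<omega>, x, y) \<partial>R (Z \<omega>)) \<partial>B (Z \<omega>)) \<partial>P)"
proof -
  let ?A = "cbox (0::'a) One"
  have Zs: "Z \<omega> \<in> space S" if "\<omega> \<in> space P" for \<omega>
    using measurable_space[OF measurable_Z that] .
  \<comment> \<open>The mass sent from the cube shifted by \<open>- u\<close> to the cube shifted by
    \<open>t - u\<close>. For \<open>u = 0\<close> the source is the unit cube, for
    \<open>u = t\<close> the target is, and translation by \<open>t\<close> carries one case into
    the other.\<close>
  define F where "F u t z =
      (\<integral>\<^sup>+x. (\<integral>\<^sup>+y. indicator ?A (x + u) * (indicator ?A (y + u - t) * f (z, x, y)) \<partial>B z) \<partial>R z)" for u t z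
  have F [measurable]: "(\<lambda>(\<omega>, t). F 0 t (Z \<omega>)) \<in> borel_measurable (P \<Otimes>\<^sub>M lborel)"
      "(\<lambda>(\<omega>, t). F t t (Z \<omega>)) \<in> borel_measurable (P \<Otimes>\<^sub>M lborel)"
    unfolding F_def by measurable
  have F' [measurable]: "F u t \<in> borel_measurable S" for u t
    unfolding F_def[abs_def] by measurable
  have fz: "(\<lambda>(x, y). f (z, x, y)) \<in> borel_measurable (borel \<Otimes>\<^sub>M borel)" if "z \<in> space S" for z
    using that by measurable
  note swapR = nn_integral_swap[OF sigma_finite_configs[OF R_configs] lborel.sigma_finite_measure_axioms
      sets_configs[OF R_configs] refl]
  note swapB = nn_integral_swap[OF sigma_finite_configs[OF B_configs] lborel.sigma_finite_measure_axioms
      sets_configs[OF B_configs] refl]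
  note swapRB = nn_integral_swap[OF sigma_finite_configs[OF R_configs] sigma_finite_configs[OF B_configs]
      sets_configs[OF R_configs] sets_configs[OF B_configs]]
  have L: "(\<integral>\<^sup>+x. indicator ?A x * (\<integral>\<^sup>+y. f (z, x, y) \<partial>B z) \<partial>R z) = (\<integral>\<^sup>+t. F 0 t z \<partial>lborel)"
    if z: "z \<in> space S" for z
  proof -
    note [measurable] = fz[OF z]
    note [measurable_cong] = sets_configs[OF R_configs[OF z]] sets_configs[OF B_configs[OF z]]
    interpret Bz: sigma_finite_measure "B z" by (rule sigma_finite_configs[OF B_configs[OF z]])
    have "(\<integral>\<^sup>+x. indicator ?A x * (\<integral>\<^sup>+y. f (z, x, y) \<partial>B z) \<partial>R z) =
        (\<integral>\<^sup>+x. (\<integral>\<^sup>+y. (\<integral>\<^sup>+t. indicator ?A x * (indicator ?A (y - t) * f (z, x, y)) \<partial>lborel) \<partial>B z) \<partial>R z)"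
      by (simp add: nn_integral_cmult nn_integral_multc nn_integral_lborel_unit_cube)
    also have "\<dots> = (\<integral>\<^sup>+x. (\<integral>\<^sup>+t. (\<integral>\<^sup>+y. indicator ?A x * (indicator ?A (y - t) * f (z, x, y)) \<partial>B z) \<partial>lborel) \<partial>R z)"
      by (intro nn_integral_cong swapB[OF z z]) measurable
    also have "\<dots> = (\<integral>\<^sup>+t. F 0 t z \<partial>lborel)"
      unfolding F_def by (subst swapR[OF z z]) (simp_all, measurable)
    finally show ?thesis .
  qed
  have Rt: "(\<integral>\<^sup>+y. indicator ?A y * (\<integral>\<^sup>+x. f (z, x, y) \<partial>R z) \<partial>B z) = (\<integral>\<^sup>+t. F t t z \<partial>lborel)"
    if z: "z \<in> space S" for z
  proof -
    note [measurable] = fz[OF z]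
    note [measurable_cong] = sets_configs[OF R_configs[OF z]] sets_configs[OF B_configs[OF z]]
    interpret Rz: sigma_finite_measure "R z" by (rule sigma_finite_configs[OF R_configs[OF z]])
    interpret Bz: sigma_finite_measure "B z" by (rule sigma_finite_configs[OF B_configs[OF z]])
    have "(\<integral>\<^sup>+y. indicator ?A y * (\<integral>\<^sup>+x. f (z, x, y) \<partial>R z) \<partial>B z) =
        (\<integral>\<^sup>+y. (\<integral>\<^sup>+x. indicator ?A y * f (z, x, y) \<partial>R z) \<partial>B z)"
      by (simp add: nn_integral_cmult)
    also have "\<dots> = (\<integral>\<^sup>+x. (\<integral>\<^sup>+y. indicator ?A y * f (z, x, y) \<partial>B z) \<partial>R z)"
      by (rule swapRB[OF z z z z, symmetric]) measurable
    also have "\<dots> =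
        (\<integral>\<^sup>+x. (\<integral>\<^sup>+y. (\<integral>\<^sup>+t. indicator ?A (x + t) * (indicator ?A y * f (z, x, y)) \<partial>lborel) \<partial>B z) \<partial>R z)"
      by (simp add: nn_integral_multc nn_integral_lborel_unit_cube)
    also have "\<dots> =
        (\<integral>\<^sup>+x. (\<integral>\<^sup>+t. (\<integral>\<^sup>+y. indicator ?A (x + t) * (indicator ?A y * f (z, x, y)) \<partial>B z) \<partial>lborel) \<partial>R z)"
      by (intro nn_integral_cong swapB[OF z z]) measurable
    also have "\<dots> = (\<integral>\<^sup>+t. F t t z \<partial>lborel)"
      unfolding F_def by (subst swapR[OF z z]) (simp_all, measurable)
    finally show ?thesis .
  qed
  have "(\<integral>\<^sup>+\<omega>. F 0 t (Z \<omega>) \<partial>P) = (\<integral>\<^sup>+\<omega>. F t t (Z \<omega>) \<partial>P)" for t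
  proof -
    have "F 0 t (T t z) = F t t z" if z: "z \<in> space S" for z
    proof -
      have Tz: "T t z \<in> space S" by (rule measurable_space[OF measurable_T z])
      note [measurable] = fz[OF Tz]
      note [measurable_cong] = sets_configs[OF R_configs[OF z]] sets_configs[OF B_configs[OF z]]
      interpret Bz: sigma_finite_measure "B z" by (rule sigma_finite_configs[OF B_configs[OF z]])
      interpret BTz: sigma_finite_measure "translate t (B z)"
        using sigma_finite_configs[OF B_configs[OF Tz]] by (simp add: B_T[OF z])
      have [measurable_cong]: "sets (translate t (B z)) = sets borel" by (simp add: translate_def)
      have "F 0 t (T t z) = (\<integral>\<^sup>+x. (\<integral>\<^sup>+y. indicator ?A x * (indicator ?A (y - t) * f (T t z, x, y))
          \<partial>translate t (B z)) \<partial>translate t (R z))"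
        by (simp add: F_def R_T[OF z] B_T[OF z])
      also have "\<dots> = (\<integral>\<^sup>+x. (\<integral>\<^sup>+y. indicator ?A (x + t) * (indicator ?A (y - t) * f (T t z, x + t, y))
          \<partial>translate t (B z)) \<partial>R z)"
        by (subst nn_integral_translate[OF sets_configs[OF R_configs[OF z]]]) (simp_all, measurable)
      also have "\<dots> = (\<integral>\<^sup>+x. (\<integral>\<^sup>+y. indicator ?A (x + t) * (indicator ?A (y + t - t) * f (T t z, x + t, y + t))
          \<partial>B z) \<partial>R z)"
        by (intro nn_integral_cong, subst nn_integral_translate[OF sets_configs[OF B_configs[OF z]]]) auto
      also have "\<dots> = F t t z"
        by (simp add: F_def f_T[OF z])
      finally show ?thesis .
    qed
    then have "(\<integral>\<^sup>+\<omega>. F t t (Z \<omega>) \<partial>P) = (\<integral>\<^sup>+\<omega>. F 0 t (T t (Z \<omega>)) \<partial>P)"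
      using Zs by (intro nn_integral_cong) auto
    then show ?thesis
      using nn_integral_invariant[OF F', of 0 t t] by simp
  qed
  then have "(\<integral>\<^sup>+\<omega>. (\<integral>\<^sup>+t. F 0 t (Z \<omega>) \<partial>lborel) \<partial>P) = (\<integral>\<^sup>+\<omega>. (\<integral>\<^sup>+t. F t t (Z \<omega>) \<partial>lborel) \<partial>P)"
    using nn_integral_swap[OF sigma_finite_measure_axioms lborel.sigma_finite_measure_axioms refl refl F(1)]
      nn_integral_swap[OF sigma_finite_measure_axioms lborel.sigma_finite_measure_axioms refl refl F(2)]
    by simp
  then show ?thesis
    using Zs by (simp add: L Rt cong: nn_integral_cong)
qed

end

section \<open>Stable multi-matching\<close>

text \<open>Degrees are masses of partner sets under the opposite color rather than cardinalities:
  the two agree for simple measures, and the masses depend measurably on the configuration by the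
  kernel lemmas.\<close>

definition free :: "('a::euclidean_space) measure \<Rightarrow> 'a measure \<Rightarrow> 'a measure \<Rightarrow> 'a measure
    \<Rightarrow> ('a \<Rightarrow> 'a \<Rightarrow> bool) \<Rightarrow> 'a \<Rightarrow> 'a \<Rightarrow> bool" where
  "free r hr b hb E x y \<longleftrightarrow> x \<in> atoms r \<and> y \<in> atoms b \<and> \<not> E x y \<and>
     emeasure b {y'. E x y'} < emeasure hr {x} \<and> emeasure r {x'. E x' y} < emeasure hb {y}"

text \<open>
  One round joins all pairs that are mutually closest among the free pairs. ``No closer point'' is
  expressed by a null set, so that measurability of all rounds follows from kernel integrals.
\<close>

definition step :: "('a::euclidean_space) measure \<Rightarrow> 'a measure \<Rightarrow> 'a measure \<Rightarrow> 'a measure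
    \<Rightarrow> ('a \<Rightarrow> 'a \<Rightarrow> bool) \<Rightarrow> 'a \<Rightarrow> 'a \<Rightarrow> bool" where
  "step r hr b hb E x y \<longleftrightarrow> E x y \<or> free r hr b hb E x y \<and>
     emeasure b {y'. free r hr b hb E x y' \<and> dist x y' < dist x y} = 0 \<and>
     emeasure r {x'. free r hr b hb E x' y \<and> dist x' y < dist x y} = 0"

primrec stage :: "('a::euclidean_space) measure \<Rightarrow> 'a measure \<Rightarrow> 'a measure \<Rightarrow> 'a measure
    \<Rightarrow> nat \<Rightarrow> 'a \<Rightarrow> 'a \<Rightarrow> bool" where
  "stage r hr b hb 0 = (\<lambda>_ _. False)"
| "stage r hr b hb (Suc n) = step r hr b hb (stage r hr b hb n)"

definition matched :: "('a::euclidean_space) measure \<Rightarrow> 'a measure \<Rightarrow> 'a measure \<Rightarrow> 'a measure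
    \<Rightarrow> 'a \<Rightarrow> 'a \<Rightarrow> bool" where
  "matched r hr b hb x y \<longleftrightarrow> (\<exists>n. stage r hr b hb n x y)"

section \<open>Exchange of colors and monotonicity of the rounds\<close>

lemma free_swap: "free b hb r hr (\<lambda>y x. E x y) y x \<longleftrightarrow> free r hr b hb E x y"
  by (auto simp: free_def)

lemma step_swap: "step b hb r hr (\<lambda>y x. E x y) y x \<longleftrightarrow> step r hr b hb E x y"
proof -
  have "free b hb r hr (\<lambda>y x. E x y) v u \<longleftrightarrow> free r hr b hb E u v" for u v
    by (rule free_swap)
  then show ?thesis by (auto simp: step_def dist_commute)
qed

lemma stage_swap: "stage b hb r hr n y x \<longleftrightarrow> stage r hr b hb n x y"
proof (induction n arbitrary: x y)
  case (Suc n)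
  then have "stage b hb r hr n = (\<lambda>y x. stage r hr b hb n x y)" by blast
  with step_swap[of b hb r hr "stage r hr b hb n" y x] show ?case by simp
qed simp

lemma matched_swap: "matched b hb r hr y x \<longleftrightarrow> matched r hr b hb x y"
  by (simp add: matched_def stage_swap)

lemma stage_Suc: "stage r hr b hb n x y \<Longrightarrow> stage r hr b hb (Suc n) x y"
  by (simp add: step_def)

lemma stage_mono: "m \<le> n \<Longrightarrow> stage r hr b hb m x y \<Longrightarrow> stage r hr b hb n x y"
  by (induction rule: dec_induct) (auto simp: step_def)

lemma stage_atoms: "stage r hr b hb n x y \<Longrightarrow> x \<in> atoms r \<and> y \<in> atoms b"
  by (induction n) (auto simp: step_def free_def)

lemma matched_atoms: "matched r hr b hb x y \<Longrightarrow> x \<in> atoms r \<and> y \<in> atoms b"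
  unfolding matched_def by (blast dest: stage_atoms)

subsection \<open>Equivariance and measurability\<close>

lemma vimage_Collect_translate: "(\<lambda>x. x + t) -` {x. Q x} = {x. Q (x + t)}"
  by auto

text \<open>\<open>E'\<close> is a relation of its own because, in the induction on the rounds, it
  is the previous round of the translated configuration, related to \<open>E\<close> only by the
  induction hypothesis.\<close>

lemma free_translate:
  assumes "sets r = sets borel" "sets hr = sets borel" "sets b = sets borel" "sets hb = sets borel"
    and "\<And>x y. E' (x + t) (y + t) \<longleftrightarrow> E x y"
  shows "free (translate t r) (translate t hr) (translate t b) (translate t hb) E' (x + t) (y + t) \<longleftrightarrow>
    free r hr b hb E x y"
  unfolding free_def atoms_translate[OF assms(1)] atoms_translate[OF assms(3)]
    emeasure_translate_singleton[OF assms(2)] emeasure_translate_singleton[OF assms(4)]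
    emeasure_translate[OF assms(1)] emeasure_translate[OF assms(3)] vimage_Collect_translate assms(5)
  ..

lemma step_translate:
  assumes "sets r = sets borel" "sets hr = sets borel" "sets b = sets borel" "sets hb = sets borel"
    and "\<And>x y. E' (x + t) (y + t) \<longleftrightarrow> E x y"
  shows "step (translate t r) (translate t hr) (translate t b) (translate t hb) E' (x + t) (y + t) \<longleftrightarrow>
    step r hr b hb E x y"
  unfolding step_def emeasure_translate[OF assms(1)] emeasure_translate[OF assms(3)]
    vimage_Collect_translate free_translate[OF assms(1-4), of E' t E, OF assms(5)] assms(5)
  by (simp add: dist_norm)

lemma stage_translate:
  assumes "sets r = sets borel" "sets hr = sets borel" "sets b = sets borel" "sets hb = sets borel"
  shows "stage (translate t r) (translate t hr) (translate t b) (translate t hb) n (x + t) (y + t) \<longleftrightarrow>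
    stage r hr b hb n x y"
  by (induction n arbitrary: x y) (simp_all add: step_translate[OF assms])

lemma matched_translate:
  assumes "sets r = sets borel" "sets hr = sets borel" "sets b = sets borel" "sets hb = sets borel"
  shows "matched (translate t r) (translate t hr) (translate t b) (translate t hb) (x + t) (y + t) \<longleftrightarrow>
    matched r hr b hb x y"
  by (simp add: matched_def stage_translate[OF assms])

lemma measurable_emeasure_singleton:
  fixes K :: "'w \<Rightarrow> ('a::euclidean_space) measure"
  assumes [measurable]: "K \<in> N \<rightarrow>\<^sub>M configs" "g \<in> borel_measurable N"
  shows "(\<lambda>\<omega>. emeasure (K \<omega>) {g \<omega>}) \<in> borel_measurable N"
proof -
  have "(\<lambda>\<omega>. emeasure (K \<omega>) {x. x = g \<omega>}) \<in> borel_measurable N"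
    by (rule measurable_emeasure_configs) measurable
  then show ?thesis by simp
qed

lemma measurable_atoms:
  fixes K :: "'w \<Rightarrow> ('a::euclidean_space) measure"
  assumes [measurable]: "K \<in> N \<rightarrow>\<^sub>M configs" "g \<in> borel_measurable N"
  shows "Measurable.pred N (\<lambda>\<omega>. g \<omega> \<in> atoms (K \<omega>))"
  using measurable_emeasure_singleton[OF assms] unfolding atoms_def by simp

text \<open>A relation that is jointly measurable in parameter and points is brought into a form
  usable at arbitrary measurable arguments, in particular under further binders.\<close>

lemma pred_compose3:
  assumes "Measurable.pred (N \<Otimes>\<^sub>M borel \<Otimes>\<^sub>M borel) (\<lambda>(\<omega>, x, y). E \<omega> x y)"
    and [measurable]: "f \<in> M \<rightarrow>\<^sub>M N" "g \<in> M \<rightarrow>\<^sub>M borel" "h \<in> M \<rightarrow>\<^sub>M borel"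
  shows "Measurable.pred M (\<lambda>p. E (f p) (g p) (h p))"
  using measurable_compose[OF _ assms(1), of "\<lambda>p. (f p, g p, h p)" M] by simp

context
  fixes N :: "'w measure" and r hr b hb :: "'w \<Rightarrow> ('a::euclidean_space) measure"
  assumes [measurable]: "r \<in> N \<rightarrow>\<^sub>M configs" "hr \<in> N \<rightarrow>\<^sub>M configs"
      "b \<in> N \<rightarrow>\<^sub>M configs" "hb \<in> N \<rightarrow>\<^sub>M configs"
begin

lemma pred_free:
  assumes E: "Measurable.pred (N \<Otimes>\<^sub>M borel \<Otimes>\<^sub>M borel) (\<lambda>(\<omega>, x, y). E \<omega> x y)"
  shows "Measurable.pred (N \<Otimes>\<^sub>M borel \<Otimes>\<^sub>M borel)
    (\<lambda>(\<omega>, x, y). free (r \<omega>) (hr \<omega>) (b \<omega>) (hb \<omega>) (E \<omega>) x y)"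
proof -
  note [measurable] = pred_compose3[OF E] measurable_emeasure_singleton measurable_atoms
  show ?thesis
    unfolding free_def case_prod_beta' by measurable
qed

lemma pred_step:
  assumes E: "Measurable.pred (N \<Otimes>\<^sub>M borel \<Otimes>\<^sub>M borel) (\<lambda>(\<omega>, x, y). E \<omega> x y)"
  shows "Measurable.pred (N \<Otimes>\<^sub>M borel \<Otimes>\<^sub>M borel)
    (\<lambda>(\<omega>, x, y). step (r \<omega>) (hr \<omega>) (b \<omega>) (hb \<omega>) (E \<omega>) x y)"
proof -
  note [measurable] = pred_compose3[OF E] pred_compose3[OF pred_free[OF E]]
  show ?thesis
    unfolding step_def case_prod_beta' by measurable
qed

lemma pred_matched:
  "Measurable.pred (N \<Otimes>\<^sub>M borel \<Otimes>\<^sub>M borel)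
    (\<lambda>(\<omega>, x, y). matched (r \<omega>) (hr \<omega>) (b \<omega>) (hb \<omega>) x y)"
proof -
  have "Measurable.pred (N \<Otimes>\<^sub>M borel \<Otimes>\<^sub>M borel)
      (\<lambda>(\<omega>, x, y). stage (r \<omega>) (hr \<omega>) (b \<omega>) (hb \<omega>) n x y)" for n
  proof (induction n)
    case (Suc n)
    from pred_step[OF this] show ?case by simp
  qed simp
  then show ?thesis
    unfolding matched_def case_prod_beta' by measurable
qed

end

subsection \<open>Stability\<close>

text \<open>An atom has a positive integer mass that is at most 1, hence mass 1, and the sum over
  the atoms in \<open>A\<close> becomes a count.\<close>

lemma emeasure_simple_measure:
  fixes \<mu> :: "('a::euclidean_space) measure"
  assumes \<mu>: "\<mu> \<in> point_measures borel bounded" and simple: "simple_measure \<mu>" and A: "A \<subseteq> atoms \<mu>"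
  shows "emeasure \<mu> A = emeasure (count_space UNIV) A"
proof -
  have one: "emeasure \<mu> {x} = 1" if "x \<in> atoms \<mu>" for x
  proof -
    obtain n::nat where n: "emeasure \<mu> {x} = of_nat n"
      using configs_nat[OF \<mu> borel_singleton[OF sets.empty_sets] bounded_insert[THEN iffD2, OF bounded_empty]] by blast
    moreover have "0 < emeasure \<mu> {x}" "emeasure \<mu> {x} \<le> 1"
      using that simple by (auto simp: atoms_def simple_measure_def)
    ultimately have "n \<noteq> 0" "(of_nat n :: ennreal) \<le> of_nat 1" by (auto intro: gr0I)
    then have "n = 1" unfolding of_nat_le_iff by simp
    then show ?thesis using n by simp
  qed
  have "A \<in> sets borel"
    by (rule borel_subset_atoms[OF \<mu> A])
  then have "emeasure \<mu> A = (\<integral>\<^sup>+x. indicator A x * emeasure \<mu> {x} \<partial>count_space (atoms \<mu>))"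
    by (subst nn_integral_point_measure[OF \<mu>, symmetric]) (auto simp: sets_configs[OF \<mu>])
  also have "\<dots> = (\<integral>\<^sup>+x. indicator A x \<partial>count_space (atoms \<mu>))"
    by (intro nn_integral_cong) (auto simp: one)
  also have "\<dots> = emeasure (count_space (atoms \<mu>)) A"
    using A by (intro nn_integral_indicator) auto
  also have "\<dots> = emeasure (count_space UNIV) A"
    using A by (simp add: emeasure_count_space)
  finally show ?thesis .
qed

text \<open>One realization outside the exceptional null sets. The combinatorics of the matching is
  deterministic and is carried out here, without probability.\<close>

locale bicolored_points =
  fixes r hr b hb :: "('a::euclidean_space) measure"
  assumes r: "r \<in> point_measures borel bounded" and hr: "hr \<in> point_measures borel bounded"
    and b: "b \<in> point_measures borel bounded" and hb: "hb \<in> point_measures borel bounded"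
    and simple_r: "simple_measure r" and simple_b: "simple_measure b"
    and disjoint: "atoms r \<inter> atoms b = {}"
    and non_equidistant: "non_equidistant (atoms r \<union> atoms b)"
    and no_chain: "\<nexists>x. descending_chain (atoms r \<union> atoms b) x"
begin

lemma swap: "bicolored_points b hb r hr"
  using r hr b hb simple_r simple_b disjoint non_equidistant no_chain
  by unfold_locales (auto simp: Un_commute)

abbreviation stg where "stg \<equiv> stage r hr b hb"
abbreviation mtch where "mtch \<equiv> matched r hr b hb"
abbreviation fr where "fr \<equiv> free r hr b hb"

lemma emeasure_r: "A \<subseteq> atoms r \<Longrightarrow> emeasure r A = emeasure (count_space UNIV) A"
  and emeasure_b: "A \<subseteq> atoms b \<Longrightarrow> emeasure b A = emeasure (count_space UNIV) A"
  using emeasure_simple_measure r b simple_r simple_b by auto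

lemma mark_nat: "\<exists>n::nat. emeasure hr {x} = of_nat n"
  by (rule configs_nat[OF hr]) auto

lemma emeasure_b_mono: "A \<subseteq> A' \<Longrightarrow> A' \<subseteq> atoms b \<Longrightarrow> emeasure b A \<le> emeasure b A'"
  using emeasure_b[of A] emeasure_b[of A'] emeasure_mono[of A A' "count_space UNIV"] by auto

lemma emeasure_r_mono: "A \<subseteq> A' \<Longrightarrow> A' \<subseteq> atoms r \<Longrightarrow> emeasure r A \<le> emeasure r A'"
  using emeasure_r[of A] emeasure_r[of A'] emeasure_mono[of A A' "count_space UNIV"] by auto

text \<open>The sets in \<open>step\<close> consist of atoms of simple measures, so they are null
  exactly if they are empty; this recovers the literal condition of being mutually closest.\<close>

lemma step_iff:
  "step r hr b hb E x y \<longleftrightarrow> E x y \<or> fr E x y \<and>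
     (\<forall>y'. fr E x y' \<longrightarrow> dist x y \<le> dist x y') \<and> (\<forall>x'. fr E x' y \<longrightarrow> dist x y \<le> dist x' y)"
proof -
  have "{y'. fr E x y' \<and> dist x y' < dist x y} \<subseteq> atoms b" "{x'. fr E x' y \<and> dist x' y < dist x y} \<subseteq> atoms r"
    by (auto simp: free_def)
  then show ?thesis
    unfolding step_def
    by (subst emeasure_r, simp, subst emeasure_b, simp) (auto simp: emeasure_count_space_eq_0 not_less[symmetric])
qed

text \<open>A point gains at most one edge in a round: two new partners would both be at the minimal
  free distance from it, against non-equidistance. It gains one only while its degree is below its
  mark.\<close>

lemma stage_degree_le: "emeasure b {y. stg n x y} \<le> emeasure hr {x}"
proof (induction n)
  case (Suc n)
  define N where "N = {y. \<not> stg n x y \<and> stg (Suc n) x y}"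
  have sub: "{y. stg n x y} \<subseteq> atoms b" "{y. stg (Suc n) x y} \<subseteq> atoms b"
    using stage_atoms by fast+
  have N: "fr (stg n) x y \<and> (\<forall>y'. fr (stg n) x y' \<longrightarrow> dist x y \<le> dist x y')" if "y \<in> N" for y
    using that by (auto simp: N_def step_iff)
  have eq: "{y. stg (Suc n) x y} = {y. stg n x y} \<union> N"
    using stage_Suc[of r hr b hb n x] by (auto simp: N_def)
  show ?case
  proof (cases "N = {}")
    case True
    then show ?thesis using Suc eq by simp
  next
    case False
    then obtain y where y: "y \<in> N" by blast
    have "y' = y" if y': "y' \<in> N" for y'
    proof (rule ccontr)
      assume "y' \<noteq> y"
      moreover have "dist x y = dist x y'" using N[OF y] N[OF y'] by (auto intro: antisym)
      moreover have "x \<in> atoms r" "y \<in> atoms b" "y' \<in> atoms b" using N[OF y] N[OF y'] by (auto simp: free_def)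
      moreover from this have "x \<noteq> y" "x \<noteq> y'" using disjoint by auto
      ultimately show False
        using non_equidistant unfolding non_equidistant_def dist_norm by (metis UnI1 UnI2 distinct_length_2_or_more distinct_singleton)
    qed
    with y have N1: "N = {y}" by blast
    obtain k::nat where k: "emeasure hr {x} = of_nat k" using mark_nat by blast
    \<comment> \<open>A count strictly below \<open>of_nat k\<close> is finite, so the inequality
      becomes one between natural numbers, with room for one more edge.\<close>
    have lt: "emeasure (count_space UNIV) {y. stg n x y} < of_nat k"
      using N[OF y] emeasure_b[OF sub(1)] by (simp add: free_def k)
    then have fin: "finite {y. stg n x y}"
      by (auto simp: emeasure_count_space split: if_splits)
    with lt have "card {y. stg n x y} < k" by (simp add: emeasure_count_space)
    then have "card {y. stg (Suc n) x y} \<le> k"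
      unfolding eq N1 using fin by (simp add: card_insert_if)
    moreover have "finite {y. stg (Suc n) x y}" using fin by (simp only: eq N1) simp
    ultimately show ?thesis
      unfolding emeasure_b[OF sub(2)] k by (simp del: stage.simps)
  qed
qed simp

section \<open>The limit of the rounds\<close>

lemma matched_SUP: "emeasure b {y. mtch x y} = (SUP n. emeasure b {y. stg n x y})"
proof -
  have "{y. mtch x y} = (\<Union>n. {y. stg n x y})" by (auto simp: matched_def)
  moreover have "incseq (\<lambda>n. {y. stg n x y})" using stage_mono by (fastforce simp: incseq_def)
  moreover have "{y. stg n x y} \<in> sets b" for n
  proof -
    have "{y. stg n x y} \<subseteq> atoms b" using stage_atoms by fast
    from borel_subset_atoms[OF b this] show ?thesis
      unfolding sets_configs[OF b] .
  qed
  ultimately show ?thesis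
    by (simp add: SUP_emeasure_incseq image_subset_iff)
qed

lemma matched_degree_le: "emeasure b {y. mtch x y} \<le> emeasure hr {x}"
  unfolding matched_SUP by (intro SUP_least stage_degree_le)

text \<open>A supremum need not preserve strict inequalities. Here it does, because the degrees are
  integers and stay below \<open>k - 1\<close>, inclusive.\<close>

lemma matched_degree_less:
  assumes "\<And>n. emeasure b {y. stg n x y} < emeasure hr {x}"
  shows "emeasure b {y. mtch x y} < emeasure hr {x}"
proof -
  obtain k::nat where k: "emeasure hr {x} = of_nat k" using mark_nat by blast
  have "emeasure b {y. stg n x y} \<le> of_nat (k - 1)" for n
  proof -
    have sub: "{y. stg n x y} \<subseteq> atoms b" using stage_atoms by fast
    have lt: "emeasure (count_space UNIV) {y. stg n x y} < of_nat k"
      using assms[of n] emeasure_b[OF sub] by (simp add: k)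
    then have fin: "finite {y. stg n x y}"
      by (auto simp: emeasure_count_space split: if_splits)
    with lt have "card {y. stg n x y} < k" by (simp add: emeasure_count_space)
    then have "card {y. stg n x y} \<le> k - 1" by simp
    then show ?thesis using fin by (simp only: emeasure_b[OF sub] emeasure_count_space) simp
  qed
  then have "emeasure b {y. mtch x y} \<le> of_nat (k - 1)" unfolding matched_SUP by (intro SUP_least)
  also have "\<dots> < of_nat k" using assms[of 0] k by (cases k) auto
  finally show ?thesis by (simp add: k)
qed

lemma finite_matched: "finite {y. mtch x y}"
proof -
  have sub: "{y. mtch x y} \<subseteq> atoms b" using matched_atoms by fast
  obtain k::nat where k: "emeasure hr {x} = of_nat k" using mark_nat by blast
  show ?thesis
    using matched_degree_le[of x] by (auto simp: emeasure_b[OF sub] k emeasure_count_space top_unique split: if_splits)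
qed

lemma degree_mono: "emeasure b {y. stg n x y} \<le> emeasure b {y. mtch x y}"
  using matched_atoms[of r hr b hb x] by (intro emeasure_b_mono) (auto simp: matched_def)

lemma degree_mono': "emeasure r {x. stg n x y} \<le> emeasure r {x. mtch x y}"
  and matched_degree_le': "emeasure r {x. mtch x y} \<le> emeasure hb {y}"
  and finite_matched': "finite {x. mtch x y}"
  and matched_degree_less': "(\<And>n. emeasure r {x. stg n x y} < emeasure hb {y}) \<Longrightarrow>
    emeasure r {x. mtch x y} < emeasure hb {y}"
proof -
  interpret s: bicolored_points b hb r hr by (rule swap)
  show "emeasure r {x. stg n x y} \<le> emeasure r {x. mtch x y}"
    using s.degree_mono[of n y] by (simp add: stage_swap matched_swap)
  show "emeasure r {x. mtch x y} \<le> emeasure hb {y}"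
    using s.matched_degree_le[of y] by (simp add: matched_swap)
  show "finite {x. mtch x y}"
    using s.finite_matched[of y] by (simp add: matched_swap)
  show "(\<And>n. emeasure r {x. stg n x y} < emeasure hb {y}) \<Longrightarrow>
      emeasure r {x. mtch x y} < emeasure hb {y}"
    using s.matched_degree_less[of y] by (simp add: matched_swap stage_swap)
qed

lemma free_stage: "fr mtch x y \<Longrightarrow> fr (stg n) x y"
  using degree_mono[of n x] degree_mono'[of n y] by (auto simp: free_def matched_def)

lemma free_stage_Suc: "fr (stg (Suc n)) x y \<Longrightarrow> fr (stg n) x y"
proof -
  have "emeasure b {y. stg n x y} \<le> emeasure b {y. stg (Suc n) x y}"
    by (intro emeasure_b_mono) (use stage_Suc stage_atoms in fast)+
  moreover have "emeasure r {x. stg n x y} \<le> emeasure r {x. stg (Suc n) x y}"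
    by (intro emeasure_r_mono) (use stage_Suc stage_atoms in fast)+
  ultimately show "fr (stg (Suc n)) x y \<Longrightarrow> fr (stg n) x y"
    using stage_Suc[of r hr b hb n x y] unfolding free_def by (auto simp del: stage.simps)
qed

lemma free_stage_antimono: "m \<le> n \<Longrightarrow> fr (stg n) x y \<Longrightarrow> fr (stg m) x y"
  by (induction rule: dec_induct) (auto simp del: stage.simps dest: free_stage_Suc)

text \<open>Used in contraposition: a pair that is not free in the limit has stopped being free
  after finitely many rounds. This rests on \<open>matched_degree_less\<close> for both
  ends.\<close>

lemma free_matched: "(\<And>n. fr (stg n) x y) \<Longrightarrow> fr mtch x y"
  using matched_degree_less[of x] matched_degree_less'[of y] unfolding free_def
  by (metis matched_def)

text \<open>Freeness is lost once and for all, so the maximum of finitely many rounds serves all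
  pairs in \<open>F\<close>.\<close>

lemma eventually_not_free:
  assumes "finite F" "\<And>p. p \<in> F \<Longrightarrow> \<not> fr mtch (fst p) (snd p)"
  shows "\<exists>n. \<forall>p\<in>F. \<not> fr (stg n) (fst p) (snd p)"
  using assms
proof (induction F)
  case (insert p F)
  then obtain m where m: "\<forall>q\<in>F. \<not> fr (stg m) (fst q) (snd q)" by blast
  have "\<not> fr mtch (fst p) (snd p)" using insert(4) by simp
  then obtain k where k: "\<not> fr (stg k) (fst p) (snd p)" using free_matched by blast
  have "\<not> fr (stg (max m k)) (fst q) (snd q)" if "q \<in> insert p F" for q
  proof (cases "q = p")
    case True
    then show ?thesis using k free_stage_antimono[OF max.cobounded2] by blast
  next
    case False
    then show ?thesis using that m free_stage_antimono[OF max.cobounded1] by blast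
  qed
  then show ?case by blast
qed simp

text \<open>Otherwise all closer competitors of the pair, finitely many by local finiteness, have
  stopped being free by some round. From then on the pair is mutually closest among the free pairs,
  so the next round joins it.\<close>

lemma free_dist_less_exists:
  assumes xy: "fr mtch x y"
  shows "(\<exists>y'. fr mtch x y' \<and> dist x y' < dist x y) \<or> (\<exists>x'. fr mtch x' y \<and> dist x' y < dist x y)"
proof (rule ccontr)
  assume *: "\<not> ?thesis"
  \<comment> \<open>All pairs that share an end with \<open>(x, y)\<close> and could be
    closer.\<close>
  define F where "F = Pair x ` (atoms b \<inter> cball x (dist x y)) \<union> (\<lambda>x'. (x', y)) ` (atoms r \<inter> cball y (dist x y))"
  define G where "G = {p \<in> F. \<not> fr mtch (fst p) (snd p)}"
  have "finite F"
    unfolding F_def by (intro finite_UnI finite_imageI finite_atoms_bounded r b bounded_cball)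
  then have "finite G" by (simp add: G_def)
  then have "\<exists>n. \<forall>p\<in>G. \<not> fr (stg n) (fst p) (snd p)"
    by (rule eventually_not_free) (simp add: G_def)
  then obtain n where n: "p \<in> F \<Longrightarrow> \<not> fr mtch (fst p) (snd p) \<Longrightarrow> \<not> fr (stg n) (fst p) (snd p)" for p
    unfolding G_def by blast
  have "dist x y \<le> dist x y'" if "fr (stg n) x y'" for y'
  proof (rule ccontr)
    assume "\<not> dist x y \<le> dist x y'"
    moreover from this have "(x, y') \<in> F" using that by (auto simp: F_def free_def)
    ultimately have "fr mtch x y'" using n[of "(x, y')"] that by auto
    with * \<open>\<not> dist x y \<le> dist x y'\<close> show False by auto
  qed
  moreover have "dist x y \<le> dist x' y" if "fr (stg n) x' y" for x'
  proof (rule ccontr)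
    assume "\<not> dist x y \<le> dist x' y"
    moreover from this have "(x', y) \<in> F" using that by (auto simp: F_def free_def dist_commute)
    ultimately have "fr mtch x' y" using n[of "(x', y)"] that by auto
    with * \<open>\<not> dist x y \<le> dist x' y\<close> show False by auto
  qed
  ultimately have "stg (Suc n) x y" using free_stage[OF xy, of n] by (simp add: step_iff)
  then show False using xy by (auto simp: free_def matched_def simp del: stage.simps)
qed

text \<open>
  Otherwise, moving from a point of a free pair to its closest free partner again and again would
  give a descending chain.
\<close>

lemma no_free: "\<not> fr mtch x y"
proof
  assume xy: "fr mtch x y"
  \<comment> \<open>The relation is symmetrized so that the chain, which alternates between the
    colors, can be built without keeping track of them.\<close>
  define A where "A u v \<longleftrightarrow> fr mtch u v \<or> fr mtch v u" for u v
  have A_sym: "A u v \<Longrightarrow> A v u" for u v by (auto simp: A_def)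
  have A_atoms: "u \<in> atoms r \<union> atoms b \<and> v \<in> atoms r \<union> atoms b" if "A u v" for u v
    using that by (auto simp: A_def free_def)
  have "\<exists>w. A u w \<and> (\<forall>w'. A u w' \<longrightarrow> dist u w \<le> dist u w')" if "A u v" for u v
  proof -
    let ?W = "{w. A u w \<and> dist u w \<le> dist u v}"
    have "?W \<subseteq> atoms r \<inter> cball u (dist u v) \<union> atoms b \<inter> cball u (dist u v)"
      using A_atoms by auto
    then have fin: "finite ?W"
      using finite_atoms_bounded[OF r bounded_cball] finite_atoms_bounded[OF b bounded_cball]
      by (meson finite_UnI finite_subset)
    have ne: "?W \<noteq> {}" using that by auto
    have "arg_min_on (dist u) ?W \<in> ?W" using arg_min_if_finite(1)[OF fin ne] .
    moreover have "dist u (arg_min_on (dist u) ?W) \<le> dist u w'" if "A u w'" for w'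
      using arg_min_least[OF fin ne, of w' "dist u"] that calculation by (cases "dist u w' \<le> dist u v") auto
    ultimately show ?thesis by blast
  qed
  then obtain best where best: "A u (best u)" "A u w \<Longrightarrow> dist u (best u) \<le> dist u w"
    if "A u v" for u v w
    by metis
  define s where "s i = (best ^^ i) x" for i
  have A_s: "A (s i) (s (Suc i))" for i
  proof (induction i)
    case 0
    have "A x y" using xy by (simp add: A_def)
    then show ?case using best(1) by (simp add: s_def)
  next
    case (Suc i)
    then have "A (s (Suc i)) (s i)" by (rule A_sym)
    from best(1)[OF this] show ?case by (simp add: s_def)
  qed
  have "range s \<subseteq> atoms r \<union> atoms b" using A_s A_atoms by blast
  moreover have "\<not> descending_chain (atoms r \<union> atoms b) s" using no_chain by blast
  ultimately obtain i where i: "\<not> norm (s (Suc (Suc i)) - s (Suc i)) < norm (s (Suc i) - s i)"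
    unfolding descending_chain_def by blast
  \<comment> \<open>At an index where the chain does not descend, \<open>v\<close> is a closest free
    partner of \<open>u\<close> by choice of \<open>best\<close>, and \<open>u\<close> is at least
    as close to \<open>v\<close> as every free partner of \<open>v\<close>. So no free pair at
    either end is closer.\<close>
  define u v where "u = s i" and "v = s (Suc i)"
  have uv: "A u v" using A_s by (simp add: u_def v_def)
  have u: "dist u v \<le> dist u w" if "A u w" for w
    using best(2)[OF uv that] by (simp add: u_def v_def s_def)
  have v: "dist u v \<le> dist v w" if "A v w" for w
  proof -
    have "dist u v \<le> dist v (best v)" using i by (simp add: u_def v_def s_def dist_norm norm_minus_commute)
    also have "\<dots> \<le> dist v w" using best(2)[OF A_sym[OF uv] that] .
    finally show ?thesis .
  qed
  show False
  proof (cases "fr mtch u v")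
    case True
    from free_dist_less_exists[OF this] show False
      using u v by (force simp: A_def dist_commute)
  next
    case False
    then have "fr mtch v u" using uv by (simp add: A_def)
    from free_dist_less_exists[OF this] show False
      using u v by (force simp: A_def dist_commute)
  qed
qed

text \<open>Since no pair is free in the limit, an unjoined blue \<open>y\<close> has no free stub
  left. At the moment when \<open>y\<close> was joined to \<open>x'\<close> it still had one, and so
  had \<open>x\<close>; the pair of \<open>x\<close> and \<open>y\<close> was therefore free and
  competed with \<open>x'\<close>.\<close>

lemma unsaturated:
  assumes x: "x \<in> atoms r" "emeasure b {y. mtch x y} < emeasure hr {x}"
    and y: "y \<in> atoms b" "\<not> mtch x y"
  shows "emeasure r {x. mtch x y} = emeasure hb {y}"
    and "mtch x' y \<Longrightarrow> dist x' y \<le> dist x y"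
proof -
  show "emeasure r {x. mtch x y} = emeasure hb {y}"
    using no_free[of x y] matched_degree_le'[of y] assms by (auto simp: free_def)
  assume x': "mtch x' y"
  show "dist x' y \<le> dist x y"
  proof (rule ccontr)
    assume gt: "\<not> dist x' y \<le> dist x y"
    \<comment> \<open>The round that joins \<open>x'\<close> and \<open>y\<close>. It is a successor
      because round 0 has no edges, and its predecessor \<open>m\<close> is the state in which the
      choice was made.\<close>
    define n where "n = (LEAST n. stg n x' y)"
    have n: "stg n x' y" using x' unfolding n_def matched_def by (metis LeastI)
    then obtain m where m: "n = Suc m" by (cases n) auto
    have "\<not> stg m x' y" using not_less_Least[of m "\<lambda>n. stg n x' y"] by (simp add: n_def[symmetric] m)
    with n have fr: "fr (stg m) x' y" and min: "\<And>x''. fr (stg m) x'' y \<Longrightarrow> dist x' y \<le> dist x'' y"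
      by (auto simp: m step_iff)
    have "fr (stg m) x y"
      using fr x y le_less_trans[OF degree_mono x(2), of m] by (auto simp: free_def matched_def)
    from min[OF this] gt show False by simp
  qed
qed

end

subsection \<open>The matching as a point process of pairs\<close>

text \<open>The product measure restricted to the joined pairs. It gives every edge mass 1 when the
  colors are simple and disjoint, and it needs no enumeration of the edges, which would have to be
  measurable and equivariant.\<close>

definition matching :: "('a::euclidean_space) measure \<Rightarrow> 'a measure \<Rightarrow> 'a measure \<Rightarrow> 'a measure
    \<Rightarrow> 'a uprod measure" where
  "matching r hr b hb = distr (density (r \<Otimes>\<^sub>M b) (indicator {(x, y). matched r hr b hb x y}))
     uprod_borel (\<lambda>(x, y). Upair x y)"

lemma configs_const: "\<mu> \<in> point_measures borel bounded \<Longrightarrow> (\<lambda>_. \<mu>) \<in> N \<rightarrow>\<^sub>M configs"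
  by simp

lemma pred_matched_const:
  fixes r hr b hb :: "('a::euclidean_space) measure"
  assumes "r \<in> point_measures borel bounded" "hr \<in> point_measures borel bounded"
    "b \<in> point_measures borel bounded" "hb \<in> point_measures borel bounded"
  shows "Measurable.pred (borel \<Otimes>\<^sub>M borel) (\<lambda>(x, y). matched r hr b hb x y)"
proof -
  \<comment> \<open>The parameter space is a dummy: constant configurations are measurable on any
    space, and \<open>undefined\<close> is an arbitrary point of it.\<close>
  have "(\<lambda>p. (undefined, fst p, snd p)) \<in> borel \<Otimes>\<^sub>M borel \<rightarrow>\<^sub>M count_space UNIV \<Otimes>\<^sub>M borel \<Otimes>\<^sub>M (borel :: 'a measure)"
    by measurable
  from measurable_compose[OF this pred_matched[OF configs_const[OF assms(1)] configs_const[OF assms(2)]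
    configs_const[OF assms(3)] configs_const[OF assms(4)]]]
  show ?thesis by (simp add: case_prod_beta')
qed

text \<open>Fubini reduces the pair process to one-point integrals. Integrality, measurability and
  equivariance of \<open>matching\<close> are all read off from this formula.\<close>

lemma emeasure_matching:
  assumes c: "r \<in> point_measures borel bounded" "hr \<in> point_measures borel bounded"
    "b \<in> point_measures borel bounded" "hb \<in> point_measures borel bounded"
    and E: "E \<in> sets uprod_borel"
  shows "emeasure (matching r hr b hb) E =
    (\<integral>\<^sup>+x. emeasure b {y. matched r hr b hb x y \<and> Upair x y \<in> E} \<partial>r)"
proof -
  interpret b: sigma_finite_measure b by (rule sigma_finite_configs[OF c(3)])
  note [measurable] = pred_matched_const[OF c] E
  note [measurable_cong] = sets_configs[OF c(1)] sets_configs[OF c(3)]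
  let ?W = "{p. (case p of (x, y) \<Rightarrow> matched r hr b hb x y \<and> Upair x y \<in> E)}"
  have sp: "space (r \<Otimes>\<^sub>M b) = UNIV" by (simp add: space_pair_measure space_configs[OF c(1)] space_configs[OF c(3)])
  have M: "{p. case p of (x, y) \<Rightarrow> matched r hr b hb x y} \<in> sets (r \<Otimes>\<^sub>M b)"
    using pred_matched_const[OF c] by (simp add: pred_def space_pair_measure cong: sets_pair_measure_cong)
  have UE: "(\<lambda>(x, y). Upair x y) -` E \<in> sets (r \<Otimes>\<^sub>M b)"
    using measurable_sets[OF measurable_Upair E] by (simp add: space_pair_measure cong: sets_pair_measure_cong)
  have W: "?W = {p. case p of (x, y) \<Rightarrow> matched r hr b hb x y} \<inter> (\<lambda>(x, y). Upair x y) -` E" by auto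
  have "emeasure (matching r hr b hb) E =
      emeasure (density (r \<Otimes>\<^sub>M b) (indicator {(x, y). matched r hr b hb x y})) ((\<lambda>(x, y). Upair x y) -` E)"
    unfolding matching_def by (subst emeasure_distr) (simp_all add: sp)
  also have "\<dots> = (\<integral>\<^sup>+p. indicator ?W p \<partial>(r \<Otimes>\<^sub>M b))"
    using M UE by (subst emeasure_density) (auto intro!: nn_integral_cong simp: indicator_def)
  also have "\<dots> = emeasure (r \<Otimes>\<^sub>M b) ?W"
    unfolding W using M UE by (intro nn_integral_indicator) auto
  also have "\<dots> = (\<integral>\<^sup>+x. emeasure b (Pair x -` ?W) \<partial>r)"
    unfolding W using M UE by (intro b.emeasure_pair_measure_alt) auto
  finally show ?thesis by (simp add: vimage_def)
qed

lemma sets_matching [simp]: "sets (matching r hr b hb) = sets uprod_borel"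
  by (simp add: matching_def)

text \<open>Only red points among the ends of pairs in \<open>E\<close> contribute, finitely many
  since \<open>E\<close> is bounded, and each contributes an integer. The statement covers all
  configurations, including those outside \<open>bicolored_points\<close>, because
  \<open>matching\<close> has to map every sample into \<open>pair_configs\<close>.\<close>

lemma matching_configs:
  assumes c: "r \<in> point_measures borel bounded" "hr \<in> point_measures borel bounded"
    "b \<in> point_measures borel bounded" "hb \<in> point_measures borel bounded"
  shows "matching r hr b hb \<in> point_measures uprod_borel bounded_pairs"
proof -
  have "\<exists>n::nat. emeasure (matching r hr b hb) E = of_nat n"
    if E: "E \<in> sets uprod_borel" "bounded_pairs E" for E
  proof -
    let ?C = "\<Union>e\<in>E. set_uprod e"
    define g where "g x = emeasure b {y. matched r hr b hb x y \<and> Upair x y \<in> E}" for x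
    have [measurable]: "Measurable.pred (borel \<Otimes>\<^sub>M borel) (\<lambda>(x, y). matched r hr b hb x y \<and> Upair x y \<in> E)"
      using pred_matched_const[OF c] measurable_compose[OF measurable_Upair, of "\<lambda>e. e \<in> E"] E(1)
      unfolding case_prod_beta' by (intro pred_intros_logic) (auto simp: pred_def)
    have g: "g \<in> borel_measurable borel"
      unfolding g_def[abs_def] by (rule measurable_emeasure_configs[OF configs_const[OF c(3)]]) measurable
    have "\<exists>n::nat. g x = of_nat n" for x
      unfolding g_def
    proof (rule configs_nat[OF c(3)])
      have "{y. matched r hr b hb x y \<and> Upair x y \<in> E} \<subseteq> atoms b" by (auto dest: matched_atoms)
      then show "{y. matched r hr b hb x y \<and> Upair x y \<in> E} \<in> sets borel"
        by (rule borel_subset_atoms[OF c(3)])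
      show "bounded {y. matched r hr b hb x y \<and> Upair x y \<in> E}"
        by (rule bounded_subset[OF E(2)[unfolded bounded_pairs_def]]) force
    qed
    moreover have "\<exists>n::nat. emeasure r {x} = of_nat n" for x by (rule configs_nat[OF c(1)]) auto
    ultimately obtain j k where jk: "g x = of_nat (j x)" "emeasure r {x} = of_nat (k x)" for x
      by metis
    have fin: "finite (atoms r \<inter> ?C)"
      using E(2) by (intro finite_atoms_bounded[OF c(1)]) (simp add: bounded_pairs_def)
    have g0: "g x = 0" if "x \<notin> ?C" for x
    proof -
      have "{y. matched r hr b hb x y \<and> Upair x y \<in> E} = {}" using that by force
      then show ?thesis by (simp only: g_def) simp
    qed
    have "emeasure (matching r hr b hb) E = (\<integral>\<^sup>+x. g x * emeasure r {x} \<partial>count_space (atoms r))"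
      unfolding emeasure_matching[OF c E(1)] g_def[symmetric] by (rule nn_integral_point_measure[OF c(1) g])
    also have "\<dots> = (\<Sum>x\<in>atoms r \<inter> ?C. g x * emeasure r {x})"
      using fin g0 by (intro nn_integral_count_space') auto
    also have "\<dots> = of_nat (\<Sum>x\<in>atoms r \<inter> ?C. j x * k x)" by (simp add: jk)
    finally show ?thesis by blast
  qed
  then show ?thesis by (simp add: point_measures_def)
qed

lemma measurable_matching:
  fixes r hr b hb :: "'w \<Rightarrow> ('a::euclidean_space) measure"
  assumes [measurable]: "r \<in> N \<rightarrow>\<^sub>M configs" "hr \<in> N \<rightarrow>\<^sub>M configs" "b \<in> N \<rightarrow>\<^sub>M configs" "hb \<in> N \<rightarrow>\<^sub>M configs"
  shows "(\<lambda>\<omega>. matching (r \<omega>) (hr \<omega>) (b \<omega>) (hb \<omega>)) \<in> N \<rightarrow>\<^sub>M pair_configs"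
proof (rule measurable_point_measure_spaceI)
  fix \<omega> assume \<omega>: "\<omega> \<in> space N"
  note conf = measurable_space[OF assms(1) \<omega>] measurable_space[OF assms(2) \<omega>]
    measurable_space[OF assms(3) \<omega>] measurable_space[OF assms(4) \<omega>]
  show "matching (r \<omega>) (hr \<omega>) (b \<omega>) (hb \<omega>) \<in> point_measures uprod_borel bounded_pairs"
    using conf by (intro matching_configs) auto
next
  fix E :: "'a uprod set" assume E [measurable]: "E \<in> sets uprod_borel"
  have U: "Measurable.pred M (\<lambda>p. Upair (f p) (g p) \<in> E)"
    if [measurable]: "f \<in> borel_measurable M" "g \<in> borel_measurable M" for M f g
    using measurable_compose[OF _ measurable_Upair, of "\<lambda>p. (f p, g p)" M] E by measurable
  note [measurable] = U pred_compose3[OF pred_matched[OF assms]]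
  have "(\<lambda>\<omega>. \<integral>\<^sup>+x. emeasure (b \<omega>) {y. matched (r \<omega>) (hr \<omega>) (b \<omega>) (hb \<omega>) x y \<and> Upair x y \<in> E} \<partial>r \<omega>)
      \<in> borel_measurable N"
    unfolding case_prod_beta' by measurable
  then show "(\<lambda>\<omega>. emeasure (matching (r \<omega>) (hr \<omega>) (b \<omega>) (hb \<omega>)) E) \<in> borel_measurable N"
    by (rule measurable_cong[THEN iffD1, rotated])
       (use assms[THEN measurable_space] in \<open>auto intro!: emeasure_matching[symmetric] E\<close>)
qed

lemma matching_translate:
  assumes c: "r \<in> point_measures borel bounded" "hr \<in> point_measures borel bounded"
    "b \<in> point_measures borel bounded" "hb \<in> point_measures borel bounded"
  shows "matching (translate t r) (translate t hr) (translate t b) (translate t hb) =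
    translate_pairs t (matching r hr b hb)"
proof (rule measure_eqI)
  fix E assume "E \<in> sets (matching (translate t r) (translate t hr) (translate t b) (translate t hb))"
  then have E: "E \<in> sets uprod_borel" by simp
  let ?m = "matched (translate t r) (translate t hr) (translate t b) (translate t hb)"
  note s = sets_configs[OF c(1)] sets_configs[OF c(2)] sets_configs[OF c(3)] sets_configs[OF c(4)]
  have tE: "map_uprod (\<lambda>x. x + t) -` E \<in> sets uprod_borel"
    using measurable_sets[OF measurable_map_uprod_translate E] by simp
  have [measurable]: "Measurable.pred (borel \<Otimes>\<^sub>M borel) (\<lambda>(x, y). ?m x y \<and> Upair x y \<in> E)"
    using pred_matched_const[OF c[THEN translate_configs]] measurable_compose[OF measurable_Upair, of "\<lambda>e. e \<in> E"] E
    unfolding case_prod_beta' by (intro pred_intros_logic) (auto simp: pred_def)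
  have m: "(\<lambda>x. emeasure (translate t b) {y. ?m x y \<and> Upair x y \<in> E}) \<in> borel_measurable borel"
    by (rule measurable_emeasure_configs[OF configs_const[OF translate_configs[OF c(3)]]]) measurable
  have "emeasure (matching (translate t r) (translate t hr) (translate t b) (translate t hb)) E =
      (\<integral>\<^sup>+x. emeasure (translate t b) {y. ?m x y \<and> Upair x y \<in> E} \<partial>translate t r)"
    by (rule emeasure_matching[OF c[THEN translate_configs] E])
  also have "\<dots> = (\<integral>\<^sup>+x. emeasure b {y. matched r hr b hb x y \<and> Upair x y \<in> map_uprod (\<lambda>x. x + t) -` E} \<partial>r)"
    by (subst nn_integral_translate[OF s(1) m])
       (simp add: emeasure_translate[OF s(3)] vimage_Collect_translate matched_translate[OF s])
  also have "\<dots> = emeasure (translate_pairs t (matching r hr b hb)) E"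
    by (simp add: emeasure_translate_pairs E emeasure_matching[OF c tE])
  finally show "emeasure (matching (translate t r) (translate t hr) (translate t b) (translate t hb)) E =
      emeasure (translate_pairs t (matching r hr b hb)) E" .
qed (simp add: translate_pairs_def)

context bicolored_points
begin

text \<open>An unordered pair has two orderings, but the colors are disjoint, so at most one of them
  has a red first and a blue second component; no edge is counted twice.\<close>

lemma emeasure_matching_singleton:
  "emeasure (matching r hr b hb) {Upair u v} = (if mtch u v \<or> mtch v u then 1 else 0)"
proof -
  have *: "emeasure (matching r hr b hb) {Upair u v} = 1" if uv: "mtch u v" for u v
  proof -
    have at: "u \<in> atoms r" "v \<in> atoms b" using matched_atoms[OF uv] by auto
    then have no: "\<not> mtch v u" using matched_atoms[of r hr b hb v u] disjoint by auto
    have "emeasure b {y. mtch x y \<and> Upair x y \<in> {Upair u v}} = indicator {u} x" for x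
    proof (cases "x = u")
      case True
      then have "{y. mtch x y \<and> Upair x y \<in> {Upair u v}} = {v}" using uv no by auto
      then show ?thesis using True emeasure_b[of "{v}"] at by simp
    next
      case False
      then have "{y. mtch x y \<and> Upair x y \<in> {Upair u v}} = {}" using no by auto
      then show ?thesis using False by (simp only:) simp
    qed
    then have "emeasure (matching r hr b hb) {Upair u v} = (\<integral>\<^sup>+x. indicator {u} x \<partial>r)"
      by (simp only: emeasure_matching[OF r hr b hb singleton_uprod_borel])
    also have "\<dots> = 1" using emeasure_r[of "{u}"] at by (simp add: sets_configs[OF r])
    finally show ?thesis .
  qed
  have "emeasure (matching r hr b hb) {Upair u v} = 0" if uv: "\<not> mtch u v" "\<not> mtch v u"
  proof -
    have "{y. mtch x y \<and> Upair x y \<in> {Upair u v}} = {}" for x using uv by auto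
    then show ?thesis by (simp only: emeasure_matching[OF r hr b hb singleton_uprod_borel]) simp
  qed
  moreover have "Upair v u = Upair u v" by (simp add: Upair_inject)
  ultimately show ?thesis using *[of u v] *[of v u] by metis
qed

lemma atoms_matching: "atoms (matching r hr b hb) = {Upair x y | x y. mtch x y}"
proof (intro set_eqI)
  fix e :: "'a uprod" obtain u v where e: "e = Upair u v" by (cases e)
  show "e \<in> atoms (matching r hr b hb) \<longleftrightarrow> e \<in> {Upair x y | x y. mtch x y}"
    by (auto simp: atoms_def e emeasure_matching_singleton)
qed

lemma simple_matching: "simple_measure (matching r hr b hb)"
  unfolding simple_measure_def
proof
  fix e show "emeasure (matching r hr b hb) {e} \<le> 1"
    by (cases e) (simp add: emeasure_matching_singleton)
qed

text \<open>A red \<open>x\<close> is not blue, so every edge at \<open>x\<close> is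
  \<open>Upair x y\<close> for exactly one partner \<open>y\<close>.\<close>

lemma vertex_degree_matching:
  assumes x: "x \<in> atoms r"
  shows "vertex_degree (atoms (matching r hr b hb)) x = emeasure b {y. mtch x y}"
proof -
  have "x \<notin> atoms b" using x disjoint by auto
  then have "{e \<in> atoms (matching r hr b hb). x \<in> set_uprod e} = Upair x ` {y. mtch x y}"
    using matched_atoms[of r hr b hb] by (auto simp: atoms_matching)
  moreover have "inj_on (Upair x) {y. mtch x y}" by (auto simp: inj_on_def)
  ultimately have "vertex_degree (atoms (matching r hr b hb)) x = of_nat (card {y. mtch x y})"
    using finite_matched[of x] by (simp add: vertex_degree_def card_image)
  also have "\<dots> = emeasure b {y. mtch x y}"
    using finite_matched[of x] matched_atoms[of r hr b hb x] by (subst emeasure_b) auto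
  finally show ?thesis .
qed

end

lemma (in bicolored_points) matching_swap: "atoms (matching b hb r hr) = atoms (matching r hr b hb)"
proof -
  interpret s: bicolored_points b hb r hr by (rule swap)
  show ?thesis
    unfolding atoms_matching s.atoms_matching by (auto simp: matched_swap[of b hb r hr]) (metis Upair_inject)+
qed

lemma (in bicolored_points) two_color_multi_matching_matching:
  assumes "\<And>x. x \<in> atoms r \<Longrightarrow> emeasure b {y. mtch x y} = emeasure hr {x}"
    and "\<And>y. y \<in> atoms b \<Longrightarrow> emeasure r {x. mtch x y} = emeasure hb {y}"
  shows "two_color_multi_matching (matching r hr b hb) r hr b hb"
proof -
  interpret s: bicolored_points b hb r hr by (rule swap)
  have "vertex_degree (atoms (matching r hr b hb)) y = emeasure hb {y}" if "y \<in> atoms b" for y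
    using s.vertex_degree_matching[OF that] assms(2)[OF that] by (simp add: matching_swap matched_swap[of b hb r hr])
  moreover have "\<exists>x\<in>atoms r. \<exists>y\<in>atoms b. e = Upair x y" if "e \<in> atoms (matching r hr b hb)" for e
    using that by (auto simp: atoms_matching dest: matched_atoms)
  ultimately show ?thesis
    using vertex_degree_matching assms(1) by (simp add: two_color_multi_matching_def)
qed

section \<open>Schemes and degrees\<close>

text \<open>The ground atoms have mass 1 and coincide with the atoms of the mark measure. This
  writes the mass of marks as an integral over the ground process, the form that mass transport
  produces.\<close>

lemma emeasure_marks:
  fixes \<mu> h :: "('a::euclidean_space) measure"
  assumes \<mu>: "\<mu> \<in> point_measures borel bounded" and h: "h \<in> point_measures borel bounded"
    and simple: "simple_measure \<mu>" and at: "atoms h = atoms \<mu>" and A: "A \<in> sets borel"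
  shows "(\<integral>\<^sup>+x. indicator A x * emeasure h {x} \<partial>\<mu>) = emeasure h A"
proof -
  have m: "(\<lambda>x. indicator A x * emeasure h {x}) \<in> borel_measurable borel"
    using A measurable_emeasure_singleton[OF configs_const[OF h], of "\<lambda>x. x" borel] by measurable
  have "(\<integral>\<^sup>+x. indicator A x * emeasure h {x} \<partial>\<mu>) =
      (\<integral>\<^sup>+x. indicator A x * emeasure h {x} * emeasure \<mu> {x} \<partial>count_space (atoms \<mu>))"
    by (rule nn_integral_point_measure[OF \<mu> m])
  also have "\<dots> = (\<integral>\<^sup>+x. indicator A x * emeasure h {x} \<partial>count_space (atoms h))"
    unfolding at
    by (intro nn_integral_cong) (simp add: emeasure_simple_measure[OF \<mu> simple])
  also have "\<dots> = (\<integral>\<^sup>+x. indicator A x \<partial>h)"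
    using A by (subst nn_integral_point_measure[OF h]) auto
  also have "\<dots> = emeasure h A"
    using A by (simp add: sets_configs[OF h])
  finally show ?thesis .
qed

lemma measurable_translate4: "translate4 t \<in> configs4 \<rightarrow>\<^sub>M configs4"
  unfolding translate4_def case_prod_beta' using measurable_translate[of t] by measurable

lemma measurable_translate5: "translate5 t \<in> configs5 \<rightarrow>\<^sub>M configs5"
  unfolding translate5_def case_prod_beta' using measurable_translate[of t] measurable_translate_pairs[of t] by measurable

text \<open>With both measures simple the integral counts the blue \<open>y\<close> for which
  \<open>Upair x y\<close> is an edge. An edge containing \<open>x\<close> has \<open>x\<close> as
  its red end by disjointness, so these \<open>y\<close> correspond to the edges at
  \<open>x\<close>.\<close>

lemma nn_integral_scheme_degree:
  fixes r h b :: "('a::euclidean_space) measure" and m :: "'a uprod measure"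
  assumes b: "b \<in> point_measures borel bounded" "simple_measure b"
    and m: "m \<in> point_measures uprod_borel bounded_pairs" "simple_measure m"
    and edges: "\<And>e. e \<in> atoms m \<Longrightarrow> \<exists>x\<in>atoms r. \<exists>y\<in>atoms b. e = Upair x y"
    and disjoint: "atoms r \<inter> atoms b = {}" and x: "x \<in> atoms r"
  shows "(\<integral>\<^sup>+y. emeasure m {Upair x y} \<partial>b) = vertex_degree (atoms m) x"
proof -
  have one: "emeasure m {e} = indicator (atoms m) e" for e
  proof -
    have "bounded_pairs {e}" unfolding bounded_pairs_def by (cases e) simp
    then obtain n::nat where n: "emeasure m {e} = of_nat n"
      using m(1) singleton_uprod_borel[of e] by (auto simp: point_measures_def)
    have "(of_nat n :: ennreal) \<le> of_nat 1" using m(2) n unfolding simple_measure_def by (metis of_nat_1)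
    then have "n \<le> 1" unfolding of_nat_le_iff .
    then have "n = 0 \<or> n = 1" by auto
    then show ?thesis using n by (auto simp: atoms_def)
  qed
  have meas: "(\<lambda>y. emeasure m {Upair x y}) \<in> borel_measurable borel"
  proof -
    have "m \<in> space pair_configs" using m by simp
    then have "(\<lambda>y. (m, x, y)) \<in> borel \<rightarrow>\<^sub>M pair_configs \<Otimes>\<^sub>M borel \<Otimes>\<^sub>M borel" by measurable
    from measurable_compose[OF this measurable_emeasure_Upair] show ?thesis by simp
  qed
  have "(\<integral>\<^sup>+y. emeasure m {Upair x y} \<partial>b) =
      (\<integral>\<^sup>+y. emeasure m {Upair x y} * emeasure b {y} \<partial>count_space (atoms b))"
    by (rule nn_integral_point_measure[OF b(1) meas])
  also have "\<dots> = (\<integral>\<^sup>+y. indicator {y. Upair x y \<in> atoms m} y \<partial>count_space (atoms b))"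
    by (intro nn_integral_cong) (simp add: emeasure_simple_measure[OF b] one indicator_def)
  also have "\<dots> = (\<integral>\<^sup>+y. indicator {y \<in> atoms b. Upair x y \<in> atoms m} y \<partial>count_space (atoms b))"
    by (intro nn_integral_cong) (simp add: indicator_def)
  also have "\<dots> = emeasure (count_space (atoms b)) {y \<in> atoms b. Upair x y \<in> atoms m}"
    by (intro nn_integral_indicator) auto
  also have "\<dots> = emeasure (count_space UNIV) (Upair x ` {y \<in> atoms b. Upair x y \<in> atoms m})"
  proof -
    have "inj_on (Upair x) {y \<in> atoms b. Upair x y \<in> atoms m}" by (auto simp: inj_on_def)
    then show ?thesis
      by (cases "finite {y \<in> atoms b. Upair x y \<in> atoms m}")
         (auto simp: emeasure_count_space card_image finite_image_iff)
  qed
  also have "Upair x ` {y \<in> atoms b. Upair x y \<in> atoms m} = {e \<in> atoms m. x \<in> set_uprod e}"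
  proof (intro equalityI subsetI)
    fix e assume e: "e \<in> {e \<in> atoms m. x \<in> set_uprod e}"
    then obtain u v where uv: "u \<in> atoms r" "v \<in> atoms b" "e = Upair u v" using edges by blast
    then have "x = u" using e x disjoint by auto
    then show "e \<in> Upair x ` {y \<in> atoms b. Upair x y \<in> atoms m}" using uv e by auto
  qed auto
  finally show ?thesis by (simp add: vertex_degree_def)
qed

text \<open>Unit mass is sent along every edge. What a point sends or receives is its degree, hence
  its mark, and the mean over the unit cube is the intensity of the mark measure. The transport
  depends on \<open>M\<close>, so invariance of all five components jointly is used.\<close>

lemma scheme_intensity:
  fixes R \<eta>R B \<eta>B :: "'v \<Rightarrow> ('a::euclidean_space) measure"
  assumes Q: "prob_space Q" and scheme: "scheme Q R \<eta>R B \<eta>B M"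
    and disjoint: "AE v in Q. atoms (R v) \<inter> atoms (B v) = {}"
    and simple: "AE v in Q. simple_measure (R v)" "AE v in Q. simple_measure (B v)"
    and marks: "AE v in Q. atoms (\<eta>R v) = atoms (R v)" "AE v in Q. atoms (\<eta>B v) = atoms (B v)"
  shows "intensity Q \<eta>R = intensity Q \<eta>B"
proof -
  define Z where "Z v = (R v, \<eta>R v, B v, \<eta>B v, M v)" for v
  have Z: "translation_invariant Q configs5 translate5 Z"
    using scheme by (simp add: scheme_def Z_def[abs_def])
  then have "Z \<in> Q \<rightarrow>\<^sub>M configs5" by (simp add: translation_invariant_def)
  interpret stationary_kernels Q configs5 translate5 Z fst "\<lambda>z. fst (snd (snd z))"
  proof (intro stationary_kernels.intro Q stationary_kernels_axioms.intro Z measurable_translate5)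
  qed (auto simp: translate5_def)
  let ?A = "cbox (0::'a) One"
  define f :: "('a measure \<times> 'a measure \<times> 'a measure \<times> 'a measure \<times> 'a uprod measure) \<times> 'a \<times> 'a \<Rightarrow> ennreal"
    where "f p = emeasure (snd (snd (snd (snd (fst p))))) {Upair (fst (snd p)) (snd (snd p))}" for p
  have f: "f \<in> borel_measurable (configs5 \<Otimes>\<^sub>M borel \<Otimes>\<^sub>M borel)"
  proof -
    have "(\<lambda>p. (snd (snd (snd (snd (fst p)))), snd p)) \<in> configs5 \<Otimes>\<^sub>M borel \<Otimes>\<^sub>M borel \<rightarrow>\<^sub>M
        pair_configs \<Otimes>\<^sub>M borel \<Otimes>\<^sub>M (borel :: 'a measure)"
      by measurable
    from measurable_compose[OF this measurable_emeasure_Upair] show ?thesis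
      by (simp add: f_def[abs_def] case_prod_beta')
  qed
  have "f (translate5 t z, x + t, y + t) = f (z, x, y)" if "z \<in> space configs5" for z x y t
  proof -
    obtain r hr b hb m where z: "z = (r, hr, b, hb, m)" by (cases z)
    have m: "sets m = sets uprod_borel" using that by (auto simp: z space_pair_measure sets_point_measure)
    have "map_uprod (\<lambda>x. x + t) -` {Upair (x + t) (y + t)} = {Upair x y}"
    proof (intro set_eqI)
      fix e :: "'a uprod" show "e \<in> map_uprod (\<lambda>x. x + t) -` {Upair (x + t) (y + t)} \<longleftrightarrow> e \<in> {Upair x y}"
        by (cases e) auto
    qed
    then show ?thesis
      by (simp add: f_def translate5_def z emeasure_translate_pairs[OF m singleton_uprod_borel])
  qed
  from mass_transport[OF f this]
  have mt: "(\<integral>\<^sup>+v. (\<integral>\<^sup>+x. indicator ?A x * (\<integral>\<^sup>+y. emeasure (M v) {Upair x y} \<partial>B v) \<partial>R v) \<partial>Q) =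
    (\<integral>\<^sup>+v. (\<integral>\<^sup>+y. indicator ?A y * (\<integral>\<^sup>+x. emeasure (M v) {Upair x y} \<partial>R v) \<partial>B v) \<partial>Q)"
    by (simp add: f_def Z_def)
  have conf: "R v \<in> point_measures borel bounded" "\<eta>R v \<in> point_measures borel bounded"
      "B v \<in> point_measures borel bounded" "\<eta>B v \<in> point_measures borel bounded"
      "M v \<in> point_measures uprod_borel bounded_pairs" if "v \<in> space Q" for v
    using measurable_space[OF measurable_Z that] by (auto simp: Z_def space_pair_measure)
  have nn_cong: "(\<integral>\<^sup>+x. indicator ?A x * g x \<partial>\<mu>) = (\<integral>\<^sup>+x. indicator ?A x * g' x \<partial>\<mu>)"
    if \<mu>: "\<mu> \<in> point_measures borel bounded" and "\<And>x. x \<in> atoms \<mu> \<Longrightarrow> g x = g' x" for \<mu> :: "'a measure" and g g'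
  proof (rule nn_integral_cong_AE)
    show "AE x in \<mu>. indicator ?A x * g x = indicator ?A x * g' x"
      using AE_atoms[OF \<mu>] by eventually_elim (simp add: that)
  qed
  have sch: "AE v in Q. two_color_multi_matching (M v) (R v) (\<eta>R v) (B v) (\<eta>B v)" "AE v in Q. simple_measure (M v)"
    using scheme by (auto simp: scheme_def)
  have "(\<integral>\<^sup>+v. (\<integral>\<^sup>+x. indicator ?A x * (\<integral>\<^sup>+y. emeasure (M v) {Upair x y} \<partial>B v) \<partial>R v) \<partial>Q) = intensity Q \<eta>R"
    unfolding intensity_def
  proof (rule nn_integral_cong_AE)
    show "AE v in Q. (\<integral>\<^sup>+x. indicator ?A x * (\<integral>\<^sup>+y. emeasure (M v) {Upair x y} \<partial>B v) \<partial>R v) =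
        emeasure (\<eta>R v) ?A"
      using sch simple disjoint marks AE_space
    proof eventually_elim
      case (elim v)
      note c = conf[OF \<open>v \<in> space Q\<close>]
      have "(\<integral>\<^sup>+x. indicator ?A x * (\<integral>\<^sup>+y. emeasure (M v) {Upair x y} \<partial>B v) \<partial>R v) =
          (\<integral>\<^sup>+x. indicator ?A x * emeasure (\<eta>R v) {x} \<partial>R v)"
      proof (rule nn_cong[OF c(1)])
        fix x assume x: "x \<in> atoms (R v)"
        have "(\<integral>\<^sup>+y. emeasure (M v) {Upair x y} \<partial>B v) = vertex_degree (atoms (M v)) x"
          by (rule nn_integral_scheme_degree[where r="R v"])
             (use elim c x in \<open>auto simp: two_color_multi_matching_def\<close>)
        then show "(\<integral>\<^sup>+y. emeasure (M v) {Upair x y} \<partial>B v) = emeasure (\<eta>R v) {x}"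
          using elim x by (simp add: two_color_multi_matching_def)
      qed
      also have "\<dots> = emeasure (\<eta>R v) ?A"
        using elim c by (intro emeasure_marks) auto
      finally show ?case .
    qed
  qed
  moreover have "(\<integral>\<^sup>+v. (\<integral>\<^sup>+y. indicator ?A y * (\<integral>\<^sup>+x. emeasure (M v) {Upair x y} \<partial>R v) \<partial>B v) \<partial>Q) = intensity Q \<eta>B"
    unfolding intensity_def
  proof (rule nn_integral_cong_AE)
    show "AE v in Q. (\<integral>\<^sup>+y. indicator ?A y * (\<integral>\<^sup>+x. emeasure (M v) {Upair x y} \<partial>R v) \<partial>B v) =
        emeasure (\<eta>B v) ?A"
      using sch simple disjoint marks AE_space
    proof eventually_elim
      case (elim v)
      note c = conf[OF \<open>v \<in> space Q\<close>]
      have "(\<integral>\<^sup>+y. indicator ?A y * (\<integral>\<^sup>+x. emeasure (M v) {Upair x y} \<partial>R v) \<partial>B v) =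
          (\<integral>\<^sup>+y. indicator ?A y * emeasure (\<eta>B v) {y} \<partial>B v)"
      proof (rule nn_cong[OF c(3)])
        fix y assume y: "y \<in> atoms (B v)"
        have "(\<integral>\<^sup>+x. emeasure (M v) {Upair y x} \<partial>R v) = vertex_degree (atoms (M v)) y"
        proof (rule nn_integral_scheme_degree[where r="B v"])
          fix e assume "e \<in> atoms (M v)"
          then obtain x y where "x \<in> atoms (R v)" "y \<in> atoms (B v)" "e = Upair x y"
            using elim by (auto simp: two_color_multi_matching_def)
          moreover have "Upair x y = Upair y x" by (simp add: Upair_inject)
          ultimately show "\<exists>x\<in>atoms (B v). \<exists>y\<in>atoms (R v). e = Upair x y" by auto
        qed (use elim c y in auto)
        moreover have "Upair y x = Upair x y" for x by (simp add: Upair_inject)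
        ultimately show "(\<integral>\<^sup>+x. emeasure (M v) {Upair x y} \<partial>R v) = emeasure (\<eta>B v) {y}"
          using elim y by (simp add: two_color_multi_matching_def)
      qed
      also have "\<dots> = emeasure (\<eta>B v) ?A"
        using elim c by (intro emeasure_marks) auto
      finally show ?case .
    qed
  qed
  ultimately show ?thesis using mt by simp
qed

text \<open>Extra randomness leaves the marked processes alone: \<open>P\<close> is the image of
  \<open>Q\<close> under \<open>fst\<close>, so almost sure properties lift to \<open>Q\<close> and
  intensities are the same on both spaces.\<close>

lemma scheme_exists_intensity:
  fixes R \<eta>R B \<eta>B :: "'w \<Rightarrow> ('a::euclidean_space) measure"
  assumes "scheme_exists P R \<eta>R B \<eta>B"
    and meas: "\<eta>R \<in> P \<rightarrow>\<^sub>M configs" "\<eta>B \<in> P \<rightarrow>\<^sub>M configs"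
    and disjoint: "AE \<omega> in P. atoms (R \<omega>) \<inter> atoms (B \<omega>) = {}"
    and simple: "AE \<omega> in P. simple_measure (R \<omega>)" "AE \<omega> in P. simple_measure (B \<omega>)"
    and marks: "AE \<omega> in P. atoms (\<eta>R \<omega>) = atoms (R \<omega>)" "AE \<omega> in P. atoms (\<eta>B \<omega>) = atoms (B \<omega>)"
  shows "intensity P \<eta>R = intensity P \<eta>B"
proof -
  obtain Q :: "('w \<times> 'a uprod measure) measure" and M where Q: "prob_space Q" "fst \<in> Q \<rightarrow>\<^sub>M P" "distr Q P fst = P"
    and M: "scheme Q (R \<circ> fst) (\<eta>R \<circ> fst) (B \<circ> fst) (\<eta>B \<circ> fst) M"
    using assms(1) by (auto simp: scheme_exists_def extension_def)
  have AE: "AE v in Q. \<phi> (fst v)" if "AE \<omega> in P. \<phi> \<omega>" for \<phi>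
    using that by (intro AE_distrD[OF Q(2)]) (subst Q(3))
  have "intensity Q (\<eta>R \<circ> fst) = intensity Q (\<eta>B \<circ> fst)"
    using AE[OF disjoint] AE[OF simple(1)] AE[OF simple(2)] AE[OF marks(1)] AE[OF marks(2)]
    by (intro scheme_intensity[OF Q(1) M]) (simp_all add: comp_def)
  moreover have "intensity Q (\<eta> \<circ> fst) = intensity P \<eta>" if \<eta>: "\<eta> \<in> P \<rightarrow>\<^sub>M configs" for \<eta> :: "'w \<Rightarrow> 'a measure"
  proof -
    have "(\<lambda>\<omega>. emeasure (\<eta> \<omega>) (cbox 0 One)) \<in> borel_measurable P"
      using measurable_compose[OF \<eta> measurable_emeasure_point_measure_space] by auto
    then have "(\<integral>\<^sup>+\<omega>. emeasure (\<eta> \<omega>) (cbox 0 One) \<partial>distr Q P fst) =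
        (\<integral>\<^sup>+v. emeasure (\<eta> (fst v)) (cbox 0 One) \<partial>Q)"
      by (intro nn_integral_distr) (use Q in auto)
    then show ?thesis by (simp only: intensity_def Q(3) comp_def)
  qed
  ultimately show ?thesis using meas by simp
qed

text \<open>The law of the five components is the image of the law of the marked processes under
  \<open>\<Psi>\<close>, which commutes with translations; invariance is inherited.\<close>

lemma scheme_existsI:
  fixes R \<eta>R B \<eta>B :: "'w \<Rightarrow> ('a::euclidean_space) measure"
  assumes P: "prob_space P"
    and inv: "translation_invariant P configs4 translate4 (\<lambda>\<omega>. (R \<omega>, \<eta>R \<omega>, B \<omega>, \<eta>B \<omega>))"
    and match: "AE \<omega> in P. two_color_multi_matching (matching (R \<omega>) (\<eta>R \<omega>) (B \<omega>) (\<eta>B \<omega>))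
      (R \<omega>) (\<eta>R \<omega>) (B \<omega>) (\<eta>B \<omega>)"
    and simple: "AE \<omega> in P. simple_measure (matching (R \<omega>) (\<eta>R \<omega>) (B \<omega>) (\<eta>B \<omega>))"
  shows "scheme_exists P R \<eta>R B \<eta>B"
proof -
  interpret P: prob_space P by (rule P)
  \<comment> \<open>A scheme lives on a product space, but the matching is a function of the first
    component; the second one is constant, a point mass at an arbitrary value.\<close>
  define D :: "'a uprod measure measure" where "D = return (count_space UNIV) undefined"
  interpret D: prob_space D unfolding D_def by (rule prob_space_return) simp
  define Q where "Q = P \<Otimes>\<^sub>M D"
  interpret Q: pair_prob_space P D ..
  have fst: "fst \<in> Q \<rightarrow>\<^sub>M P" by (simp add: Q_def)
  have dist: "distr Q P fst = P" unfolding Q_def by (rule D.distr_pair_fst)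
  define Z where "Z \<omega> = (R \<omega>, \<eta>R \<omega>, B \<omega>, \<eta>B \<omega>)" for \<omega>
  define \<Psi> :: "_ \<Rightarrow> _ \<times> _ \<times> _ \<times> _ \<times> 'a uprod measure"
    where "\<Psi> z = (case z of (r, hr, b, hb) \<Rightarrow> (r, hr, b, hb, matching r hr b hb))" for z
  have Z [measurable]: "Z \<in> P \<rightarrow>\<^sub>M configs4"
    and Zinv: "distr P configs4 (\<lambda>\<omega>. translate4 t (Z \<omega>)) = distr P configs4 Z" for t
    using inv by (auto simp: translation_invariant_def Z_def[abs_def])
  note [measurable] = measurable_translate4[of t for t] fst
  have \<Psi> [measurable]: "\<Psi> \<in> configs4 \<rightarrow>\<^sub>M configs5"
    unfolding \<Psi>_def case_prod_beta' by (intro measurable_Pair measurable_matching) measurable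
  have \<Psi>T: "translate5 t (\<Psi> z) = \<Psi> (translate4 t z)" if "z \<in> space configs4" for t z
    using that by (auto simp: \<Psi>_def translate4_def translate5_def space_pair_measure matching_translate)
  have law: "distr Q configs5 (\<lambda>v. \<Psi> (g (fst v))) = distr (distr P configs4 g) configs5 \<Psi>"
    if [measurable]: "g \<in> P \<rightarrow>\<^sub>M configs4" for g
    by (subst dist[symmetric]) (simp add: distr_distr comp_def)
  have "translation_invariant Q configs5 translate5 (\<lambda>v. \<Psi> (Z (fst v)))"
    unfolding translation_invariant_def
  proof (intro conjI allI)
    show "(\<lambda>v. \<Psi> (Z (fst v))) \<in> Q \<rightarrow>\<^sub>M configs5" by measurable
    fix t
    have "distr Q configs5 (\<lambda>v. translate5 t (\<Psi> (Z (fst v)))) =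
        distr Q configs5 (\<lambda>v. \<Psi> (translate4 t (Z (fst v))))"
      using measurable_space[OF fst] measurable_space[OF Z]
      by (intro distr_cong refl) (auto intro!: \<Psi>T)
    also have "\<dots> = distr Q configs5 (\<lambda>v. \<Psi> (Z (fst v)))"
      using law[of "\<lambda>\<omega>. translate4 t (Z \<omega>)"] law[OF Z] by (simp add: Zinv)
    finally show "distr Q configs5 (\<lambda>v. translate5 t (\<Psi> (Z (fst v)))) =
        distr Q configs5 (\<lambda>v. \<Psi> (Z (fst v)))" .
  qed
  then have "translation_invariant Q configs5 translate5 (\<lambda>v. (R (fst v), \<eta>R (fst v), B (fst v), \<eta>B (fst v),
      matching (R (fst v)) (\<eta>R (fst v)) (B (fst v)) (\<eta>B (fst v))))"
    unfolding \<Psi>_def Z_def prod.case .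
  moreover have AE: "AE v in Q. \<phi> (fst v)" if "AE \<omega> in P. \<phi> \<omega>" for \<phi>
    using that by (intro AE_distrD[OF fst]) (subst dist)
  moreover have "(\<lambda>v. matching (R (fst v)) (\<eta>R (fst v)) (B (fst v)) (\<eta>B (fst v))) \<in> Q \<rightarrow>\<^sub>M pair_configs"
  proof -
    have "(\<lambda>v. snd (snd (snd (snd (\<Psi> (Z (fst v))))))) \<in> Q \<rightarrow>\<^sub>M pair_configs" by measurable
    then show ?thesis by (simp add: \<Psi>_def Z_def)
  qed
  ultimately have "scheme Q (R \<circ> fst) (\<eta>R \<circ> fst) (B \<circ> fst) (\<eta>B \<circ> fst)
      (\<lambda>v. matching (R (fst v)) (\<eta>R (fst v)) (B (fst v)) (\<eta>B (fst v)))"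
    using AE[OF match] AE[OF simple] by (simp add: scheme_def)
  moreover have "extension P Q"
    using fst dist Q.prob_space_axioms by (simp add: extension_def Q_def)
  ultimately show ?thesis unfolding scheme_exists_def by blast
qed

section \<open>Saturation when the mean number of stubs is finite\<close>

lemma ergodicD:
  assumes "ergodic P S T Z" "A \<in> sets S" "\<And>t z. z \<in> space S \<Longrightarrow> T t z \<in> A \<longleftrightarrow> z \<in> A"
  shows "measure P {\<omega> \<in> space P. Z \<omega> \<in> A} \<in> {0, 1}"
  using assms unfolding ergodic_def by blast

text \<open>The statements in this locale concern the red color; \<open>swap\<close> makes each of
  them available for blue.\<close>

locale matching_problem = prob_space P for P :: "'w measure" +
  fixes R \<eta>R B \<eta>B :: "'w \<Rightarrow> ('a::euclidean_space) measure"
  assumes measurable_R [measurable]: "R \<in> P \<rightarrow>\<^sub>M configs" and measurable_\<eta>R [measurable]: "\<eta>R \<in> P \<rightarrow>\<^sub>M configs"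
    and measurable_B [measurable]: "B \<in> P \<rightarrow>\<^sub>M configs" and measurable_\<eta>B [measurable]: "\<eta>B \<in> P \<rightarrow>\<^sub>M configs"
    and disjoint: "AE \<omega> in P. atoms (R \<omega>) \<inter> atoms (B \<omega>) = {}"
    and erg: "ergodic P configs4 translate4 (\<lambda>\<omega>. (R \<omega>, \<eta>R \<omega>, B \<omega>, \<eta>B \<omega>))"
    and simple_R: "AE \<omega> in P. simple_measure (R \<omega>)" and simple_B: "AE \<omega> in P. simple_measure (B \<omega>)"
    and marks_R: "AE \<omega> in P. atoms (\<eta>R \<omega>) = atoms (R \<omega>)"
    and marks_B: "AE \<omega> in P. atoms (\<eta>B \<omega>) = atoms (B \<omega>)"
    and non_equidistant: "AE \<omega> in P. non_equidistant (atoms (R \<omega>) \<union> atoms (B \<omega>))"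
    and no_chain: "AE \<omega> in P. \<not> (\<exists>x. descending_chain (atoms (R \<omega>) \<union> atoms (B \<omega>)) x)"
begin

section \<open>Unsaturated red points and ergodicity\<close>

abbreviation Z where "Z \<omega> \<equiv> (R \<omega>, \<eta>R \<omega>, B \<omega>, \<eta>B \<omega>)"

abbreviation red_of where "red_of \<equiv> fst :: ('a measure \<times> 'a measure \<times> 'a measure \<times> 'a measure) \<Rightarrow> 'a measure"
abbreviation red_marks_of where "red_marks_of \<equiv> (\<lambda>z. fst (snd z)) :: ('a measure \<times> 'a measure \<times> 'a measure \<times> 'a measure) \<Rightarrow> 'a measure"
abbreviation blue_of where "blue_of \<equiv> (\<lambda>z. fst (snd (snd z))) :: ('a measure \<times> 'a measure \<times> 'a measure \<times> 'a measure) \<Rightarrow> 'a measure"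
abbreviation blue_marks_of where "blue_marks_of \<equiv> (\<lambda>z. snd (snd (snd z))) :: ('a measure \<times> 'a measure \<times> 'a measure \<times> 'a measure) \<Rightarrow> 'a measure"

abbreviation matched_in :: "('a measure \<times> 'a measure \<times> 'a measure \<times> 'a measure) \<Rightarrow> 'a \<Rightarrow> 'a \<Rightarrow> bool" where
  "matched_in z \<equiv> matched (red_of z) (red_marks_of z) (blue_of z) (blue_marks_of z)"

definition unsat :: "('a measure \<times> 'a measure \<times> 'a measure \<times> 'a measure) \<Rightarrow> 'a \<Rightarrow> bool" where
  "unsat z x \<longleftrightarrow> x \<in> atoms (red_of z) \<and> emeasure (blue_of z) {y. matched_in z x y} < emeasure (red_marks_of z) {x}"

lemma good: "AE \<omega> in P. bicolored_points (R \<omega>) (\<eta>R \<omega>) (B \<omega>) (\<eta>B \<omega>)"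
  using disjoint simple_R simple_B non_equidistant no_chain AE_space
proof eventually_elim
  case (elim \<omega>)
  have "R \<omega> \<in> point_measures borel bounded" "\<eta>R \<omega> \<in> point_measures borel bounded"
      "B \<omega> \<in> point_measures borel bounded" "\<eta>B \<omega> \<in> point_measures borel bounded"
    using elim measurable_space[OF measurable_R] measurable_space[OF measurable_\<eta>R]
      measurable_space[OF measurable_B] measurable_space[OF measurable_\<eta>B] by auto
  then show ?case using elim by (simp add: bicolored_points_def)
qed

lemma stationary: "stationary_kernels P configs4 translate4 Z red_of blue_of"
  using erg prob_space_axioms measurable_translate4
  by (auto simp: stationary_kernels_def stationary_kernels_axioms_def ergodic_def translate4_def)

lemma measurable_Z [measurable]: "Z \<in> P \<rightarrow>\<^sub>M configs4"
  by measurable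

lemma matched_in_translate: "z \<in> space configs4 \<Longrightarrow> matched_in (translate4 t z) (x + t) (y + t) \<longleftrightarrow> matched_in z x y"
  by (auto simp: translate4_def space_pair_measure matched_translate sets_configs)

lemma pred_matched_in: "Measurable.pred (configs4 \<Otimes>\<^sub>M borel \<Otimes>\<^sub>M borel) (\<lambda>(z, x, y). matched_in z x y)"
  by (rule pred_matched) measurable

lemma pred_unsat [measurable]: "Measurable.pred (configs4 \<Otimes>\<^sub>M borel) (\<lambda>(z, x). unsat z x)"
proof -
  note [measurable] = pred_compose3[OF pred_matched_in] measurable_emeasure_singleton measurable_atoms
  show ?thesis unfolding unsat_def case_prod_beta' by measurable
qed

lemma unsat_translate: "z \<in> space configs4 \<Longrightarrow> unsat (translate4 t z) (x + t) \<longleftrightarrow> unsat z x"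
proof -
  assume z: "z \<in> space configs4"
  obtain r hr b hb where zz: "z = (r, hr, b, hb)" by (cases z)
  have s: "sets r = sets borel" "sets hr = sets borel" "sets b = sets borel" "sets hb = sets borel"
    using z by (auto simp: zz space_pair_measure sets_configs)
  have "{y. matched_in (translate4 t z) (x + t) (y + t)} = {y. matched_in z x y}"
    using matched_in_translate[OF z] by simp
  then show ?thesis
    by (simp add: unsat_def zz translate4_def atoms_translate[OF s(1)] emeasure_translate_singleton[OF s(2)]
        emeasure_translate[OF s(3)] vimage_Collect_translate)
qed

text \<open>For simple red measures this is the number of unsaturated points. It is invariant under
  translations: whether it vanishes is settled by ergodicity, and finite positive values are
  excluded by stationarity.\<close>

definition unsat_mass :: "('a measure \<times> 'a measure \<times> 'a measure \<times> 'a measure) \<Rightarrow> ennreal" where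
  "unsat_mass z = emeasure (red_of z) {x. unsat z x}"

lemma measurable_unsat_mass [measurable]: "unsat_mass \<in> borel_measurable configs4"
  unfolding unsat_mass_def[abs_def] by measurable

lemma unsat_mass_translate: "z \<in> space configs4 \<Longrightarrow> unsat_mass (translate4 t z) = unsat_mass z"
proof -
  assume z: "z \<in> space configs4"
  then have "sets (fst z) = sets borel" by (auto simp: space_pair_measure sets_configs)
  moreover have "red_of (translate4 t z) = translate t (red_of z)" by (cases z) (simp add: translate4_def)
  ultimately show ?thesis
    by (simp add: unsat_mass_def emeasure_translate vimage_Collect_translate unsat_translate[OF z])
qed

text \<open>If unsaturated points exist with positive probability, they exist almost surely.
  Arguments by contradiction may thus start from the almost sure statement.\<close>

lemma zero_one: "(AE \<omega> in P. unsat_mass (Z \<omega>) = 0) \<or> (AE \<omega> in P. unsat_mass (Z \<omega>) \<noteq> 0)"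
proof -
  let ?A = "{z \<in> space configs4. unsat_mass z = 0}"
  have A: "?A \<in> sets configs4" by measurable
  have "measure P {\<omega> \<in> space P. Z \<omega> \<in> ?A} \<in> {0, 1}"
  proof -
    have "translate4 t z \<in> ?A \<longleftrightarrow> z \<in> ?A" if "z \<in> space configs4" for t z
      using that measurable_space[OF measurable_translate4 that] by (simp add: unsat_mass_translate)
    from ergodicD[OF erg A this] show ?thesis .
  qed
  moreover have eq: "{\<omega> \<in> space P. Z \<omega> \<in> ?A} = {\<omega> \<in> space P. unsat_mass (Z \<omega>) = 0}"
    using measurable_space[OF measurable_Z] by auto
  moreover have "{\<omega> \<in> space P. unsat_mass (Z \<omega>) = 0} \<in> events" by measurable
  ultimately show ?thesis
    using prob_eq_0[of "{\<omega> \<in> space P. unsat_mass (Z \<omega>) = 0}"] prob_eq_1[of "{\<omega> \<in> space P. unsat_mass (Z \<omega>) = 0}"]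
    by (auto elim!: eventually_mono)
qed

lemma unsat_mass_eq_0:
  assumes "bicolored_points (R \<omega>) (\<eta>R \<omega>) (B \<omega>) (\<eta>B \<omega>)"
  shows "unsat_mass (Z \<omega>) = 0 \<longleftrightarrow> (\<forall>x. \<not> unsat (Z \<omega>) x)"
proof -
  interpret bicolored_points "R \<omega>" "\<eta>R \<omega>" "B \<omega>" "\<eta>B \<omega>" by (rule assms)
  show ?thesis
    unfolding unsat_mass_def by (simp, subst emeasure_r) (auto simp: unsat_def emeasure_count_space_eq_0)
qed

lemma saturated_iff:
  assumes "bicolored_points (R \<omega>) (\<eta>R \<omega>) (B \<omega>) (\<eta>B \<omega>)"
  shows "unsat_mass (Z \<omega>) = 0 \<longleftrightarrow>
    (\<forall>x\<in>atoms (R \<omega>). emeasure (B \<omega>) {y. matched_in (Z \<omega>) x y} = emeasure (\<eta>R \<omega>) {x})"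
proof -
  interpret bicolored_points "R \<omega>" "\<eta>R \<omega>" "B \<omega>" "\<eta>B \<omega>" by (rule assms)
  show ?thesis
    using matched_degree_le unfolding unsat_mass_eq_0[OF assms] unsat_def by (auto simp: less_le)
qed

text \<open>The permutation \<open>?s\<close> of the components commutes with translations, so the
  preimage under it of an invariant event is invariant; ergodicity is thereby transferred.\<close>

lemma swap: "matching_problem P B \<eta>B R \<eta>R"
proof -
  let ?s = "\<lambda>z::'a measure \<times> 'a measure \<times> 'a measure \<times> 'a measure. (blue_of z, blue_marks_of z, red_of z, red_marks_of z)"
  have s [measurable]: "?s \<in> configs4 \<rightarrow>\<^sub>M configs4" by measurable
  have Ts: "translate4 t (?s z) = ?s (translate4 t z)" for t z
    by (cases z) (simp add: translate4_def)
  note [measurable] = measurable_translate4[of t for t]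
  have inv: "distr P configs4 (\<lambda>\<omega>. translate4 t (Z \<omega>)) = distr P configs4 Z" for t
    using erg by (simp add: ergodic_def translation_invariant_def)
  have "ergodic P configs4 translate4 (\<lambda>\<omega>. ?s (Z \<omega>))"
    unfolding ergodic_def translation_invariant_def
  proof (intro conjI allI ballI impI)
    show "(\<lambda>\<omega>. ?s (Z \<omega>)) \<in> P \<rightarrow>\<^sub>M configs4" by measurable
  next
    fix t
    have "distr P configs4 (\<lambda>\<omega>. translate4 t (?s (Z \<omega>))) =
        distr (distr P configs4 (\<lambda>\<omega>. translate4 t (Z \<omega>))) configs4 ?s"
      unfolding Ts by (subst distr_distr) (auto simp: comp_def)
    also have "\<dots> = distr P configs4 (\<lambda>\<omega>. ?s (Z \<omega>))"
      unfolding inv by (subst distr_distr) (auto simp: comp_def)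
    finally show "distr P configs4 (\<lambda>\<omega>. translate4 t (?s (Z \<omega>))) = distr P configs4 (\<lambda>\<omega>. ?s (Z \<omega>))" .
  next
    fix A :: "('a measure \<times> 'a measure \<times> 'a measure \<times> 'a measure) set"
    assume A: "A \<in> sets configs4" and iA: "\<forall>t. \<forall>z\<in>space configs4. (translate4 t z \<in> A) = (z \<in> A)"
    have sA: "?s -` A \<inter> space configs4 \<in> sets configs4" using A by measurable
    have "translate4 t z \<in> ?s -` A \<inter> space configs4 \<longleftrightarrow> z \<in> ?s -` A \<inter> space configs4"
      if z: "z \<in> space configs4" for t z
    proof -
      have "?s z \<in> space configs4" using measurable_space[OF s z] .
      then have "translate4 t (?s z) \<in> A \<longleftrightarrow> ?s z \<in> A" using iA by blast
      then show ?thesis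
        using z measurable_space[OF measurable_translate4 z, of t] unfolding Ts by blast
    qed
    from ergodicD[OF erg sA this]
    have "measure P {\<omega> \<in> space P. Z \<omega> \<in> ?s -` A \<inter> space configs4} \<in> {0, 1}" .
    moreover have "{\<omega> \<in> space P. Z \<omega> \<in> ?s -` A \<inter> space configs4} = {\<omega> \<in> space P. ?s (Z \<omega>) \<in> A}"
      using measurable_space[OF measurable_Z] by auto
    ultimately show "measure P {\<omega> \<in> space P. ?s (Z \<omega>) \<in> A} \<in> {0, 1}" by simp
  qed
  then show ?thesis
    using prob_space_axioms measurable_R measurable_\<eta>R measurable_B measurable_\<eta>B disjoint simple_R simple_B
      marks_R marks_B non_equidistant no_chain
    by (simp add: matching_problem_def matching_problem_axioms_def Int_commute Un_commute)
qed

section \<open>Mean degrees and saturation\<close>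

lemma intensity_marks:
  "(\<integral>\<^sup>+\<omega>. (\<integral>\<^sup>+x. indicator (cbox 0 One) x * emeasure (\<eta>R \<omega>) {x} \<partial>R \<omega>) \<partial>P) = intensity P \<eta>R"
  unfolding intensity_def
proof (rule nn_integral_cong_AE)
  show "AE \<omega> in P. (\<integral>\<^sup>+x. indicator (cbox 0 One) x * emeasure (\<eta>R \<omega>) {x} \<partial>R \<omega>) = emeasure (\<eta>R \<omega>) (cbox 0 One)"
    using good marks_R
  proof eventually_elim
    case (elim \<omega>)
    then interpret bicolored_points "R \<omega>" "\<eta>R \<omega>" "B \<omega>" "\<eta>B \<omega>" by simp
    show ?case using elim r hr simple_r by (intro emeasure_marks) auto
  qed
qed

lemma matched_mass_transport:
  "(\<integral>\<^sup>+\<omega>. (\<integral>\<^sup>+x. indicator (cbox 0 One) x * emeasure (B \<omega>) {y. matched_in (Z \<omega>) x y} \<partial>R \<omega>) \<partial>P) =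
   (\<integral>\<^sup>+\<omega>. (\<integral>\<^sup>+y. indicator (cbox 0 One) y * emeasure (R \<omega>) {x. matched_in (Z \<omega>) x y} \<partial>B \<omega>) \<partial>P)"
proof -
  interpret st: stationary_kernels P configs4 translate4 Z red_of blue_of by (rule stationary)
  define f :: "('a measure \<times> 'a measure \<times> 'a measure \<times> 'a measure) \<times> 'a \<times> 'a \<Rightarrow> ennreal"
    where "f p = of_bool (matched_in (fst p) (fst (snd p)) (snd (snd p)))" for p
  note [measurable] = pred_compose3[OF pred_matched_in]
  have f: "f \<in> borel_measurable (configs4 \<Otimes>\<^sub>M borel \<Otimes>\<^sub>M borel)"
    unfolding f_def[abs_def] of_bool_def by measurable
  have fT: "f (translate4 t z, x + t, y + t) = f (z, x, y)" if "z \<in> space configs4" for z x y t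
    using matched_in_translate[OF that, of t x y] by (simp add: f_def)
  have c: "R \<omega> \<in> point_measures borel bounded" "B \<omega> \<in> point_measures borel bounded" if "\<omega> \<in> space P" for \<omega>
    using measurable_space[OF measurable_R that] measurable_space[OF measurable_B that] by auto
  have fB: "(\<integral>\<^sup>+y. f (Z \<omega>, x, y) \<partial>B \<omega>) = emeasure (B \<omega>) {y. matched_in (Z \<omega>) x y}" if \<omega>: "\<omega> \<in> space P" for \<omega> x
  proof -
    have "{y. matched_in (Z \<omega>) x y} \<subseteq> atoms (B \<omega>)" by (auto dest: matched_atoms)
    from borel_subset_atoms[OF c(2)[OF \<omega>] this]
    have "(\<integral>\<^sup>+y. indicator {y. matched_in (Z \<omega>) x y} y \<partial>B \<omega>) = emeasure (B \<omega>) {y. matched_in (Z \<omega>) x y}"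
      by (intro nn_integral_indicator) (simp add: sets_configs[OF c(2)[OF \<omega>]])
    then show ?thesis by (simp add: f_def indicator_def)
  qed
  have fR: "(\<integral>\<^sup>+x. f (Z \<omega>, x, y) \<partial>R \<omega>) = emeasure (R \<omega>) {x. matched_in (Z \<omega>) x y}" if \<omega>: "\<omega> \<in> space P" for \<omega> y
  proof -
    have "{x. matched_in (Z \<omega>) x y} \<subseteq> atoms (R \<omega>)" by (auto dest: matched_atoms)
    from borel_subset_atoms[OF c(1)[OF \<omega>] this]
    have "(\<integral>\<^sup>+x. indicator {x. matched_in (Z \<omega>) x y} x \<partial>R \<omega>) = emeasure (R \<omega>) {x. matched_in (Z \<omega>) x y}"
      by (intro nn_integral_indicator) (simp add: sets_configs[OF c(1)[OF \<omega>]])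
    then show ?thesis by (simp add: f_def indicator_def)
  qed
  have "(\<integral>\<^sup>+\<omega>. (\<integral>\<^sup>+x. indicator (cbox 0 One) x * (\<integral>\<^sup>+y. f (Z \<omega>, x, y) \<partial>B \<omega>) \<partial>R \<omega>) \<partial>P) =
      (\<integral>\<^sup>+\<omega>. (\<integral>\<^sup>+x. indicator (cbox 0 One) x * emeasure (B \<omega>) {y. matched_in (Z \<omega>) x y} \<partial>R \<omega>) \<partial>P)"
    by (intro nn_integral_cong) (simp only: fB)
  moreover have "(\<integral>\<^sup>+\<omega>. (\<integral>\<^sup>+y. indicator (cbox 0 One) y * (\<integral>\<^sup>+x. f (Z \<omega>, x, y) \<partial>R \<omega>) \<partial>B \<omega>) \<partial>P) =
      (\<integral>\<^sup>+\<omega>. (\<integral>\<^sup>+y. indicator (cbox 0 One) y * emeasure (R \<omega>) {x. matched_in (Z \<omega>) x y} \<partial>B \<omega>) \<partial>P)"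
    by (intro nn_integral_cong) (simp only: fR)
  ultimately show ?thesis
    using st.mass_transport[OF f fT] by simp
qed

text \<open>Degree plus the indicator of being unsaturated is at most the mark. If the mean degree
  already equals the finite mean mark, the mean number of unsaturated points in the unit cube is
  0.\<close>

lemma saturated_of_intensity:
  assumes deg: "(\<integral>\<^sup>+\<omega>. (\<integral>\<^sup>+x. indicator (cbox 0 One) x * emeasure (B \<omega>) {y. matched_in (Z \<omega>) x y} \<partial>R \<omega>) \<partial>P) = intensity P \<eta>R"
    and fin: "intensity P \<eta>R < \<infinity>"
  shows "AE \<omega> in P. unsat_mass (Z \<omega>) = 0"
proof -
  let ?A = "cbox (0::'a) One"
  interpret st: stationary_kernels P configs4 translate4 Z red_of blue_of by (rule stationary)
  note [measurable] = pred_compose3[OF pred_matched_in] measurable_emeasure_singleton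
  have c: "R \<omega> \<in> point_measures borel bounded" if "\<omega> \<in> space P" for \<omega>
    using measurable_space[OF measurable_R that] by auto
  let ?u = "\<integral>\<^sup>+\<omega>. (\<integral>\<^sup>+x. indicator ?A x * of_bool (unsat (Z \<omega>) x) \<partial>R \<omega>) \<partial>P"
  have "intensity P \<eta>R + ?u = (\<integral>\<^sup>+\<omega>. (\<integral>\<^sup>+x. indicator ?A x * emeasure (B \<omega>) {y. matched_in (Z \<omega>) x y} \<partial>R \<omega>) +
      (\<integral>\<^sup>+x. indicator ?A x * of_bool (unsat (Z \<omega>) x) \<partial>R \<omega>) \<partial>P)"
    unfolding deg[symmetric] by (rule nn_integral_add[symmetric]) measurable
  also have "\<dots> \<le> (\<integral>\<^sup>+\<omega>. (\<integral>\<^sup>+x. indicator ?A x * emeasure (\<eta>R \<omega>) {x} \<partial>R \<omega>) \<partial>P)"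
  proof (rule nn_integral_mono_AE)
    show "AE \<omega> in P. (\<integral>\<^sup>+x. indicator ?A x * emeasure (B \<omega>) {y. matched_in (Z \<omega>) x y} \<partial>R \<omega>) +
        (\<integral>\<^sup>+x. indicator ?A x * of_bool (unsat (Z \<omega>) x) \<partial>R \<omega>) \<le>
        (\<integral>\<^sup>+x. indicator ?A x * emeasure (\<eta>R \<omega>) {x} \<partial>R \<omega>)"
      using good AE_space
    proof eventually_elim
      case (elim \<omega>)
      then interpret bicolored_points "R \<omega>" "\<eta>R \<omega>" "B \<omega>" "\<eta>B \<omega>" by simp
      have B\<omega>: "(\<lambda>_. B \<omega>) \<in> borel \<rightarrow>\<^sub>M configs" by (rule configs_const[OF b])
      have m: "Measurable.pred (borel \<Otimes>\<^sub>M borel) (\<lambda>(x, y). matched_in (Z \<omega>) x y)"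
        using pred_matched_const[OF r hr b hb] by simp
      have m1: "(\<lambda>x. indicator ?A x * emeasure (B \<omega>) {y. matched_in (Z \<omega>) x y}) \<in> borel_measurable (R \<omega>)"
        using measurable_emeasure_configs[OF B\<omega> m] unfolding measurable_cong_sets[OF sets_configs[OF r] refl]
        by measurable
      have "{x. unsat (Z \<omega>) x} \<in> sets borel"
        by (rule borel_subset_atoms[OF r]) (auto simp: unsat_def)
      then have "(\<lambda>x. indicator ?A x * indicator {x. unsat (Z \<omega>) x} x :: ennreal) \<in> borel_measurable (R \<omega>)"
        unfolding measurable_cong_sets[OF sets_configs[OF r] refl] by measurable
      then have m2: "(\<lambda>x. indicator ?A x * of_bool (unsat (Z \<omega>) x) :: ennreal) \<in> borel_measurable (R \<omega>)"
        by (simp add: indicator_def)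
      \<comment> \<open>Degree and mark are integers, so an unsaturated point misses at least one
        whole edge.\<close>
      have le: "emeasure (B \<omega>) {y. matched_in (Z \<omega>) x y} + of_bool (unsat (Z \<omega>) x) \<le> emeasure (\<eta>R \<omega>) {x}" for x
      proof (cases "unsat (Z \<omega>) x")
        case False
        then show ?thesis using matched_degree_le[of x] by simp
      next
        case True
        obtain k::nat where k: "emeasure (\<eta>R \<omega>) {x} = of_nat k" using mark_nat by blast
        have "emeasure (B \<omega>) {y. matched_in (Z \<omega>) x y} = of_nat (card {y. matched_in (Z \<omega>) x y})"
          using finite_matched[of x] matched_atoms[of "R \<omega>" "\<eta>R \<omega>" "B \<omega>" "\<eta>B \<omega>" x]
          by (subst emeasure_b) auto
        moreover from this have "card {y. matched_in (Z \<omega>) x y} < k" using True k by (simp add: unsat_def)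
        then have "(of_nat (Suc (card {y. matched_in (Z \<omega>) x y})) :: ennreal) \<le> of_nat k"
          unfolding of_nat_le_iff by simp
        ultimately show ?thesis using True k by (simp add: add.commute)
      qed
      have "(\<integral>\<^sup>+x. indicator ?A x * emeasure (B \<omega>) {y. matched_in (Z \<omega>) x y} \<partial>R \<omega>) +
          (\<integral>\<^sup>+x. indicator ?A x * of_bool (unsat (Z \<omega>) x) \<partial>R \<omega>) =
          (\<integral>\<^sup>+x. indicator ?A x * emeasure (B \<omega>) {y. matched_in (Z \<omega>) x y} + indicator ?A x * of_bool (unsat (Z \<omega>) x) \<partial>R \<omega>)"
        by (rule nn_integral_add[symmetric, OF m1 m2])
      also have "\<dots> \<le> (\<integral>\<^sup>+x. indicator ?A x * emeasure (\<eta>R \<omega>) {x} \<partial>R \<omega>)"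
        using le by (intro nn_integral_mono) (auto simp: indicator_def)
      finally show ?case .
    qed
  qed
  also have "\<dots> = intensity P \<eta>R + 0" by (simp add: intensity_marks)
  \<comment> \<open>Cancelling the intensity of the marks is where its finiteness enters.\<close>
  finally have u: "?u = 0"
    using fin by (auto simp: ennreal_add_left_cancel_le)
  \<comment> \<open>Through \<open>stationary_total\<close>, the vanishing mean in the unit cube
    passes to the whole space.\<close>
  define f :: "('a measure \<times> 'a measure \<times> 'a measure \<times> 'a measure) \<times> 'a \<Rightarrow> ennreal"
    where "f p = of_bool (unsat (fst p) (snd p))" for p
  have f: "f \<in> borel_measurable (configs4 \<Otimes>\<^sub>M borel)"
    using pred_unsat unfolding f_def[abs_def] of_bool_def case_prod_beta' by measurable
  have "(\<integral>\<^sup>+\<omega>. (\<integral>\<^sup>+x. f (Z \<omega>, x) \<partial>R \<omega>) \<partial>P) = \<infinity> * (\<integral>\<^sup>+\<omega>. (\<integral>\<^sup>+x. indicator ?A x * f (Z \<omega>, x) \<partial>R \<omega>) \<partial>P)"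
    using st.stationary_total[OF f] unsat_translate by (simp add: f_def)
  also have "\<dots> = 0" using u by (simp add: f_def)
  finally have "(\<integral>\<^sup>+\<omega>. (\<integral>\<^sup>+x. f (Z \<omega>, x) \<partial>R \<omega>) \<partial>P) = 0" .
  moreover have "(\<integral>\<^sup>+x. f (Z \<omega>, x) \<partial>R \<omega>) = unsat_mass (Z \<omega>)" if \<omega>: "\<omega> \<in> space P" for \<omega>
  proof -
    have "{x. unsat (Z \<omega>) x} \<subseteq> atoms (R \<omega>)" by (auto simp: unsat_def)
    from borel_subset_atoms[OF c[OF \<omega>] this]
    have "(\<integral>\<^sup>+x. indicator {x. unsat (Z \<omega>) x} x \<partial>R \<omega>) = emeasure (R \<omega>) {x. unsat (Z \<omega>) x}"
      by (intro nn_integral_indicator) (simp add: sets_configs[OF c[OF \<omega>]])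
    then show ?thesis by (simp add: f_def indicator_def unsat_mass_def)
  qed
  ultimately have "(\<integral>\<^sup>+\<omega>. unsat_mass (Z \<omega>) \<partial>P) = 0" by (simp cong: nn_integral_cong)
  then show ?thesis by (subst (asm) nn_integral_0_iff_AE) auto
qed

text \<open>
  The uniform distribution on a finite nonempty set of unsaturated points cannot be stationary.
\<close>

lemma unsat_not_finite:
  assumes "AE \<omega> in P. unsat_mass (Z \<omega>) \<noteq> 0 \<and> unsat_mass (Z \<omega>) < \<infinity>"
  shows False
proof -
  let ?A = "cbox (0::'a) One"
  interpret st: stationary_kernels P configs4 translate4 Z red_of blue_of by (rule stationary)
  have c: "R \<omega> \<in> point_measures borel bounded" if "\<omega> \<in> space P" for \<omega>
    using measurable_space[OF measurable_R that] by auto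
  define f :: "('a measure \<times> 'a measure \<times> 'a measure \<times> 'a measure) \<times> 'a \<Rightarrow> ennreal"
    where "f p = indicator {x. unsat (fst p) x} (snd p) / unsat_mass (fst p)" for p
  have f: "f \<in> borel_measurable (configs4 \<Otimes>\<^sub>M borel)"
    using pred_unsat unfolding f_def[abs_def] indicator_def case_prod_beta' by measurable
  have fT: "f (translate4 t z, x + t) = f (z, x)" if "z \<in> space configs4" for z x t
    using unsat_translate[OF that, of t x] unsat_mass_translate[OF that, of t] by (simp add: f_def indicator_def)
  have "AE \<omega> in P. (\<integral>\<^sup>+x. f (Z \<omega>, x) \<partial>R \<omega>) = 1"
    using assms AE_space
  proof eventually_elim
    case (elim \<omega>)
    have "{x. unsat (Z \<omega>) x} \<subseteq> atoms (R \<omega>)" by (auto simp: unsat_def)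
    from borel_subset_atoms[OF c[OF elim(2)] this] have U: "{x. unsat (Z \<omega>) x} \<in> sets (R \<omega>)"
      by (simp add: sets_configs[OF c[OF elim(2)]])
    have "(\<integral>\<^sup>+x. f (Z \<omega>, x) \<partial>R \<omega>) = emeasure (R \<omega>) {x. unsat (Z \<omega>) x} / unsat_mass (Z \<omega>)"
      using U by (simp add: f_def nn_integral_divide)
    then show ?case using elim(1) by (simp add: unsat_mass_def)
  qed
  then have "(\<integral>\<^sup>+\<omega>. (\<integral>\<^sup>+x. f (Z \<omega>, x) \<partial>R \<omega>) \<partial>P) = (\<integral>\<^sup>+\<omega>. 1 \<partial>P)"
    by (rule nn_integral_cong_AE)
  \<comment> \<open>The weights of the uniform distribution add up to 1, whereas the mean total of a
    stationary weight is 0 or infinite.\<close>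
  then have "1 = \<infinity> * (\<integral>\<^sup>+\<omega>. (\<integral>\<^sup>+x. indicator ?A x * f (Z \<omega>, x) \<partial>R \<omega>) \<partial>P)"
    using st.stationary_total[OF f fT] by (simp add: emeasure_space_1)
  then show False by (auto simp: ennreal_top_mult split: if_splits)
qed

end

text \<open>Unqualified names speak of red, names with the prefix \<open>blue\<close> of the same
  configuration with the colors exchanged.\<close>

locale bicolored_matching_problem = matching_problem +
  blue: matching_problem P B \<eta>B R \<eta>R
begin

lemma matched_in_swap: "blue.matched_in (B \<omega>, \<eta>B \<omega>, R \<omega>, \<eta>R \<omega>) y x \<longleftrightarrow> matched_in (Z \<omega>) x y"
  by (simp add: matched_swap[of "B \<omega>"])

lemma saturated_finite:
  assumes eq: "intensity P \<eta>R = intensity P \<eta>B" and fin: "intensity P \<eta>R < \<infinity>"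
  shows "AE \<omega> in P. unsat_mass (Z \<omega>) = 0"
proof (rule ccontr)
  assume contra: "\<not> ?thesis"
  then have red: "AE \<omega> in P. unsat_mass (Z \<omega>) \<noteq> 0" using zero_one by blast
  have "\<not> (AE \<omega> in P. blue.unsat_mass (blue.Z \<omega>) = 0)"
  proof
    assume *: "AE \<omega> in P. blue.unsat_mass (blue.Z \<omega>) = 0"
    have "(\<integral>\<^sup>+\<omega>. (\<integral>\<^sup>+x. indicator (cbox 0 One) x * emeasure (B \<omega>) {y. matched_in (Z \<omega>) x y} \<partial>R \<omega>) \<partial>P) =
        (\<integral>\<^sup>+\<omega>. (\<integral>\<^sup>+y. indicator (cbox 0 One) y * emeasure (R \<omega>) {x. matched_in (Z \<omega>) x y} \<partial>B \<omega>) \<partial>P)"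
      by (rule matched_mass_transport)
    also have "\<dots> = (\<integral>\<^sup>+\<omega>. (\<integral>\<^sup>+y. indicator (cbox 0 One) y * emeasure (\<eta>B \<omega>) {y} \<partial>B \<omega>) \<partial>P)"
    proof (rule nn_integral_cong_AE)
      show "AE \<omega> in P. (\<integral>\<^sup>+y. indicator (cbox 0 One) y * emeasure (R \<omega>) {x. matched_in (Z \<omega>) x y} \<partial>B \<omega>) =
          (\<integral>\<^sup>+y. indicator (cbox 0 One) y * emeasure (\<eta>B \<omega>) {y} \<partial>B \<omega>)"
        using * blue.good AE_space
      proof eventually_elim
        case (elim \<omega>)
        then interpret b: bicolored_points "B \<omega>" "\<eta>B \<omega>" "R \<omega>" "\<eta>R \<omega>" by simp
        have sat: "emeasure (R \<omega>) {x. matched_in (Z \<omega>) x y} = emeasure (\<eta>B \<omega>) {y}" if "y \<in> atoms (B \<omega>)" for y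
          using elim blue.saturated_iff[OF elim(2)] that by (simp add: matched_in_swap[simplified])
        show ?case
          using AE_atoms[OF b.r] by (intro nn_integral_cong_AE) (auto elim!: eventually_mono simp: sat[simplified])
      qed
    qed
    also have "\<dots> = intensity P \<eta>R" by (simp add: blue.intensity_marks eq)
    finally have "AE \<omega> in P. unsat_mass (Z \<omega>) = 0"
      using fin by (rule saturated_of_intensity)
    then show False using contra by blast
  qed
  then have blue: "AE \<omega> in P. blue.unsat_mass (blue.Z \<omega>) \<noteq> 0" using blue.zero_one by blast
  show False
  proof (rule unsat_not_finite)
    show "AE \<omega> in P. unsat_mass (Z \<omega>) \<noteq> 0 \<and> unsat_mass (Z \<omega>) < \<infinity>"
      using red blue good blue.good
    proof eventually_elim
      case (elim \<omega>)
      then interpret bicolored_points "R \<omega>" "\<eta>R \<omega>" "B \<omega>" "\<eta>B \<omega>" by simp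
      obtain y where y: "blue.unsat (blue.Z \<omega>) y"
        using elim blue.unsat_mass_eq_0[OF elim(4)] by blast
      have yb: "y \<in> atoms (B \<omega>)" "emeasure (R \<omega>) {x. matched_in (Z \<omega>) x y} < emeasure (\<eta>B \<omega>) {y}"
        using y by (auto simp: blue.unsat_def matched_in_swap[simplified])
      \<comment> \<open>The unsaturated red points all lie among the partners of a single blue point
        \<open>y\<close>, whose degree is bounded by its mark.\<close>
      have sub: "{x. unsat (Z \<omega>) x} \<subseteq> {x. matched_in (Z \<omega>) x y}"
      proof (intro subsetI, rule ccontr)
        fix x assume x: "x \<in> {x. unsat (Z \<omega>) x}" "x \<notin> {x. matched_in (Z \<omega>) x y}"
        then have "emeasure (R \<omega>) {x. matched_in (Z \<omega>) x y} = emeasure (\<eta>B \<omega>) {y}"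
          using unsaturated(1)[of x y] yb(1) by (simp add: unsat_def)
        with yb(2) show False by simp
      qed
      then have "finite {x. unsat (Z \<omega>) x}"
        using finite_subset[OF sub] finite_matched'[of y] by simp
      moreover have "{x. unsat (Z \<omega>) x} \<subseteq> atoms (R \<omega>)" by (auto simp: unsat_def)
      ultimately have "unsat_mass (Z \<omega>) < \<infinity>"
        by (simp add: unsat_mass_def emeasure_r of_nat_less_top)
      then show ?case using elim by simp
    qed
  qed
qed

end

section \<open>Independent marks\<close>

lemma measurable_minorant:
  fixes u :: "'a \<Rightarrow> ennreal"
  shows "\<exists>\<phi>\<in>borel_measurable M. (\<forall>x. \<phi> x \<le> u x) \<and> integral\<^sup>N M \<phi> = integral\<^sup>N M u"
proof -
  \<comment> \<open>The integral of any function is the supremum of the integrals of the simple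
    functions below it. The pointwise supremum of a maximizing sequence is measurable and attains
    this value.\<close>
  let ?S = "integral\<^sup>S M ` {g. simple_function M g \<and> g \<le> u}"
  have "(\<lambda>_. 0) \<in> {g. simple_function M g \<and> g \<le> u}" by (auto simp: le_fun_def)
  then have "?S \<noteq> {}" by blast
  from ennreal_Sup_countable_SUP[OF this]
  obtain c :: "nat \<Rightarrow> ennreal" where c: "range c \<subseteq> ?S" "Sup ?S = (SUP i. c i)" by blast
  have "\<exists>g. simple_function M g \<and> g \<le> u \<and> integral\<^sup>S M g = c i" for i
  proof -
    have "c i \<in> ?S" using c(1) by (rule subsetD) simp
    then show ?thesis by auto
  qed
  then obtain g where g: "\<And>i. simple_function M (g i)" "\<And>i. g i \<le> u" "\<And>i. integral\<^sup>S M (g i) = c i" by metis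
  have "(\<lambda>x. SUP i. g i x) \<in> borel_measurable M"
    using g(1) by (intro borel_measurable_SUP) (auto intro: borel_measurable_simple_function)
  moreover have le: "(SUP i. g i x) \<le> u x" for x using g(2) by (auto intro!: SUP_least simp: le_fun_def)
  moreover have "(\<integral>\<^sup>+x. (SUP i. g i x) \<partial>M) = integral\<^sup>N M u"
  proof (rule antisym)
    show "(\<integral>\<^sup>+x. (SUP i. g i x) \<partial>M) \<le> integral\<^sup>N M u" using le by (intro nn_integral_mono)
    have "c i \<le> (\<integral>\<^sup>+x. (SUP i. g i x) \<partial>M)" for i
      unfolding g(3)[symmetric] nn_integral_eq_simple_integral[OF g(1), symmetric]
      by (intro nn_integral_mono SUP_upper) auto
    then show "integral\<^sup>N M u \<le> (\<integral>\<^sup>+x. (SUP i. g i x) \<partial>M)"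
      unfolding nn_integral_def[of M u] c(2) by (intro SUP_least)
  qed
  ultimately show ?thesis by (intro bexI[of _ "\<lambda>x. SUP i. g i x"] conjI allI)
qed

text \<open>
  The integral of a nonmeasurable function is a lower integral. Since the masses of a set and of its
  complement under the kernel have lower integrals adding up to \<open>1\<close>, the kernel is measurable up to
  null sets, without any further argument.
\<close>

locale disintegration = prob_space P for P :: "'w measure" +
  fixes N :: "'g measure" and M :: "'m measure" and g :: "'w \<Rightarrow> 'g" and \<eta> :: "'w \<Rightarrow> 'm"
    and \<kappa> :: "'w \<Rightarrow> 'm measure"
  assumes g [measurable]: "g \<in> P \<rightarrow>\<^sub>M N" and \<eta> [measurable]: "\<eta> \<in> P \<rightarrow>\<^sub>M M"
    and prob_kernel: "\<omega> \<in> space P \<Longrightarrow> prob_space (\<kappa> \<omega>)"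
    and sets_kernel: "\<omega> \<in> space P \<Longrightarrow> sets (\<kappa> \<omega>) = sets M"
    and kernel: "A \<in> sets N \<Longrightarrow> D \<in> sets M \<Longrightarrow>
      emeasure P {\<omega> \<in> space P. g \<omega> \<in> A \<and> \<eta> \<omega> \<in> D} =
      (\<integral>\<^sup>+\<omega>. emeasure (\<kappa> \<omega>) D * indicator {\<omega> \<in> space P. g \<omega> \<in> A} \<omega> \<partial>P)"
begin

text \<open>The inner integral may fail to be measurable in \<open>\<omega>\<close>. The identity
  therefore carries a measurable version \<open>\<phi>\<close>, for which differences, sums and
  monotone limits may be integrated.\<close>

definition disintegrates :: "('g \<times> 'm \<Rightarrow> ennreal) \<Rightarrow> bool" where
  "disintegrates u \<longleftrightarrow> (\<exists>\<phi>\<in>borel_measurable P. (AE \<omega> in P. \<phi> \<omega> = (\<integral>\<^sup>+h. u (g \<omega>, h) \<partial>\<kappa> \<omega>)) \<and>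
     (\<integral>\<^sup>+\<omega>. u (g \<omega>, \<eta> \<omega>) \<partial>P) = integral\<^sup>N P \<phi>)"

lemma disintegratesI:
  assumes "AE \<omega> in P. \<phi> \<omega> = (\<integral>\<^sup>+h. u (g \<omega>, h) \<partial>\<kappa> \<omega>)" "(\<integral>\<^sup>+\<omega>. u (g \<omega>, \<eta> \<omega>) \<partial>P) = integral\<^sup>N P \<phi>"
    and "\<phi> \<in> borel_measurable P"
  shows "disintegrates u"
  using assms unfolding disintegrates_def by blast

lemma disintegrates_seqE:
  assumes "\<And>i::nat. disintegrates (u i)"
  obtains \<phi> where "\<And>i. \<phi> i \<in> borel_measurable P" "\<And>i. AE \<omega> in P. \<phi> i \<omega> = (\<integral>\<^sup>+h. u i (g \<omega>, h) \<partial>\<kappa> \<omega>)"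
    "\<And>i. (\<integral>\<^sup>+\<omega>. u i (g \<omega>, \<eta> \<omega>) \<partial>P) = integral\<^sup>N P (\<phi> i)"
proof -
  have "\<forall>i. \<exists>f. f \<in> borel_measurable P \<and> (AE \<omega> in P. f \<omega> = (\<integral>\<^sup>+h. u i (g \<omega>, h) \<partial>\<kappa> \<omega>)) \<and>
      (\<integral>\<^sup>+\<omega>. u i (g \<omega>, \<eta> \<omega>) \<partial>P) = integral\<^sup>N P f"
    using assms unfolding disintegrates_def by blast
  from choice[OF this] show ?thesis using that by blast
qed

text \<open>The minorants of the masses of \<open>D\<close> and of its complement have sum at most 1
  and total integral 1. Hence their sum is 1 almost surely, and neither can stay below the mass that
  it minorizes.\<close>

lemma kernel_AE_measurable:
  assumes D [measurable]: "D \<in> sets M"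
  shows "\<exists>\<phi>\<in>borel_measurable P. AE \<omega> in P. \<phi> \<omega> = emeasure (\<kappa> \<omega>) D"
proof -
  let ?D' = "space M - D"
  obtain \<phi> where \<phi> [measurable]: "\<phi> \<in> borel_measurable P" and \<phi>_le: "\<And>\<omega>. \<phi> \<omega> \<le> emeasure (\<kappa> \<omega>) D"
    and \<phi>_int: "integral\<^sup>N P \<phi> = (\<integral>\<^sup>+\<omega>. emeasure (\<kappa> \<omega>) D \<partial>P)"
    using measurable_minorant[of P "\<lambda>\<omega>. emeasure (\<kappa> \<omega>) D"] by blast
  obtain \<psi> where \<psi> [measurable]: "\<psi> \<in> borel_measurable P" and \<psi>_le: "\<And>\<omega>. \<psi> \<omega> \<le> emeasure (\<kappa> \<omega>) ?D'"
    and \<psi>_int: "integral\<^sup>N P \<psi> = (\<integral>\<^sup>+\<omega>. emeasure (\<kappa> \<omega>) ?D' \<partial>P)"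
    using measurable_minorant[of P "\<lambda>\<omega>. emeasure (\<kappa> \<omega>) ?D'"] by blast
  have total: "emeasure P {\<omega> \<in> space P. \<eta> \<omega> \<in> E} = (\<integral>\<^sup>+\<omega>. emeasure (\<kappa> \<omega>) E \<partial>P)" if "E \<in> sets M" for E
  proof -
    have "{\<omega> \<in> space P. g \<omega> \<in> space N \<and> \<eta> \<omega> \<in> E} = {\<omega> \<in> space P. \<eta> \<omega> \<in> E}"
      using measurable_space[OF g] by auto
    moreover have "(\<integral>\<^sup>+\<omega>. emeasure (\<kappa> \<omega>) E * indicator {\<omega> \<in> space P. g \<omega> \<in> space N} \<omega> \<partial>P) =
        (\<integral>\<^sup>+\<omega>. emeasure (\<kappa> \<omega>) E \<partial>P)"
      using measurable_space[OF g] by (intro nn_integral_cong) auto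
    ultimately show ?thesis using kernel[of "space N" E] that by simp
  qed
  have compl: "emeasure (\<kappa> \<omega>) D + emeasure (\<kappa> \<omega>) ?D' = 1" if "\<omega> \<in> space P" for \<omega>
  proof -
    interpret k: prob_space "\<kappa> \<omega>" by (rule prob_kernel[OF that])
    have "emeasure (\<kappa> \<omega>) D + emeasure (\<kappa> \<omega>) ?D' = emeasure (\<kappa> \<omega>) (D \<union> ?D')"
      using D by (intro plus_emeasure) (auto simp: sets_kernel[OF that])
    also have "D \<union> ?D' = space (\<kappa> \<omega>)"
      using sets.sets_into_space[OF D] sets_eq_imp_space_eq[OF sets_kernel[OF that]] by auto
    finally show ?thesis by (simp add: k.emeasure_space_1)
  qed
  have "(\<integral>\<^sup>+\<omega>. \<phi> \<omega> + \<psi> \<omega> \<partial>P) = emeasure P {\<omega> \<in> space P. \<eta> \<omega> \<in> D} + emeasure P {\<omega> \<in> space P. \<eta> \<omega> \<in> ?D'}"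
    unfolding nn_integral_add[OF \<phi> \<psi>] \<phi>_int \<psi>_int total[OF D] total[OF sets.compl_sets[OF D]] ..
  also have "\<dots> = emeasure P ({\<omega> \<in> space P. \<eta> \<omega> \<in> D} \<union> {\<omega> \<in> space P. \<eta> \<omega> \<in> ?D'})"
    by (rule plus_emeasure) auto
  also have "{\<omega> \<in> space P. \<eta> \<omega> \<in> D} \<union> {\<omega> \<in> space P. \<eta> \<omega> \<in> ?D'} = space P"
    using measurable_space[OF \<eta>] by auto
  finally have int1: "(\<integral>\<^sup>+\<omega>. \<phi> \<omega> + \<psi> \<omega> \<partial>P) = 1" by (simp add: emeasure_space_1)
  have le1: "\<phi> \<omega> + \<psi> \<omega> \<le> 1" if "\<omega> \<in> space P" for \<omega>
    using add_mono[OF \<phi>_le \<psi>_le, of \<omega> \<omega>] compl[OF that] by simp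
  have "(\<integral>\<^sup>+\<omega>. 1 - (\<phi> \<omega> + \<psi> \<omega>) \<partial>P) = (\<integral>\<^sup>+\<omega>. 1 \<partial>P) - (\<integral>\<^sup>+\<omega>. \<phi> \<omega> + \<psi> \<omega> \<partial>P)"
    using le1 by (intro nn_integral_diff) (auto simp: int1 intro!: AE_I2)
  also have "\<dots> = 0" by (simp add: int1 emeasure_space_1)
  finally have "AE \<omega> in P. 1 - (\<phi> \<omega> + \<psi> \<omega>) = 0"
    by (subst (asm) nn_integral_0_iff_AE) auto
  then have "AE \<omega> in P. \<phi> \<omega> = emeasure (\<kappa> \<omega>) D"
    using AE_space
  proof eventually_elim
    case (elim \<omega>)
    have "1 \<le> \<phi> \<omega> + \<psi> \<omega>" using elim(1) by (simp only: diff_eq_0_iff_ennreal)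
    with le1[OF elim(2)] have "\<phi> \<omega> + \<psi> \<omega> = emeasure (\<kappa> \<omega>) D + emeasure (\<kappa> \<omega>) ?D'"
      unfolding compl[OF elim(2)] by (rule antisym)
    moreover have "\<psi> \<omega> \<noteq> \<infinity>"
      using le1[OF elim(2)] by (auto simp: top_unique)
    moreover have "\<psi> \<omega> + emeasure (\<kappa> \<omega>) D \<le> emeasure (\<kappa> \<omega>) D + emeasure (\<kappa> \<omega>) ?D'"
      using add_mono[OF \<psi>_le[of \<omega>] order_refl[of "emeasure (\<kappa> \<omega>) D"]] by (simp only: add.commute)
    ultimately have "\<psi> \<omega> + emeasure (\<kappa> \<omega>) D \<le> \<psi> \<omega> + \<phi> \<omega>" by (simp add: add.commute)
    with \<open>\<psi> \<omega> \<noteq> \<infinity>\<close> have "emeasure (\<kappa> \<omega>) D \<le> \<phi> \<omega>"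
      by (auto simp: ennreal_add_left_cancel_le)
    with \<phi>_le[of \<omega>] show ?case by (rule antisym)
  qed
  with \<phi> show ?thesis by blast
qed

text \<open>On a rectangle the version is an indicator of the ground event times a version of the
  mass of \<open>D\<close>. Complements and disjoint unions then follow, each time producing a
  version from the previous ones.\<close>

lemma disintegrates_set:
  assumes W: "W \<in> sets (N \<Otimes>\<^sub>M M)"
  shows "disintegrates (indicator W)"
proof -
  have "Int_stable {a \<times> b | a b. a \<in> sets N \<and> b \<in> sets M}"
    by (rule Int_stable_pair_measure_generator)
  moreover have "{a \<times> b | a b. a \<in> sets N \<and> b \<in> sets M} \<subseteq> Pow (space N \<times> space M)"
    by (rule pair_measure_closed)
  moreover have "W \<in> sigma_sets (space N \<times> space M) {a \<times> b | a b. a \<in> sets N \<and> b \<in> sets M}"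
    using W by (simp add: sets_pair_measure)
  ultimately show ?thesis
  proof (induction rule: sigma_sets_induct_disjoint)
    case (basic V)
    then obtain A D where V: "V = A \<times> D" and A [measurable]: "A \<in> sets N" and D [measurable]: "D \<in> sets M" by blast
    obtain \<phi> where \<phi> [measurable]: "\<phi> \<in> borel_measurable P" "AE \<omega> in P. \<phi> \<omega> = emeasure (\<kappa> \<omega>) D"
      using kernel_AE_measurable[OF D] by blast
    let ?I = "indicator {\<omega> \<in> space P. g \<omega> \<in> A} :: 'w \<Rightarrow> ennreal"
    have "AE \<omega> in P. \<phi> \<omega> * ?I \<omega> = (\<integral>\<^sup>+h. indicator V (g \<omega>, h) \<partial>\<kappa> \<omega>)"
      using \<phi>(2) AE_space
    proof eventually_elim
      case (elim \<omega>)
      have "(\<integral>\<^sup>+h. indicator V (g \<omega>, h) \<partial>\<kappa> \<omega>) = (\<integral>\<^sup>+h. ?I \<omega> * indicator D h \<partial>\<kappa> \<omega>)"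
        using elim by (intro nn_integral_cong) (auto simp: V indicator_def)
      then show ?case
        unfolding elim(1) using elim D
        by (subst (asm) nn_integral_cmult_indicator) (simp_all add: sets_kernel mult.commute)
    qed
    moreover have "(\<integral>\<^sup>+\<omega>. indicator V (g \<omega>, \<eta> \<omega>) \<partial>P) = (\<integral>\<^sup>+\<omega>. \<phi> \<omega> * ?I \<omega> \<partial>P)"
    proof -
      have "(\<integral>\<^sup>+\<omega>. indicator V (g \<omega>, \<eta> \<omega>) \<partial>P) = (\<integral>\<^sup>+\<omega>. indicator {\<omega> \<in> space P. g \<omega> \<in> A \<and> \<eta> \<omega> \<in> D} \<omega> \<partial>P)"
        by (intro nn_integral_cong) (auto simp: V indicator_def)
      also have "\<dots> = emeasure P {\<omega> \<in> space P. g \<omega> \<in> A \<and> \<eta> \<omega> \<in> D}"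
        by (rule nn_integral_indicator) measurable
      also have "\<dots> = (\<integral>\<^sup>+\<omega>. \<phi> \<omega> * ?I \<omega> \<partial>P)"
        unfolding kernel[OF A D] using \<phi>(2) by (intro nn_integral_cong_AE) auto
      finally show ?thesis .
    qed
    moreover have "(\<lambda>\<omega>. \<phi> \<omega> * ?I \<omega>) \<in> borel_measurable P" by measurable
    ultimately show ?case by (intro disintegratesI)
  next
    case empty
    show ?case unfolding disintegrates_def by (intro bexI[of _ "\<lambda>_. 0"]) auto
  next
    case (compl V)
    have V: "V \<in> sets (N \<Otimes>\<^sub>M M)" using compl by (simp add: sets_pair_measure)
    obtain \<phi> where \<phi> [measurable]: "\<phi> \<in> borel_measurable P" and
      AE: "AE \<omega> in P. \<phi> \<omega> = (\<integral>\<^sup>+h. indicator V (g \<omega>, h) \<partial>\<kappa> \<omega>)" and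
      int: "(\<integral>\<^sup>+\<omega>. indicator V (g \<omega>, \<eta> \<omega>) \<partial>P) = integral\<^sup>N P \<phi>"
      using compl(2) unfolding disintegrates_def by blast
    have [measurable]: "V \<in> sets (N \<Otimes>\<^sub>M M)" by (rule V)
    have le1: "(\<integral>\<^sup>+\<omega>. indicator V (g \<omega>, \<eta> \<omega>) \<partial>P) \<le> 1"
      by (rule order_trans[OF nn_integral_mono[of P _ "\<lambda>_. 1"]]) (auto simp: emeasure_space_1 indicator_def)
    have AE1: "AE \<omega> in P. \<phi> \<omega> \<le> 1 \<and> 1 - \<phi> \<omega> = (\<integral>\<^sup>+h. indicator (space N \<times> space M - V) (g \<omega>, h) \<partial>\<kappa> \<omega>)"
      using AE AE_space
    proof eventually_elim
      case (elim \<omega>)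
      interpret k: prob_space "\<kappa> \<omega>" by (rule prob_kernel[OF elim(2)])
      have g\<omega>: "g \<omega> \<in> space N" using measurable_space[OF g elim(2)] .
      note [measurable_cong] = sets_kernel[OF elim(2)]
      have [measurable]: "(\<lambda>h. indicator V (g \<omega>, h) :: ennreal) \<in> borel_measurable (\<kappa> \<omega>)"
        using g\<omega> by measurable
      have b: "\<phi> \<omega> \<le> 1"
        unfolding elim(1)
        by (rule order_trans[OF nn_integral_mono[of "\<kappa> \<omega>" _ "\<lambda>_. 1"]])
           (auto simp: k.emeasure_space_1 indicator_def)
      have "(\<integral>\<^sup>+h. indicator (space N \<times> space M - V) (g \<omega>, h) \<partial>\<kappa> \<omega>) =
          (\<integral>\<^sup>+h. 1 - indicator V (g \<omega>, h) \<partial>\<kappa> \<omega>)"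
        using g\<omega> sets_eq_imp_space_eq[OF sets_kernel[OF elim(2)]]
        by (intro nn_integral_cong) (auto simp: indicator_def)
      also have "\<dots> = 1 - \<phi> \<omega>"
        using b unfolding elim(1)
        by (subst nn_integral_diff) (auto simp: k.emeasure_space_1 top_unique split: split_indicator)
      finally show ?case using b by simp
    qed
    have "(\<integral>\<^sup>+\<omega>. indicator (space N \<times> space M - V) (g \<omega>, \<eta> \<omega>) \<partial>P) =
        (\<integral>\<^sup>+\<omega>. 1 - indicator V (g \<omega>, \<eta> \<omega>) \<partial>P)"
      using measurable_space[OF g] measurable_space[OF \<eta>]
      by (intro nn_integral_cong) (auto simp: indicator_def)
    also have "\<dots> = 1 - (\<integral>\<^sup>+\<omega>. indicator V (g \<omega>, \<eta> \<omega>) \<partial>P)"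
      using le1 by (subst nn_integral_diff) (auto simp: emeasure_space_1 top_unique split: split_indicator)
    also have "\<dots> = (\<integral>\<^sup>+\<omega>. 1 - \<phi> \<omega> \<partial>P)"
      using le1 AE1 unfolding int
      by (subst nn_integral_diff) (auto simp: emeasure_space_1 top_unique)
    finally have "(\<integral>\<^sup>+\<omega>. indicator (space N \<times> space M - V) (g \<omega>, \<eta> \<omega>) \<partial>P) = (\<integral>\<^sup>+\<omega>. 1 - \<phi> \<omega> \<partial>P)" .
    moreover have "(\<lambda>\<omega>. 1 - \<phi> \<omega>) \<in> borel_measurable P" by measurable
    ultimately show ?case
      unfolding disintegrates_def using AE1 by (intro bexI[of _ "\<lambda>\<omega>. 1 - \<phi> \<omega>"]) auto
  next
    case (union V)
    have V: "V i \<in> sets (N \<Otimes>\<^sub>M M)" for i using union by (auto simp: sets_pair_measure)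
    note [measurable] = V
    have ind: "indicator (\<Union>i. V i) p = (\<Sum>i. indicator (V i) p :: ennreal)" for p
      using suminf_indicator[OF union(1)] by metis
    obtain \<phi> where \<phi> [measurable]: "\<And>i. \<phi> i \<in> borel_measurable P" and
      AE: "\<And>i. AE \<omega> in P. \<phi> i \<omega> = (\<integral>\<^sup>+h. indicator (V i) (g \<omega>, h) \<partial>\<kappa> \<omega>)" and
      int: "\<And>i. (\<integral>\<^sup>+\<omega>. indicator (V i) (g \<omega>, \<eta> \<omega>) \<partial>P) = integral\<^sup>N P (\<phi> i)"
      by (rule disintegrates_seqE[where u="\<lambda>i. indicator (V i)", OF union(3)]) (rule that)
    have "AE \<omega> in P. \<forall>i. \<phi> i \<omega> = (\<integral>\<^sup>+h. indicator (V i) (g \<omega>, h) \<partial>\<kappa> \<omega>)"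
      using AE by (simp add: AE_all_countable)
    then have "AE \<omega> in P. (\<Sum>i. \<phi> i \<omega>) = (\<integral>\<^sup>+h. indicator (\<Union>i. V i) (g \<omega>, h) \<partial>\<kappa> \<omega>)"
      using AE_space
    proof eventually_elim
      case (elim \<omega>)
      have g\<omega>: "g \<omega> \<in> space N" using measurable_space[OF g elim(2)] .
      note [measurable_cong] = sets_kernel[OF elim(2)]
      have "(\<lambda>h. indicator (V i) (g \<omega>, h) :: ennreal) \<in> borel_measurable (\<kappa> \<omega>)" for i
        using g\<omega> by measurable
      then show ?case unfolding ind using elim(1) by (simp add: nn_integral_suminf)
    qed
    moreover have "(\<integral>\<^sup>+\<omega>. indicator (\<Union>i. V i) (g \<omega>, \<eta> \<omega>) \<partial>P) = (\<integral>\<^sup>+\<omega>. (\<Sum>i. \<phi> i \<omega>) \<partial>P)"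
      unfolding ind by (simp add: nn_integral_suminf int)
    moreover have "(\<lambda>\<omega>. \<Sum>i. \<phi> i \<omega>) \<in> borel_measurable P" by measurable
    ultimately show ?case
      unfolding disintegrates_def by (intro bexI[of _ "\<lambda>\<omega>. \<Sum>i. \<phi> i \<omega>"]) auto
  qed
qed

lemma disintegrates_measurable:
  assumes "u \<in> borel_measurable (N \<Otimes>\<^sub>M M)"
  shows "disintegrates u"
  using assms
proof induction
  have sec: "(\<lambda>h. v (g \<omega>, h)) \<in> borel_measurable (\<kappa> \<omega>)"
    if v [measurable]: "v \<in> borel_measurable (N \<Otimes>\<^sub>M M)" and \<omega>: "\<omega> \<in> space P" for v :: "_ \<Rightarrow> ennreal" and \<omega>
  proof -
    note [measurable_cong] = sets_kernel[OF \<omega>]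
    show ?thesis using measurable_space[OF g \<omega>] by measurable
  qed
  {
    case (cong u v)
    have "(\<integral>\<^sup>+h. u (g \<omega>, h) \<partial>\<kappa> \<omega>) = (\<integral>\<^sup>+h. v (g \<omega>, h) \<partial>\<kappa> \<omega>)" if "\<omega> \<in> space P" for \<omega>
      using cong(3) measurable_space[OF g that] sets_eq_imp_space_eq[OF sets_kernel[OF that]]
      by (intro nn_integral_cong) (auto simp: space_pair_measure)
    moreover have "(\<integral>\<^sup>+\<omega>. u (g \<omega>, \<eta> \<omega>) \<partial>P) = (\<integral>\<^sup>+\<omega>. v (g \<omega>, \<eta> \<omega>) \<partial>P)"
      using cong(3) measurable_space[OF g] measurable_space[OF \<eta>]
      by (intro nn_integral_cong) (auto simp: space_pair_measure)
    ultimately show ?case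
      using cong(4) unfolding disintegrates_def by (auto elim!: bexI[rotated] simp: eventually_mono[OF AE_conjI[OF AE_space]])
  next
    case (set A)
    then show ?case by (rule disintegrates_set)
  next
    case (mult u c)
    then obtain \<phi> where \<phi> [measurable]: "\<phi> \<in> borel_measurable P" and
      AE: "AE \<omega> in P. \<phi> \<omega> = (\<integral>\<^sup>+h. u (g \<omega>, h) \<partial>\<kappa> \<omega>)" and
      int: "(\<integral>\<^sup>+\<omega>. u (g \<omega>, \<eta> \<omega>) \<partial>P) = integral\<^sup>N P \<phi>"
      unfolding disintegrates_def by blast
    note [measurable] = mult(2)
    have "AE \<omega> in P. c * \<phi> \<omega> = (\<integral>\<^sup>+h. c * u (g \<omega>, h) \<partial>\<kappa> \<omega>)"
      using AE AE_space by eventually_elim (simp add: nn_integral_cmult sec mult(2))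
    moreover have "(\<integral>\<^sup>+\<omega>. c * u (g \<omega>, \<eta> \<omega>) \<partial>P) = (\<integral>\<^sup>+\<omega>. c * \<phi> \<omega> \<partial>P)"
      by (simp add: nn_integral_cmult int)
    moreover have "(\<lambda>\<omega>. c * \<phi> \<omega>) \<in> borel_measurable P" by measurable
    ultimately show ?case by (intro disintegratesI)
  next
    case (add u v)
    then obtain \<phi> \<psi> where \<phi> [measurable]: "\<phi> \<in> borel_measurable P" "\<psi> \<in> borel_measurable P" and
      AE: "AE \<omega> in P. \<phi> \<omega> = (\<integral>\<^sup>+h. u (g \<omega>, h) \<partial>\<kappa> \<omega>)" "AE \<omega> in P. \<psi> \<omega> = (\<integral>\<^sup>+h. v (g \<omega>, h) \<partial>\<kappa> \<omega>)" and
      int: "(\<integral>\<^sup>+\<omega>. u (g \<omega>, \<eta> \<omega>) \<partial>P) = integral\<^sup>N P \<phi>" "(\<integral>\<^sup>+\<omega>. v (g \<omega>, \<eta> \<omega>) \<partial>P) = integral\<^sup>N P \<psi>"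
      unfolding disintegrates_def by blast
    note [measurable] = add(1,3)
    have "AE \<omega> in P. \<psi> \<omega> + \<phi> \<omega> = (\<integral>\<^sup>+h. v (g \<omega>, h) + u (g \<omega>, h) \<partial>\<kappa> \<omega>)"
      using AE AE_space
    proof eventually_elim
      case (elim \<omega>)
      show ?case
        unfolding elim(1,2) by (rule nn_integral_add[symmetric]) (use sec add elim(3) in auto)
    qed
    moreover have "(\<integral>\<^sup>+\<omega>. v (g \<omega>, \<eta> \<omega>) + u (g \<omega>, \<eta> \<omega>) \<partial>P) = (\<integral>\<^sup>+\<omega>. \<psi> \<omega> + \<phi> \<omega> \<partial>P)"
      by (simp add: nn_integral_add int)
    moreover have "(\<lambda>\<omega>. \<psi> \<omega> + \<phi> \<omega>) \<in> borel_measurable P" by measurable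
    ultimately show ?case by (intro disintegratesI)
  next
    case (seq U)
    obtain \<phi> where \<phi> [measurable]: "\<And>i. \<phi> i \<in> borel_measurable P" and
      AE: "\<And>i. AE \<omega> in P. \<phi> i \<omega> = (\<integral>\<^sup>+h. U i (g \<omega>, h) \<partial>\<kappa> \<omega>)" and
      int: "\<And>i. (\<integral>\<^sup>+\<omega>. U i (g \<omega>, \<eta> \<omega>) \<partial>P) = integral\<^sup>N P (\<phi> i)"
      by (rule disintegrates_seqE[where u=U, OF seq.IH]) (rule that)
    note [measurable] = seq(1)
    have AEall: "AE \<omega> in P. \<forall>i. \<phi> i \<omega> = (\<integral>\<^sup>+h. U i (g \<omega>, h) \<partial>\<kappa> \<omega>)"
      using AE by (simp add: AE_all_countable)
    have "AE \<omega> in P. (SUP i. \<phi> i \<omega>) = (\<integral>\<^sup>+h. (SUP i. U i) (g \<omega>, h) \<partial>\<kappa> \<omega>)"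
      using AEall AE_space
    proof eventually_elim
      case (elim \<omega>)
      have "(\<integral>\<^sup>+h. (SUP i. U i) (g \<omega>, h) \<partial>\<kappa> \<omega>) = (SUP i. \<integral>\<^sup>+h. U i (g \<omega>, h) \<partial>\<kappa> \<omega>)"
        unfolding SUP_apply using seq(3) sec[OF seq(1) elim(2)]
        by (intro nn_integral_monotone_convergence_SUP) (auto simp: incseq_def le_fun_def)
      then show ?case using elim(1) by simp
    qed
    moreover have "(\<integral>\<^sup>+\<omega>. (SUP i. U i) (g \<omega>, \<eta> \<omega>) \<partial>P) = (\<integral>\<^sup>+\<omega>. (SUP i. \<phi> i \<omega>) \<partial>P)"
    proof -
      have "(\<integral>\<^sup>+\<omega>. (SUP i. U i) (g \<omega>, \<eta> \<omega>) \<partial>P) = (SUP i. \<integral>\<^sup>+\<omega>. U i (g \<omega>, \<eta> \<omega>) \<partial>P)"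
        unfolding SUP_apply using seq(3)
        by (intro nn_integral_monotone_convergence_SUP) (auto simp: incseq_def le_fun_def)
      also have "\<dots> = (SUP i. integral\<^sup>N P (\<phi> i))" by (simp add: int)
      \<comment> \<open>The versions were chosen separately for each \<open>i\<close>, so they
        increase only almost surely; monotone convergence is used in its almost sure form.\<close>
      also have "\<dots> = (\<integral>\<^sup>+\<omega>. (SUP i. \<phi> i \<omega>) \<partial>P)"
      proof (rule nn_integral_monotone_convergence_SUP_AE[symmetric])
        fix i
        show "AE \<omega> in P. \<phi> i \<omega> \<le> \<phi> (Suc i) \<omega>"
          using AEall by eventually_elim (use seq(3) in \<open>auto simp: incseq_def le_fun_def intro!: nn_integral_mono\<close>)
      qed measurable
      finally show ?thesis .
    qed
    moreover have "(\<lambda>\<omega>. SUP i. \<phi> i \<omega>) \<in> borel_measurable P" by measurable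
    ultimately show ?case by (intro disintegratesI)
  }
qed

lemma nn_integral_disintegration:
  assumes "u \<in> borel_measurable (N \<Otimes>\<^sub>M M)"
  shows "(\<integral>\<^sup>+\<omega>. u (g \<omega>, \<eta> \<omega>) \<partial>P) = (\<integral>\<^sup>+\<omega>. (\<integral>\<^sup>+h. u (g \<omega>, h) \<partial>\<kappa> \<omega>) \<partial>P)"
  using disintegrates_measurable[OF assms] unfolding disintegrates_def
  by (metis nn_integral_cong_AE)

end

subsection \<open>The law of the marks of one color\<close>

lemma emeasure_attach_marks:
  fixes \<mu> :: "('a::euclidean_space) measure"
  assumes "A \<in> sets borel"
  shows "emeasure (attach_marks \<mu> f) A = (\<integral>\<^sup>+x. indicator A x * of_nat (f x) \<partial>count_space (atoms \<mu>))"
proof -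
  have "emeasure (attach_marks \<mu> f) A =
      emeasure (density (count_space (atoms \<mu>)) (\<lambda>x. of_nat (f x))) (A \<inter> atoms \<mu>)"
    unfolding attach_marks_def using assms by (subst emeasure_distr) auto
  also have "\<dots> = (\<integral>\<^sup>+x. of_nat (f x) * indicator (A \<inter> atoms \<mu>) x \<partial>count_space (atoms \<mu>))"
    by (intro emeasure_density) auto
  also have "\<dots> = (\<integral>\<^sup>+x. indicator A x * of_nat (f x) \<partial>count_space (atoms \<mu>))"
    by (intro nn_integral_cong) (auto simp: indicator_def)
  finally show ?thesis .
qed

lemma attach_marks_singleton:
  fixes \<mu> :: "('a::euclidean_space) measure"
  assumes "x \<in> atoms \<mu>"
  shows "emeasure (attach_marks \<mu> f) {x} = of_nat (f x)"
proof -
  have "emeasure (attach_marks \<mu> f) {x} = (\<integral>\<^sup>+y. of_nat (f x) * indicator {x} y \<partial>count_space (atoms \<mu>))"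
    by (subst emeasure_attach_marks) (auto intro!: nn_integral_cong simp: indicator_def)
  then show ?thesis using assms by (simp add: nn_integral_cmult_indicator)
qed

lemma attach_marks_configs:
  fixes \<mu> :: "('a::euclidean_space) measure"
  assumes \<mu>: "\<mu> \<in> point_measures borel bounded"
  shows "attach_marks \<mu> f \<in> point_measures borel bounded"
proof -
  have "\<exists>n::nat. emeasure (attach_marks \<mu> f) A = of_nat n" if A: "A \<in> sets borel" "bounded A" for A
  proof -
    have "emeasure (attach_marks \<mu> f) A = (\<Sum>x\<in>atoms \<mu> \<inter> A. indicator A x * of_nat (f x))"
      unfolding emeasure_attach_marks[OF A(1)]
      using finite_atoms_bounded[OF \<mu> A(2)] by (intro nn_integral_count_space') auto
    also have "\<dots> = of_nat (\<Sum>x\<in>atoms \<mu> \<inter> A. f x)" by simp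
    finally show ?thesis by blast
  qed
  then show ?thesis by (simp add: point_measures_def attach_marks_def)
qed

lemma point_measures_sets: "point_measures S bdd \<in> sets (point_measure_space S bdd)"
  using sets.top[of "point_measure_space S bdd"] by simp

text \<open>One marginal of \<open>mark_law\<close>: the conditional law, given the ground points,
  of the marks of a single color.\<close>

definition color_mark_law :: "nat pmf \<Rightarrow> ('a::euclidean_space) measure \<Rightarrow> 'a measure measure" where
  "color_mark_law q \<mu> = distr (\<Pi>\<^sub>M x\<in>atoms \<mu>. measure_pmf q) configs (attach_marks \<mu>)"

context
  fixes \<mu> :: "('a::euclidean_space) measure" and q :: "nat pmf"
  assumes \<mu>: "\<mu> \<in> point_measures borel bounded"
begin

text \<open>There are countably many atoms, so the mass of a set is a countable sum of functions of
  single coordinates.\<close>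

lemma measurable_attach_marks: "attach_marks \<mu> \<in> (\<Pi>\<^sub>M x\<in>atoms \<mu>. measure_pmf q) \<rightarrow>\<^sub>M configs"
proof (rule measurable_point_measure_spaceI)
  fix A :: "'a set" assume A: "A \<in> sets borel"
  interpret sigma_finite_measure "count_space (atoms \<mu>)"
    by (rule sigma_finite_measure_count_space_countable[OF countable_atoms[OF \<mu>]])
  have "(\<lambda>(x, f). indicator A x * of_nat (f x)) \<in>
      borel_measurable (count_space (atoms \<mu>) \<Otimes>\<^sub>M (\<Pi>\<^sub>M x\<in>atoms \<mu>. measure_pmf q))"
  proof (rule measurable_pair_measure_countable1[OF countable_atoms[OF \<mu>]])
    fix x assume x: "x \<in> atoms \<mu>"
    have "(\<lambda>f. f x) \<in> (\<Pi>\<^sub>M x\<in>atoms \<mu>. measure_pmf q) \<rightarrow>\<^sub>M measure_pmf q"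
      using x by (rule measurable_component_singleton)
    from measurable_compose[OF this, of "\<lambda>k. indicator A x * of_nat k" borel]
    show "(\<lambda>f. case (x, f) of (x, f) \<Rightarrow> indicator A x * of_nat (f x)) \<in>
        borel_measurable (\<Pi>\<^sub>M x\<in>atoms \<mu>. measure_pmf q)" by simp
  qed
  then have "(\<lambda>(f, x). indicator A x * of_nat (f x)) \<in>
      borel_measurable ((\<Pi>\<^sub>M x\<in>atoms \<mu>. measure_pmf q) \<Otimes>\<^sub>M count_space (atoms \<mu>))"
    by (subst measurable_pair_swap_iff) (simp add: case_prod_beta')
  from borel_measurable_nn_integral[OF this]
  show "(\<lambda>f. emeasure (attach_marks \<mu> f) A) \<in> borel_measurable (\<Pi>\<^sub>M x\<in>atoms \<mu>. measure_pmf q)"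
    by (simp add: emeasure_attach_marks[OF A])
qed (simp add: attach_marks_configs[OF \<mu>])

lemma prob_space_color_mark_law: "prob_space (color_mark_law q \<mu>)"
  unfolding color_mark_law_def
  by (intro prob_space.prob_space_distr prob_space_PiM measurable_attach_marks) (rule measure_pmf.prob_space_axioms)

text \<open>Campbell's formula for independent marks: every coordinate of the product has law
  \<open>q\<close>, and expectation commutes with the countable sum over the atoms.\<close>

lemma mean_color_mark_law:
  assumes simple: "simple_measure \<mu>" and A: "A \<in> sets borel"
  shows "(\<integral>\<^sup>+h. emeasure h A \<partial>color_mark_law q \<mu>) = (\<integral>\<^sup>+k. of_nat k \<partial>measure_pmf q) * emeasure \<mu> A"
proof -
  let ?M = "\<Pi>\<^sub>M x\<in>atoms \<mu>. measure_pmf q"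
  have c: "countable (atoms \<mu>)" by (rule countable_atoms[OF \<mu>])
  have comp: "(\<lambda>f. of_nat (f x) :: ennreal) \<in> borel_measurable ?M" if x: "x \<in> atoms \<mu>" for x
    by (rule measurable_compose[OF measurable_component_singleton[OF x]]) simp
  have mean: "(\<integral>\<^sup>+f. of_nat (f x) \<partial>?M) = (\<integral>\<^sup>+k. of_nat k \<partial>measure_pmf q)" if x: "x \<in> atoms \<mu>" for x
  proof -
    have "(\<integral>\<^sup>+k. of_nat k \<partial>distr ?M (measure_pmf q) (\<lambda>f. f x)) = (\<integral>\<^sup>+f. of_nat (f x) \<partial>?M)"
      by (rule nn_integral_distr[OF measurable_component_singleton[OF x]]) simp
    moreover have "distr ?M (measure_pmf q) (\<lambda>f. f x) = measure_pmf q"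
      using x by (intro distr_PiM_component[of _ "\<lambda>_. measure_pmf q"]) (auto intro: measure_pmf.prob_space_axioms)
    ultimately show ?thesis by simp
  qed
  have "(\<integral>\<^sup>+h. emeasure h A \<partial>color_mark_law q \<mu>) = (\<integral>\<^sup>+f. emeasure (attach_marks \<mu> f) A \<partial>?M)"
    unfolding color_mark_law_def
    by (rule nn_integral_distr[OF measurable_attach_marks]) (simp add: measurable_emeasure_point_measure_space[OF A])
  also have "\<dots> = (\<integral>\<^sup>+f. (\<integral>\<^sup>+x. indicator A x * of_nat (f x) \<partial>count_space (atoms \<mu>)) \<partial>?M)"
    by (simp add: emeasure_attach_marks[OF A])
  also have "\<dots> = (\<integral>\<^sup>+x. (\<integral>\<^sup>+f. indicator A x * of_nat (f x) \<partial>?M) \<partial>count_space (atoms \<mu>))"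
    using comp by (intro nn_integral_count_space_nn_integral c borel_measurable_times_ennreal) auto
  also have "\<dots> = (\<integral>\<^sup>+x. (\<integral>\<^sup>+k. of_nat k \<partial>measure_pmf q) * (indicator A x * emeasure \<mu> {x}) \<partial>count_space (atoms \<mu>))"
    by (intro nn_integral_cong)
       (simp add: nn_integral_cmult comp mean emeasure_simple_measure[OF \<mu> simple] mult.commute)
  also have "\<dots> = (\<integral>\<^sup>+k. of_nat k \<partial>measure_pmf q) * (\<integral>\<^sup>+x. indicator A x * emeasure \<mu> {x} \<partial>count_space (atoms \<mu>))"
    by (intro nn_integral_cmult) simp
  also have "(\<integral>\<^sup>+x. indicator A x * emeasure \<mu> {x} \<partial>count_space (atoms \<mu>)) = emeasure \<mu> A"
    using A by (subst nn_integral_point_measure[OF \<mu>, symmetric]) (auto simp: sets_configs[OF \<mu>])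
  finally show ?thesis .
qed

end

text \<open>The marks of the other color fill a factor of probability 1 of the product measure and
  disappear.\<close>

lemma emeasure_mark_law:
  fixes r b :: "('a::euclidean_space) measure"
  assumes r: "r \<in> point_measures borel bounded" and b: "b \<in> point_measures borel bounded"
    and D: "D \<in> sets configs"
  shows "emeasure (mark_law p q r b) (space configs \<times> D) = emeasure (color_mark_law q b) D"
    and "emeasure (mark_law p q r b) (D \<times> space configs) = emeasure (color_mark_law p r) D"
proof -
  let ?R = "\<Pi>\<^sub>M x\<in>atoms r. measure_pmf p" and ?B = "\<Pi>\<^sub>M y\<in>atoms b. measure_pmf q"
  interpret R: prob_space ?R by (rule prob_space_PiM) (rule measure_pmf.prob_space_axioms)
  interpret B: prob_space ?B by (rule prob_space_PiM) (rule measure_pmf.prob_space_axioms)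
  note [measurable] = measurable_attach_marks[OF r, of p] measurable_attach_marks[OF b, of q] D
  have m: "(\<lambda>(f, g). (attach_marks r f, attach_marks b g)) \<in> ?R \<Otimes>\<^sub>M ?B \<rightarrow>\<^sub>M configs \<Otimes>\<^sub>M configs"
    by measurable
  have DB: "space configs \<times> D \<in> sets (configs \<Otimes>\<^sub>M configs)" and DR: "D \<times> space configs \<in> sets (configs \<Otimes>\<^sub>M configs)"
    using D by (intro pair_measureI sets.top, simp)+
  have "emeasure (mark_law p q r b) (space configs \<times> D) = emeasure (?R \<Otimes>\<^sub>M ?B)
      (space ?R \<times> (attach_marks b -` D \<inter> space ?B))"
    unfolding mark_law_def
    using measurable_space[OF measurable_attach_marks[OF r, of p]]
    by (subst emeasure_distr[OF m DB]) (auto intro!: arg_cong2[where f=emeasure] simp: space_pair_measure)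
  also have "\<dots> = emeasure ?B (attach_marks b -` D \<inter> space ?B)"
    using B.emeasure_pair_measure_Times[of "space ?R" ?R "attach_marks b -` D \<inter> space ?B"]
    by (simp add: R.emeasure_space_1)
  finally show "emeasure (mark_law p q r b) (space configs \<times> D) = emeasure (color_mark_law q b) D"
    unfolding color_mark_law_def by (subst emeasure_distr) auto
  have "emeasure (mark_law p q r b) (D \<times> space configs) = emeasure (?R \<Otimes>\<^sub>M ?B)
      ((attach_marks r -` D \<inter> space ?R) \<times> space ?B)"
    unfolding mark_law_def
    using measurable_space[OF measurable_attach_marks[OF b, of q]]
    by (subst emeasure_distr[OF m DR]) (auto intro!: arg_cong2[where f=emeasure] simp: space_pair_measure)
  also have "\<dots> = emeasure ?R (attach_marks r -` D \<inter> space ?R)"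
    using B.emeasure_pair_measure_Times[of "attach_marks r -` D \<inter> space ?R" ?R "space ?B"]
    by (simp add: B.emeasure_space_1)
  finally show "emeasure (mark_law p q r b) (D \<times> space configs) = emeasure (color_mark_law p r) D"
    unfolding color_mark_law_def by (subst emeasure_distr) auto
qed

text \<open>The marks \<open>\<eta>\<close> belong to \<open>B\<close> alone, but the conditioning
  is on both ground processes: the thresholds with which these marks are compared later are numbers
  of points of \<open>R\<close>.\<close>

locale color_marks = prob_space P for P :: "'w measure" +
  fixes q :: "nat pmf" and R B \<eta> :: "'w \<Rightarrow> ('a::euclidean_space) measure"
  assumes measurable_R [measurable]: "R \<in> P \<rightarrow>\<^sub>M configs" and measurable_B [measurable]: "B \<in> P \<rightarrow>\<^sub>M configs"
    and measurable_\<eta> [measurable]: "\<eta> \<in> P \<rightarrow>\<^sub>M configs"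
    and law: "A \<in> sets (configs \<Otimes>\<^sub>M configs) \<Longrightarrow> D \<in> sets configs \<Longrightarrow>
      emeasure P {\<omega> \<in> space P. (R \<omega>, B \<omega>) \<in> A \<and> \<eta> \<omega> \<in> D} =
      (\<integral>\<^sup>+\<omega>. emeasure (color_mark_law q (B \<omega>)) D * indicator {\<omega> \<in> space P. (R \<omega>, B \<omega>) \<in> A} \<omega> \<partial>P)"
begin

sublocale disintegration P "configs \<Otimes>\<^sub>M configs" configs "\<lambda>\<omega>. (R \<omega>, B \<omega>)" \<eta> "\<lambda>\<omega>. color_mark_law q (B \<omega>)"
proof (intro disintegration.intro disintegration_axioms.intro prob_space_axioms)
  fix \<omega> assume "\<omega> \<in> space P"
  then have "B \<omega> \<in> point_measures borel bounded" using measurable_space[OF measurable_B] by auto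
  then show "prob_space (color_mark_law q (B \<omega>))" by (rule prob_space_color_mark_law)
  show "sets (color_mark_law q (B \<omega>)) = sets configs" by (simp add: color_mark_law_def)
qed (measurable, rule law)

text \<open>This identifies one side of the criterion, intensity times mean mark, with the intensity
  of a mark measure.\<close>

lemma intensity_marks_mean:
  assumes simple: "AE \<omega> in P. simple_measure (B \<omega>)"
  shows "intensity P \<eta> = (\<integral>\<^sup>+k. of_nat k \<partial>measure_pmf q) * intensity P B"
proof -
  have m [measurable]: "(\<lambda>h. emeasure h (cbox 0 One)) \<in> borel_measurable (configs :: 'a measure measure)"
    by (rule measurable_emeasure_point_measure_space) simp
  have "(\<lambda>p. emeasure (snd p) (cbox 0 One)) \<in> borel_measurable ((configs \<Otimes>\<^sub>M configs) \<Otimes>\<^sub>M (configs :: 'a measure measure))"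
    by measurable
  from nn_integral_disintegration[OF this]
  have "intensity P \<eta> = (\<integral>\<^sup>+\<omega>. (\<integral>\<^sup>+h. emeasure h (cbox 0 One) \<partial>color_mark_law q (B \<omega>)) \<partial>P)"
    by (simp add: intensity_def)
  also have "\<dots> = (\<integral>\<^sup>+\<omega>. (\<integral>\<^sup>+k. of_nat k \<partial>measure_pmf q) * emeasure (B \<omega>) (cbox 0 One) \<partial>P)"
  proof (rule nn_integral_cong_AE)
    show "AE \<omega> in P. (\<integral>\<^sup>+h. emeasure h (cbox 0 One) \<partial>color_mark_law q (B \<omega>)) =
        (\<integral>\<^sup>+k. of_nat k \<partial>measure_pmf q) * emeasure (B \<omega>) (cbox 0 One)"
      using simple AE_space
    proof eventually_elim
      case (elim \<omega>)
      have "B \<omega> \<in> point_measures borel bounded" using measurable_space[OF measurable_B elim(2)] by simp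
      from mean_color_mark_law[OF this elim(1)] show ?case by simp
    qed
  qed
  also have "\<dots> = (\<integral>\<^sup>+k. of_nat k \<partial>measure_pmf q) * intensity P B"
    unfolding intensity_def using measurable_compose[OF measurable_B m] by (intro nn_integral_cmult)
  finally show ?thesis .
qed

end

lemma color_marks_of_iid_marks:
  fixes R \<eta>R B \<eta>B :: "'w \<Rightarrow> ('a::euclidean_space) measure"
  assumes P: "prob_space P"
    and meas: "R \<in> P \<rightarrow>\<^sub>M configs" "\<eta>R \<in> P \<rightarrow>\<^sub>M configs" "B \<in> P \<rightarrow>\<^sub>M configs" "\<eta>B \<in> P \<rightarrow>\<^sub>M configs"
    and iid: "iid_marks P p q R \<eta>R B \<eta>B"
  shows "color_marks P q R B \<eta>B" and "color_marks P p B R \<eta>R"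
proof -
  interpret prob_space P by (rule P)
  have c: "R \<omega> \<in> point_measures borel bounded" "B \<omega> \<in> point_measures borel bounded"
      "\<eta>R \<omega> \<in> point_measures borel bounded" "\<eta>B \<omega> \<in> point_measures borel bounded" if "\<omega> \<in> space P" for \<omega>
    using meas[THEN measurable_space, OF that] by auto
  have law: "emeasure P {\<omega> \<in> space P. (R \<omega>, B \<omega>) \<in> A \<and> (\<eta>R \<omega>, \<eta>B \<omega>) \<in> D} =
      (\<integral>\<^sup>+\<omega>. emeasure (mark_law p q (R \<omega>) (B \<omega>)) D * indicator {\<omega> \<in> space P. (R \<omega>, B \<omega>) \<in> A} \<omega> \<partial>P)"
    if "A \<in> sets (configs \<Otimes>\<^sub>M configs)" "D \<in> sets (configs \<Otimes>\<^sub>M configs)" for A D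
    using iid that unfolding iid_marks_def by blast
  show "color_marks P q R B \<eta>B"
  proof (intro color_marks.intro P color_marks_axioms.intro meas)
    fix A :: "('a measure \<times> 'a measure) set" and D :: "'a measure set"
    assume A: "A \<in> sets (configs \<Otimes>\<^sub>M configs)" and D: "D \<in> sets configs"
    have "emeasure P {\<omega> \<in> space P. (R \<omega>, B \<omega>) \<in> A \<and> \<eta>B \<omega> \<in> D} =
        emeasure P {\<omega> \<in> space P. (R \<omega>, B \<omega>) \<in> A \<and> (\<eta>R \<omega>, \<eta>B \<omega>) \<in> space configs \<times> D}"
      using c by (auto intro!: arg_cong2[where f=emeasure])
    also have "\<dots> = (\<integral>\<^sup>+\<omega>. emeasure (mark_law p q (R \<omega>) (B \<omega>)) (space configs \<times> D) *
        indicator {\<omega> \<in> space P. (R \<omega>, B \<omega>) \<in> A} \<omega> \<partial>P)"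
      using A D by (intro law) (auto simp: point_measures_sets)
    also have "\<dots> = (\<integral>\<^sup>+\<omega>. emeasure (color_mark_law q (B \<omega>)) D * indicator {\<omega> \<in> space P. (R \<omega>, B \<omega>) \<in> A} \<omega> \<partial>P)"
      by (intro nn_integral_cong) (simp only: emeasure_mark_law(1)[OF c(1,2) D])
    finally show "emeasure P {\<omega> \<in> space P. (R \<omega>, B \<omega>) \<in> A \<and> \<eta>B \<omega> \<in> D} =
        (\<integral>\<^sup>+\<omega>. emeasure (color_mark_law q (B \<omega>)) D * indicator {\<omega> \<in> space P. (R \<omega>, B \<omega>) \<in> A} \<omega> \<partial>P)" .
  qed
  show "color_marks P p B R \<eta>R"
  proof (intro color_marks.intro P color_marks_axioms.intro meas)
    fix A :: "('a measure \<times> 'a measure) set" and D :: "'a measure set"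
    assume A: "A \<in> sets (configs \<Otimes>\<^sub>M configs)" and D: "D \<in> sets configs"
    \<comment> \<open>\<open>iid_marks\<close> lists red before blue, whereas
      \<open>color_marks\<close> is now used with the ground processes in the other order.\<close>
    let ?A = "(\<lambda>(x, y). (y, x)) -` A \<inter> space (configs \<Otimes>\<^sub>M configs)"
    have A': "?A \<in> sets (configs \<Otimes>\<^sub>M configs)" by (rule measurable_sets[OF measurable_pair_swap' A])
    have iA: "(R \<omega>, B \<omega>) \<in> ?A \<longleftrightarrow> (B \<omega>, R \<omega>) \<in> A" if "\<omega> \<in> space P" for \<omega>
      using c[OF that] by (auto simp: space_pair_measure)
    have "emeasure P {\<omega> \<in> space P. (B \<omega>, R \<omega>) \<in> A \<and> \<eta>R \<omega> \<in> D} =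
        emeasure P {\<omega> \<in> space P. (R \<omega>, B \<omega>) \<in> ?A \<and> (\<eta>R \<omega>, \<eta>B \<omega>) \<in> D \<times> space configs}"
      using c by (intro arg_cong2[where f=emeasure] refl) (auto simp: space_pair_measure)
    also have "\<dots> = (\<integral>\<^sup>+\<omega>. emeasure (mark_law p q (R \<omega>) (B \<omega>)) (D \<times> space configs) *
        indicator {\<omega> \<in> space P. (R \<omega>, B \<omega>) \<in> ?A} \<omega> \<partial>P)"
      using A' D by (intro law) (auto simp: point_measures_sets)
    also have "\<dots> = (\<integral>\<^sup>+\<omega>. emeasure (color_mark_law p (R \<omega>)) D * indicator {\<omega> \<in> space P. (B \<omega>, R \<omega>) \<in> A} \<omega> \<partial>P)"
    proof (intro nn_integral_cong)
      fix \<omega> assume \<omega>: "\<omega> \<in> space P"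
      have "indicator {\<omega> \<in> space P. (R \<omega>, B \<omega>) \<in> ?A} \<omega> = (indicator {\<omega> \<in> space P. (B \<omega>, R \<omega>) \<in> A} \<omega> :: ennreal)"
        using iA[OF \<omega>] by (simp add: indicator_def)
      then show "emeasure (mark_law p q (R \<omega>) (B \<omega>)) (D \<times> space configs) *
          indicator {\<omega> \<in> space P. (R \<omega>, B \<omega>) \<in> ?A} \<omega> =
          emeasure (color_mark_law p (R \<omega>)) D * indicator {\<omega> \<in> space P. (B \<omega>, R \<omega>) \<in> A} \<omega>"
        by (simp only: emeasure_mark_law(2)[OF c(1,2)[OF \<omega>] D])
    qed
    finally show "emeasure P {\<omega> \<in> space P. (B \<omega>, R \<omega>) \<in> A \<and> \<eta>R \<omega> \<in> D} =
        (\<integral>\<^sup>+\<omega>. emeasure (color_mark_law p (R \<omega>)) D * indicator {\<omega> \<in> space P. (B \<omega>, R \<omega>) \<in> A} \<omega> \<partial>P)" .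
  qed
qed

section \<open>Saturation when the mean number of stubs is infinite\<close>

definition tail :: "nat pmf \<Rightarrow> ennreal \<Rightarrow> ennreal" where
  "tail q c = emeasure (measure_pmf q) {k. c < of_nat k}"

lemma tail_le_1: "tail q c \<le> 1"
  unfolding tail_def by (rule measure_pmf.emeasure_le_1)

lemma tail_antimono: "c \<le> c' \<Longrightarrow> tail q c' \<le> tail q c"
  unfolding tail_def by (intro emeasure_mono) auto

text \<open>As a countable sum of indicators the tail is measurable in the threshold, and an
  integral over space can be exchanged with the expectation over the mark.\<close>

lemma tail_eq_suminf: "tail q c = (\<Sum>k. ennreal (pmf q k) * indicator {c<..} (of_nat k))"
proof -
  have "tail q c = (\<integral>\<^sup>+k. indicator {k. c < of_nat k} k \<partial>measure_pmf q)"
    by (simp add: tail_def)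
  also have "\<dots> = (\<Sum>k. ennreal (pmf q k) * indicator {k. c < of_nat k} k)"
    by (simp only: nn_integral_measure_pmf nn_integral_count_space_nat)
  finally show ?thesis by (simp add: indicator_def)
qed

lemma measurable_tail [measurable]: "tail q \<in> borel_measurable borel"
proof -
  have "(\<lambda>c. indicator {c<..} (of_nat k :: ennreal) :: ennreal) \<in> borel_measurable borel" for k :: nat
  proof -
    have "(\<lambda>c. indicator {c<..} (of_nat k :: ennreal) :: ennreal) = indicator {..<of_nat k}"
      by (auto simp: indicator_def)
    then show ?thesis by simp
  qed
  then show ?thesis
    unfolding tail_eq_suminf[abs_def] by measurable
qed

text \<open>By independence, the probability that no mark outside a finite set \<open>F\<close>
  exceeds its threshold is bounded by products of factors \<open>1 - p i\<close>, hence by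
  \<open>exp\<close> of minus the partial sums, since \<open>1 - p \<le> exp (- p)\<close>. The
  thresholds may differ from point to point.\<close>

lemma second_borel_cantelli_marks:
  fixes b :: "('a::euclidean_space) measure" and c :: "'a \<Rightarrow> ennreal"
  assumes b: "b \<in> point_measures borel bounded"
    and inf: "(\<integral>\<^sup>+y. tail q (c y) \<partial>count_space (atoms b)) = \<infinity>"
  shows "AE f in (\<Pi>\<^sub>M y\<in>atoms b. measure_pmf q). infinite {y \<in> atoms b. c y < of_nat (f y)}"
proof -
  let ?M = "\<Pi>\<^sub>M y\<in>atoms b. measure_pmf q"
  interpret product_prob_space "\<lambda>_. measure_pmf q" "atoms b" ..
  define N where "N F = {f \<in> space ?M. \<forall>y\<in>atoms b - F. \<not> c y < of_nat (f y)}" for F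
  have count: "countable (atoms b)" by (rule countable_atoms[OF b])
  have sets1: "{f \<in> space ?M. \<not> c y < of_nat (f y)} \<in> sets ?M" if "y \<in> atoms b" for y
    using measurable_sets[OF measurable_component_singleton[OF that, of "\<lambda>_. measure_pmf q"], of "{k. \<not> c y < of_nat k}"]
    by (simp add: vimage_def Int_def conj_commute)
  have null: "N F \<in> null_sets ?M" if F: "finite F" "F \<subseteq> atoms b" for F
  proof -
    define X where "X = atoms b - F"
    have cX: "countable X" using count by (simp add: X_def)
    \<comment> \<open>Each tail is at most 1, so removing the finite set \<open>F\<close> takes only
      a finite amount from a divergent sum.\<close>
    have infX: "(\<integral>\<^sup>+y. tail q (c y) \<partial>count_space X) = \<infinity>"
    proof (rule ccontr)
      assume fin: "(\<integral>\<^sup>+y. tail q (c y) \<partial>count_space X) \<noteq> \<infinity>"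
      have "(\<integral>\<^sup>+y. tail q (c y) \<partial>count_space (atoms b)) =
          (\<integral>\<^sup>+y. tail q (c y) * indicator X y + tail q (c y) * indicator F y \<partial>count_space (atoms b))"
        by (intro nn_integral_cong) (auto simp: X_def indicator_def)
      also have "\<dots> = (\<integral>\<^sup>+y. tail q (c y) * indicator X y \<partial>count_space (atoms b)) +
          (\<integral>\<^sup>+y. tail q (c y) * indicator F y \<partial>count_space (atoms b))"
        by (intro nn_integral_add) auto
      also have "(\<integral>\<^sup>+y. tail q (c y) * indicator X y \<partial>count_space (atoms b)) = (\<integral>\<^sup>+y. tail q (c y) \<partial>count_space X)"
      proof -
        have "(\<integral>\<^sup>+y. tail q (c y) \<partial>count_space X) = (\<integral>\<^sup>+y. tail q (c y) * indicator X y \<partial>count_space UNIV)"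
          by (rule nn_integral_count_space_indicator) simp
        also have "\<dots> = (\<integral>\<^sup>+y. tail q (c y) * indicator X y * indicator (atoms b) y \<partial>count_space UNIV)"
          by (intro nn_integral_cong) (auto simp: X_def indicator_def)
        also have "\<dots> = (\<integral>\<^sup>+y. tail q (c y) * indicator X y \<partial>count_space (atoms b))"
          by (rule nn_integral_count_space_indicator[symmetric]) simp
        finally show ?thesis ..
      qed
      also have "(\<integral>\<^sup>+y. tail q (c y) * indicator F y \<partial>count_space (atoms b)) = (\<Sum>y\<in>F. tail q (c y))"
        using F by (subst nn_integral_count_space'[where A=F]) auto
      also have "(\<integral>\<^sup>+y. tail q (c y) \<partial>count_space X) + (\<Sum>y\<in>F. tail q (c y)) < \<infinity>"
      proof -
        have "(\<Sum>y\<in>F. tail q (c y)) \<le> (\<Sum>y\<in>F. 1)" by (intro sum_mono tail_le_1)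
        also have "\<dots> < \<infinity>" by (simp add: of_nat_less_top)
        finally show ?thesis using fin by (simp add: less_top)
      qed
      finally show False using inf by simp
    qed
    have "infinite X"
    proof
      assume "finite X"
      then have "(\<integral>\<^sup>+y. tail q (c y) \<partial>count_space X) = (\<Sum>y\<in>X. tail q (c y))"
        by (rule nn_integral_count_space_finite)
      also have "\<dots> \<le> (\<Sum>y\<in>X. 1)" by (intro sum_mono tail_le_1)
      also have "\<dots> < \<infinity>" by (simp add: of_nat_less_top)
      finally show False using infX by simp
    qed
    \<comment> \<open>An enumeration of the remaining points, so that divergence can be expressed by
      partial sums and independence used for finitely many coordinates at a time.\<close>
    define e where "e = from_nat_into X"
    have e: "bij_betw e UNIV X"
      unfolding e_def using cX \<open>infinite X\<close> by (rule bij_betw_from_nat_into)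
    then have eX: "e i \<in> atoms b" "e i \<notin> F" for i by (auto simp: bij_betw_def X_def)
    define p where "p i = measure (measure_pmf q) {k. c (e i) < of_nat k}" for i
    have p: "0 \<le> p i" "p i \<le> 1" for i by (auto simp: p_def)
    have tail_p: "tail q (c (e i)) = ennreal (p i)" for i
      by (simp add: tail_def p_def measure_pmf.emeasure_eq_measure)
    have "(\<Sum>i. ennreal (p i)) = \<infinity>"
      using infX nn_integral_bij_count_space[OF e, of "\<lambda>y. tail q (c y)"] by (simp add: tail_p nn_integral_count_space_nat)
    then have unbounded: "\<exists>n. K \<le> (\<Sum>i<n. p i)" for K :: real
    proof (rule contrapos_pp)
      assume *: "\<nexists>n. K \<le> (\<Sum>i<n. p i)"
      have "(\<Sum>i<n. ennreal (p i)) \<le> ennreal K" for n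
      proof -
        have "(\<Sum>i<n. p i) \<le> K" using * by (meson nle_le)
        then show ?thesis using p by (simp add: sum_ennreal ennreal_leI)
      qed
      then have "(\<Sum>i. ennreal (p i)) \<le> ennreal K"
        unfolding suminf_eq_SUP by (intro SUP_least)
      then show "(\<Sum>i. ennreal (p i)) \<noteq> \<infinity>" by (auto simp: top_unique)
    qed
    have N_sets: "N F \<in> sets ?M"
      unfolding N_def using sets1 count by (intro sets.sets_Collect_countable_All') auto
    have bound: "emeasure ?M (N F) \<le> ennreal (exp (- (\<Sum>i<n. p i)))" for n
    proof -
      have "N F \<subseteq> {f \<in> space ?M. \<forall>y\<in>e ` {..<n}. f y \<in> {k. \<not> c y < of_nat k}}"
        using eX by (auto simp: N_def)
      then have "emeasure ?M (N F) \<le> emeasure ?M {f \<in> space ?M. \<forall>y\<in>e ` {..<n}. f y \<in> {k. \<not> c y < of_nat k}}"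
        using sets1 eX(1) by (intro emeasure_mono sets.sets_Collect_countable_All') auto
      also have "\<dots> = (\<Prod>y\<in>e ` {..<n}. emeasure (measure_pmf q) {k. \<not> c y < of_nat k})"
        using eX(1) by (intro emeasure_PiM_Collect) auto
      also have "\<dots> = (\<Prod>i<n. emeasure (measure_pmf q) {k. \<not> c (e i) < of_nat k})"
      proof -
        have "inj_on e {..<n}" using e by (auto simp: bij_betw_def inj_on_def)
        then show ?thesis by (subst prod.reindex) auto
      qed
      also have "\<dots> = (\<Prod>i<n. ennreal (1 - p i))"
      proof (rule prod.cong[OF refl])
        fix i
        have "{k. \<not> c (e i) < of_nat k} = space (measure_pmf q) - {k. c (e i) < of_nat k}" by auto
        then have "measure (measure_pmf q) {k. \<not> c (e i) < of_nat k} = 1 - p i"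
          unfolding p_def by (subst measure_pmf.prob_compl[symmetric]) auto
        then show "emeasure (measure_pmf q) {k. \<not> c (e i) < of_nat k} = ennreal (1 - p i)"
          by (simp add: measure_pmf.emeasure_eq_measure)
      qed
      also have "\<dots> = ennreal (\<Prod>i<n. 1 - p i)" using p by (intro prod_ennreal) auto
      also have "\<dots> \<le> ennreal (exp (- (\<Sum>i<n. p i)))"
      proof (rule ennreal_leI)
        have "(\<Prod>i<n. 1 - p i) \<le> (\<Prod>i<n. exp (- p i))"
          using p exp_ge_add_one_self[of "- p i" for i] by (intro prod_mono) auto
        then show "(\<Prod>i<n. 1 - p i) \<le> exp (- (\<Sum>i<n. p i))" by (simp add: exp_sum sum_negf[symmetric])
      qed
      finally show ?thesis .
    qed
    have "measure ?M (N F) = 0"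
    proof (rule ccontr)
      assume "measure ?M (N F) \<noteq> 0"
      then have pos: "0 < measure ?M (N F)" by (simp add: zero_less_measure_iff)
      \<comment> \<open>The summand 1 makes the bound strictly smaller than the measure that is
        supposed to be positive.\<close>
      obtain n where n: "1 - ln (measure ?M (N F)) \<le> (\<Sum>i<n. p i)" using unbounded by blast
      have "measure ?M (N F) \<le> exp (- (\<Sum>i<n. p i))"
        using bound[of n] by (simp add: emeasure_eq_measure)
      also have "\<dots> \<le> exp (ln (measure ?M (N F)) - 1)" using n by simp
      also have "\<dots> < exp (ln (measure ?M (N F)))" by simp
      finally show False using pos by simp
    qed
    then show ?thesis using N_sets by (simp add: null_sets_def emeasure_eq_measure)
  qed
  \<comment> \<open>If only finitely many marks exceed their thresholds, \<open>f\<close> lies in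
    \<open>N F\<close> for the set \<open>F\<close> of their positions. There are countably many
    finite \<open>F\<close>, so the null sets can be united.\<close>
  have "AE f in ?M. \<forall>F\<in>{F. finite F \<and> F \<subseteq> atoms b}. f \<notin> N F"
  proof (subst AE_ball_countable)
    show "countable {F. finite F \<and> F \<subseteq> atoms b}" by (rule countable_Collect_finite_subset[OF count])
    show "\<forall>F\<in>{F. finite F \<and> F \<subseteq> atoms b}. AE f in ?M. f \<notin> N F"
      using null AE_not_in by auto
  qed
  with AE_space show ?thesis
  proof eventually_elim
    case (elim f)
    show ?case
    proof
      assume "finite {y \<in> atoms b. c y < of_nat (f y)}"
      then have "f \<notin> N {y \<in> atoms b. c y < of_nat (f y)}" using elim(2) by auto
      then show False using elim(1) by (auto simp: N_def)
    qed
  qed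
qed

text \<open>
  An unsaturated red point \<open>x\<close> is joined to every blue point \<open>y\<close> that has more stubs than there are
  red points within distance \<open>dist x y\<close> of \<open>y\<close>.
\<close>

lemma (in bicolored_points) saturated_of_infinite:
  assumes inf: "infinite {y \<in> atoms b. emeasure r (cball 0 (3 * norm y)) < emeasure hb {y}}"
    and x: "x \<in> atoms r"
  shows "emeasure b {y. mtch x y} = emeasure hr {x}"
proof (rule ccontr)
  assume "emeasure b {y. mtch x y} \<noteq> emeasure hr {x}"
  then have unsat: "emeasure b {y. mtch x y} < emeasure hr {x}" using matched_degree_le[of x] by auto
  let ?Y = "{y \<in> atoms b. emeasure r (cball 0 (3 * norm y)) < emeasure hb {y}}"
  \<comment> \<open>Excluding these finitely many points leaves a blue \<open>y\<close> that is not
    joined to \<open>x\<close> and is farther from the origin than \<open>x\<close>.\<close>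
  have "finite (atoms b \<inter> cball 0 (norm x) \<union> {y. mtch x y})"
    using finite_atoms_bounded[OF b bounded_cball] finite_matched by blast
  then obtain y where y: "y \<in> ?Y" "y \<notin> atoms b \<inter> cball 0 (norm x) \<union> {y. mtch x y}"
    using inf finite_subset[of ?Y "atoms b \<inter> cball 0 (norm x) \<union> {y. mtch x y}"] by blast
  then have yb: "y \<in> atoms b" and nm: "\<not> mtch x y" and norm: "norm x < norm y" by auto
  \<comment> \<open>Origin of the factor 3: a partner is at most as far from \<open>y\<close> as
    \<open>x\<close>, that is at most \<open>2 * norm y\<close>, and \<open>y\<close> itself
    contributes another \<open>norm y\<close>.\<close>
  have "{x'. mtch x' y} \<subseteq> cball 0 (3 * norm y)"
  proof
    fix x' assume "x' \<in> {x'. mtch x' y}"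
    then have "dist x' y \<le> dist x y" using unsaturated(2)[OF x unsat yb nm] by blast
    also have "\<dots> \<le> 2 * norm y" using norm norm_triangle_ineq4[of x y] by (simp add: dist_norm)
    finally have "norm x' \<le> 3 * norm y" using norm_triangle_sub[of x' y] by (simp add: dist_norm)
    then show "x' \<in> cball 0 (3 * norm y)" by simp
  qed
  then have "emeasure r {x'. mtch x' y} \<le> emeasure r (cball 0 (3 * norm y))"
    by (intro emeasure_mono) (auto simp: sets_configs[OF r])
  then show False using unsaturated(1)[OF x unsat yb nm] y(1) by auto
qed

subsection \<open>Large marks at all scales\<close>

text \<open>Integrating over space first, the left side is the mean volume of the region where the
  threshold lies below a random mark \<open>k\<close>. The threshold grows like the
  \<open>DIM('a)\<close>-th power of the distance, so this volume is at least linear in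
  \<open>k\<close> up to a constant.\<close>

lemma nn_integral_tail_volume:
  fixes q :: "nat pmf"
  assumes mean: "(\<integral>\<^sup>+k. of_nat k \<partial>measure_pmf q) = \<infinity>" and C: "C > 0" and D: "D > 0"
  shows "(\<integral>\<^sup>+t. tail q (ennreal (C * (3 * norm (t::'a::euclidean_space) + 4 * D) ^ DIM('a))) \<partial>lborel) = \<infinity>"
proof -
  let ?d = "DIM('a)" and ?v = "unit_ball_vol (real DIM('a))"
  define \<tau> where "\<tau> t = C * (3 * norm t + 4 * D) ^ ?d" for t :: 'a
  have [measurable]: "\<tau> \<in> borel_measurable borel" unfolding \<tau>_def[abs_def] by measurable
  \<comment> \<open>If \<open>D \<le> s\<close>, then \<open>3 * norm t + 4 * D < 7 * s\<close> on
    the ball of radius \<open>s\<close>, hence the 7. The level \<open>k0\<close> corresponds to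
    \<open>s = D\<close>; below it the additive term alone gives the estimate.\<close>
  define \<alpha> where "\<alpha> = ?v / (C * 7 ^ ?d)"
  define k0 where "k0 = C * (7 * D) ^ ?d"
  have v: "?v > 0" by simp
  have \<alpha>: "\<alpha> > 0" using v C by (simp add: \<alpha>_def)
  have k0: "k0 \<ge> 0" using C D by (simp add: k0_def)
  have vol: "ennreal (\<alpha> * real k) \<le> emeasure lborel {t::'a. \<tau> t < real k} + ennreal (\<alpha> * k0)" for k
  proof (cases "real k \<le> k0")
    case True
    then have "ennreal (\<alpha> * real k) \<le> ennreal (\<alpha> * k0)"
      using \<alpha> by (intro ennreal_leI mult_left_mono) auto
    then show ?thesis by (simp add: add_increasing)
  next
    case False
    \<comment> \<open>The solution of \<open>C * (7 * s) ^ ?d = real k\<close>; the ball of this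
      radius has volume exactly \<open>\<alpha> * real k\<close>.\<close>
    define s where "s = root ?d (real k / (C * 7 ^ ?d))"
    have sd: "s ^ ?d = real k / (C * 7 ^ ?d)" unfolding s_def using C by (simp add: real_root_pow_pos2)
    have s0: "s \<ge> 0" unfolding s_def using C by simp
    have "D ^ ?d \<le> s ^ ?d"
      using False C by (simp add: sd k0_def field_simps power_mult_distrib)
    then have Ds: "D \<le> s"
      using power_mono_iff[of D s ?d] D s0 by simp
    have "ball 0 s \<subseteq> {t::'a. \<tau> t < real k}"
    proof
      fix t :: 'a assume "t \<in> ball 0 s"
      then have "3 * norm t + 4 * D < 7 * s" using Ds by simp
      then have "(3 * norm t + 4 * D) ^ ?d < (7 * s) ^ ?d"
        using D by (intro power_strict_mono) auto
      then have "\<tau> t < C * (7 * s) ^ ?d" unfolding \<tau>_def using C by simp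
      also have "\<dots> = real k" using C by (simp add: power_mult_distrib sd)
      finally show "t \<in> {t. \<tau> t < real k}" by simp
    qed
    then have "emeasure lborel (ball (0::'a) s) \<le> emeasure lborel {t::'a. \<tau> t < real k}"
      by (intro emeasure_mono) measurable
    moreover have "emeasure lborel (ball (0::'a) s) = ennreal (\<alpha> * real k)"
      using s0 by (simp add: emeasure_ball sd \<alpha>_def)
    ultimately show ?thesis by (simp add: add_increasing2)
  qed
  have "(\<integral>\<^sup>+k. ennreal (\<alpha> * real k) \<partial>measure_pmf q) = ennreal \<alpha> * (\<integral>\<^sup>+k. of_nat k \<partial>measure_pmf q)"
    using \<alpha> by (subst nn_integral_cmult[symmetric]) (auto simp: ennreal_mult ennreal_of_nat_eq_real_of_nat)
  also have "\<dots> = \<infinity>" using mean \<alpha> by (simp add: ennreal_mult_top)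
  finally have "\<infinity> \<le> (\<integral>\<^sup>+k. emeasure lborel {t::'a. \<tau> t < real k} + ennreal (\<alpha> * k0) \<partial>measure_pmf q)"
    using nn_integral_mono[of "measure_pmf q" "\<lambda>k. ennreal (\<alpha> * real k)"
        "\<lambda>k. emeasure lborel {t::'a. \<tau> t < real k} + ennreal (\<alpha> * k0)"] vol by simp
  also have "\<dots> = (\<integral>\<^sup>+k. emeasure lborel {t::'a. \<tau> t < real k} \<partial>measure_pmf q) + ennreal (\<alpha> * k0)"
    by (subst nn_integral_add) (auto simp: measure_pmf.emeasure_space_1)
  finally have inf: "(\<integral>\<^sup>+k. emeasure lborel {t::'a. \<tau> t < real k} \<partial>measure_pmf q) = \<infinity>"
    by (auto simp: top_unique)
  have lt: "ennreal (\<tau> t) < of_nat k \<longleftrightarrow> \<tau> t < real k" for t k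
    using C D by (simp add: ennreal_of_nat_eq_real_of_nat ennreal_less_iff \<tau>_def)
  have "(\<integral>\<^sup>+t. tail q (ennreal (\<tau> t)) \<partial>lborel) =
      (\<integral>\<^sup>+t. (\<Sum>k. ennreal (pmf q k) * indicator {t. \<tau> t < real k} t) \<partial>lborel)"
    by (intro nn_integral_cong) (simp add: tail_eq_suminf indicator_def lt)
  also have "\<dots> = (\<Sum>k. \<integral>\<^sup>+t. ennreal (pmf q k) * indicator {t. \<tau> t < real k} t \<partial>lborel)"
    by (intro nn_integral_suminf) measurable
  also have "\<dots> = (\<Sum>k. ennreal (pmf q k) * emeasure lborel {t::'a. \<tau> t < real k})"
    by (intro suminf_cong nn_integral_cmult_indicator) measurable
  also have "\<dots> = (\<integral>\<^sup>+k. emeasure lborel {t::'a. \<tau> t < real k} \<partial>measure_pmf q)"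
    by (simp add: nn_integral_measure_pmf nn_integral_count_space_nat)
  finally show ?thesis using inf by (simp add: \<tau>_def)
qed

section \<open>Numbers of points in shifted cubes and in balls\<close>

lemma cball_borel [measurable]: "cball a s \<in> sets borel"
  by (rule borel_closed[OF closed_cball])

lemma norm_unit_cube: "x \<in> cbox 0 One \<Longrightarrow> norm (x::'a::euclidean_space) \<le> norm (One::'a)"
  by (intro norm_le_componentwise) (auto simp: mem_box)

context stationary_kernels
begin

lemma swap_kernels: "stationary_kernels P S T Z B R"
  using inv measurable_T measurable_R measurable_B R_T B_T prob_space_axioms
  by (simp add: stationary_kernels_def stationary_kernels_axioms_def)

text \<open>The function \<open>F\<close> is general because both the mean number of points in a
  cube and the probability that a cube is occupied have to be independent of the position.\<close>

lemma cube_translate: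
  assumes [measurable]: "F \<in> borel_measurable borel"
  shows "(\<integral>\<^sup>+\<omega>. F (emeasure (R (Z \<omega>)) {x. x - t \<in> cbox 0 One}) \<partial>P) =
    (\<integral>\<^sup>+\<omega>. F (emeasure (R (Z \<omega>)) (cbox 0 One)) \<partial>P)"
proof -
  have m: "(\<lambda>z. F (emeasure (R z) {x. x - t \<in> cbox 0 One})) \<in> borel_measurable S"
    by measurable
  have "emeasure (R (T t z)) {x. x - t \<in> cbox 0 One} = emeasure (R z) (cbox 0 One)" if "z \<in> space S" for z
    using that by (simp add: R_T emeasure_translate[OF sets_configs[OF R_configs]] vimage_Collect_translate)
  then have "(\<integral>\<^sup>+\<omega>. F (emeasure (R (Z \<omega>)) (cbox 0 One)) \<partial>P) =
      (\<integral>\<^sup>+\<omega>. F (emeasure (R (T t (Z \<omega>))) {x. x - t \<in> cbox 0 One}) \<partial>P)"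
    using measurable_space[OF measurable_Z] by (intro nn_integral_cong) simp
  also have "\<dots> = (\<integral>\<^sup>+\<omega>. F (emeasure (R (Z \<omega>)) {x. x - t \<in> cbox 0 One}) \<partial>P)"
    by (rule nn_integral_invariant[OF m])
  finally show ?thesis ..
qed

lemma nn_integral_cubes:
  assumes z: "z \<in> space S" and [measurable]: "h \<in> borel_measurable borel"
  shows "(\<integral>\<^sup>+x. h x \<partial>R z) = (\<integral>\<^sup>+t. (\<integral>\<^sup>+x. indicator (cbox 0 One) (x - t) * h x \<partial>R z) \<partial>lborel)"
proof -
  have "(\<integral>\<^sup>+x. h x \<partial>R z) = (\<integral>\<^sup>+x. (\<integral>\<^sup>+t. indicator (cbox 0 One) (x - t) * h x \<partial>lborel) \<partial>R z)"
    by (subst nn_integral_multc) (auto simp: nn_integral_lborel_unit_cube)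
  also have "\<dots> = (\<integral>\<^sup>+t. (\<integral>\<^sup>+x. indicator (cbox 0 One) (x - t) * h x \<partial>R z) \<partial>lborel)"
    by (rule nn_integral_swap[OF sigma_finite_configs[OF R_configs[OF z]] lborel.sigma_finite_measure_axioms
          sets_configs[OF R_configs[OF z]] refl]) measurable
  finally show ?thesis .
qed

text \<open>A shifted unit cube that meets the ball is shifted by at most
  \<open>s + norm One\<close>. Averaging over all shifts bounds the mean by the intensity times the
  volume of the larger ball.\<close>

lemma mean_cball:
  "(\<integral>\<^sup>+\<omega>. emeasure (R (Z \<omega>)) (cball 0 s) \<partial>P) \<le>
    intensity P (\<lambda>\<omega>. R (Z \<omega>)) * emeasure lborel (cball (0::'a) (s + norm (One::'a)))"
proof -
  let ?A = "cbox (0::'a) One" and ?C' = "cball (0::'a) (s + norm (One::'a))"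
  have Zs: "Z \<omega> \<in> space S" if "\<omega> \<in> space P" for \<omega> using measurable_space[OF measurable_Z that] .
  have "emeasure (R z) (cball 0 s) \<le> (\<integral>\<^sup>+t. indicator ?C' t * emeasure (R z) {x. x - t \<in> ?A} \<partial>lborel)"
    if z: "z \<in> space S" for z
  proof -
    have sR: "sets (R z) = sets borel" by (rule sets_configs[OF R_configs[OF z]])
    have "emeasure (R z) (cball 0 s) = (\<integral>\<^sup>+x. indicator (cball 0 s) x \<partial>R z)"
      by (rule nn_integral_indicator[symmetric]) (simp add: sR)
    also have "\<dots> = (\<integral>\<^sup>+t. (\<integral>\<^sup>+x. indicator ?A (x - t) * indicator (cball 0 s) x \<partial>R z) \<partial>lborel)"
      by (intro nn_integral_cubes[OF z] borel_measurable_indicator borel_closed closed_cball)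
    also have "\<dots> \<le> (\<integral>\<^sup>+t. indicator ?C' t * emeasure (R z) {x. x - t \<in> ?A} \<partial>lborel)"
    proof (rule nn_integral_mono)
      fix t :: 'a
      have At: "{x. x - t \<in> ?A} \<in> sets (R z)"
        using measurable_sets[of "\<lambda>x. x - t" borel borel ?A] by (simp add: sR vimage_def)
      have "(\<integral>\<^sup>+x. indicator ?A (x - t) * indicator (cball 0 s) x \<partial>R z) \<le>
          (\<integral>\<^sup>+x. indicator ?C' t * indicator {x. x - t \<in> ?A} x \<partial>R z)"
      proof (rule nn_integral_mono)
        fix x
        have "norm t \<le> s + norm (One::'a)" if "x - t \<in> ?A" "norm x \<le> s"
          using norm_unit_cube[OF that(1)] norm_triangle_ineq4[of x "x - t"] that(2) by simp
        then show "indicator ?A (x - t) * indicator (cball 0 s) x \<le>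
            (indicator ?C' t * indicator {x. x - t \<in> ?A} x :: ennreal)"
          by (auto simp: indicator_def)
      qed
      also have "\<dots> = indicator ?C' t * emeasure (R z) {x. x - t \<in> ?A}"
        using At by (rule nn_integral_cmult_indicator)
      finally show "(\<integral>\<^sup>+x. indicator ?A (x - t) * indicator (cball 0 s) x \<partial>R z) \<le>
          indicator ?C' t * emeasure (R z) {x. x - t \<in> ?A}" .
    qed
    finally show ?thesis .
  qed
  then have "(\<integral>\<^sup>+\<omega>. emeasure (R (Z \<omega>)) (cball 0 s) \<partial>P) \<le>
      (\<integral>\<^sup>+\<omega>. (\<integral>\<^sup>+t. indicator ?C' t * emeasure (R (Z \<omega>)) {x. x - t \<in> ?A} \<partial>lborel) \<partial>P)"
    using Zs by (intro nn_integral_mono) auto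
  also have "\<dots> = (\<integral>\<^sup>+t. (\<integral>\<^sup>+\<omega>. indicator ?C' t * emeasure (R (Z \<omega>)) {x. x - t \<in> ?A} \<partial>P) \<partial>lborel)"
  proof (rule nn_integral_swap[OF sigma_finite_measure_axioms lborel.sigma_finite_measure_axioms refl refl])
    have "(\<lambda>(\<omega>, t). emeasure (R (Z \<omega>)) {x. x - t \<in> ?A}) \<in> borel_measurable (P \<Otimes>\<^sub>M lborel)"
      by measurable
    then show "(\<lambda>(\<omega>, t). indicator ?C' t * emeasure (R (Z \<omega>)) {x. x - t \<in> ?A}) \<in> borel_measurable (P \<Otimes>\<^sub>M lborel)"
      unfolding case_prod_beta' by (intro borel_measurable_times_ennreal borel_measurable_indicator') measurable
  qed
  also have "\<dots> = (\<integral>\<^sup>+t. indicator ?C' t * intensity P (\<lambda>\<omega>. R (Z \<omega>)) \<partial>lborel)"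
    using cube_translate[of "\<lambda>x. x"]
    by (intro nn_integral_cong, subst nn_integral_cmult) (auto simp: intensity_def)
  also have "\<dots> = intensity P (\<lambda>\<omega>. R (Z \<omega>)) * emeasure lborel ?C'"
    by (subst nn_integral_multc) (auto simp: mult.commute)
  finally show ?thesis .
qed

text \<open>
  The sum dominates \<open>\<integral> g t * w t dt\<close>, where \<open>g t\<close> is the tail at a constant times the volume of a ball
  of radius about \<open>3 * norm t\<close>, and \<open>w t\<close> indicates that there is a blue point near \<open>t\<close> while that
  ball does not contain exceptionally many red points. The mean of \<open>w t\<close> is bounded below
  uniformly in \<open>t\<close>, so the integral cannot be finite almost surely.
\<close>

lemma tail_sum_infinite:
  fixes q :: "nat pmf"
  assumes finR: "intensity P (\<lambda>\<omega>. R (Z \<omega>)) < \<infinity>" and posB: "0 < intensity P (\<lambda>\<omega>. B (Z \<omega>))"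
    and mean: "(\<integral>\<^sup>+k. of_nat k \<partial>measure_pmf q) = \<infinity>"
  shows "\<not> (AE \<omega> in P. (\<integral>\<^sup>+y. tail q (emeasure (R (Z \<omega>)) (cball 0 (3 * norm y))) \<partial>B (Z \<omega>)) < \<infinity>)"
proof
  interpret sw: stationary_kernels P S T Z B R by (rule swap_kernels)
  let ?A = "cbox (0::'a) One" and ?d = "DIM('a)" and ?v = "unit_ball_vol (real DIM('a))"
  \<comment> \<open>\<open>norm One\<close> bounds the norm of the points of the unit cube; the
    summand 1 gives positivity at once.\<close>
  define D where "D = norm (One::'a) + 1"
  have D: "D > 0" by (simp add: D_def add_nonneg_pos)
  have v: "?v > 0" by simp
  have Zs: "Z \<omega> \<in> space S" if "\<omega> \<in> space P" for \<omega> using measurable_space[OF measurable_Z that] .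
  obtain lam where lam: "intensity P (\<lambda>\<omega>. R (Z \<omega>)) = ennreal lam" "lam \<ge> 0"
    using finR by (cases "intensity P (\<lambda>\<omega>. R (Z \<omega>))") auto
  define N where "N t \<omega> = emeasure (B (Z \<omega>)) {y. y - t \<in> ?A}" for t \<omega>
  \<comment> \<open>The radius is chosen such that the ball contains
    \<open>cball 0 (3 * norm y)\<close> for every \<open>y\<close> in the unit cube shifted by
    \<open>t\<close>.\<close>
  define \<rho> where "\<rho> t \<omega> = emeasure (R (Z \<omega>)) (cball 0 (3 * norm t + 3 * D))" for t :: 'a and \<omega>
  \<comment> \<open>The ball is written as a comprehension because the measurability rule for random
    masses expects a predicate.\<close>
  have \<rho>_alt: "\<rho> t \<omega> = emeasure (R (Z \<omega>)) {x. norm x \<le> 3 * norm t + 3 * D}" for t \<omega>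
    unfolding \<rho>_def by (rule arg_cong2[where f=emeasure]) auto
  define s where "s \<omega> = (\<integral>\<^sup>+y. tail q (emeasure (R (Z \<omega>)) {x. norm x \<le> 3 * norm y}) \<partial>B (Z \<omega>))" for \<omega>
  have [measurable]: "(\<lambda>(\<omega>, t). N t \<omega>) \<in> borel_measurable (P \<Otimes>\<^sub>M lborel)" "N t \<in> borel_measurable P" for t
    unfolding N_def[abs_def] by measurable
  have [measurable]: "(\<lambda>(\<omega>, t). \<rho> t \<omega>) \<in> borel_measurable (P \<Otimes>\<^sub>M lborel)" "\<rho> t \<in> borel_measurable P" for t
    unfolding \<rho>_alt[abs_def] by measurable
  have [measurable]: "s \<in> borel_measurable P"
    unfolding s_def[abs_def] by measurable
  assume "AE \<omega> in P. (\<integral>\<^sup>+y. tail q (emeasure (R (Z \<omega>)) (cball 0 (3 * norm y))) \<partial>B (Z \<omega>)) < \<infinity>"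
  then have s_fin: "AE \<omega> in P. s \<omega> < \<infinity>" by (simp add: s_def cball_def)
  \<comment> \<open>The probability that a unit cube contains a blue point: by stationarity the same
    for all cubes, and positive because the blue intensity is.\<close>
  define \<beta> where "\<beta> = measure P {\<omega> \<in> space P. 1 \<le> N 0 \<omega>}"
  have \<beta>_eq: "measure P {\<omega> \<in> space P. 1 \<le> N t \<omega>} = \<beta>" for t
  proof -
    have prob: "(\<integral>\<^sup>+\<omega>. indicator {1..} (N t \<omega>) \<partial>P) = emeasure P {\<omega> \<in> space P. 1 \<le> N t \<omega>}" for t
    proof -
      have "(\<integral>\<^sup>+\<omega>. indicator {1..} (N t \<omega>) \<partial>P) = (\<integral>\<^sup>+\<omega>. indicator {\<omega> \<in> space P. 1 \<le> N t \<omega>} \<omega> \<partial>P)"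
        by (intro nn_integral_cong) (auto simp: indicator_def)
      also have "\<dots> = emeasure P {\<omega> \<in> space P. 1 \<le> N t \<omega>}" by (rule nn_integral_indicator) measurable
      finally show ?thesis .
    qed
    have "(\<integral>\<^sup>+\<omega>. indicator {1..} (N t \<omega>) \<partial>P) = (\<integral>\<^sup>+\<omega>. indicator {1..} (N 0 \<omega>) \<partial>P)"
      using sw.cube_translate[of "indicator {1..}" t] sw.cube_translate[of "indicator {1..}" 0]
      by (simp add: N_def)
    then show ?thesis unfolding prob \<beta>_def by (simp add: measure_def)
  qed
  have \<beta>: "\<beta> > 0"
  proof (rule ccontr)
    assume "\<not> \<beta> > 0"
    then have "\<beta> = 0" using measure_nonneg[of P] by (simp add: \<beta>_def less_le)
    then have "AE \<omega> in P. \<not> 1 \<le> N 0 \<omega>" using prob_eq_0[of "{\<omega> \<in> space P. 1 \<le> N 0 \<omega>}"]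
      by (auto simp: \<beta>_def elim!: eventually_mono)
    then have "AE \<omega> in P. emeasure (B (Z \<omega>)) ?A = 0"
      using AE_space
    proof eventually_elim
      case (elim \<omega>)
      obtain n::nat where n: "emeasure (B (Z \<omega>)) ?A = of_nat n"
        using configs_nat[OF B_configs[OF Zs[OF elim(2)]] borel_closed[OF closed_cbox] bounded_cbox] by blast
      then show ?case using elim(1) by (cases n) (auto simp: N_def)
    qed
    then have "intensity P (\<lambda>\<omega>. B (Z \<omega>)) = (\<integral>\<^sup>+\<omega>. 0 \<partial>P)"
      unfolding intensity_def by (rule nn_integral_cong_AE)
    then show False using posB by simp
  qed
  \<comment> \<open>With this constant, Markov's inequality bounds the probability that
    \<open>\<rho> t\<close> exceeds \<open>\<tau> t\<close> by \<open>\<beta> / 2\<close>: the mean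
    of \<open>\<rho> t\<close> is at most \<open>lam * (?v * X t)\<close>, where
    \<open>4 * D\<close> in \<open>X\<close> makes room for the \<open>norm One\<close> of
    \<open>mean_cball\<close>. With \<open>lam + 1\<close> in place of \<open>lam\<close> positivity
    of \<open>C\<close> is immediate.\<close>
  define C where "C = 2 * (lam + 1) / \<beta> * ?v"
  have C: "C > 0" using lam(2) \<beta> v by (simp add: C_def)
  define X where "X t = (3 * norm t + 4 * D) ^ ?d" for t :: 'a
  have X: "X t > 0" for t using D by (simp add: X_def add_nonneg_pos)
  define \<tau> where "\<tau> t = C * X t" for t
  have \<tau>: "\<tau> t > 0" for t using C X by (simp add: \<tau>_def)
  have [measurable]: "\<tau> \<in> borel_measurable borel" unfolding \<tau>_def[abs_def] X_def by measurable
  define g where "g t = tail q (ennreal (\<tau> t))" for t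
  have [measurable]: "g \<in> borel_measurable borel" unfolding g_def[abs_def] by measurable
  have g1: "g t \<le> 1" for t by (simp add: g_def tail_le_1)
  have g_inf: "(\<integral>\<^sup>+t. g t \<partial>lborel) = \<infinity>"
    unfolding g_def \<tau>_def X_def by (rule nn_integral_tail_volume[OF mean C D])
  define w where "w t \<omega> = (indicator {\<omega>. 1 \<le> N t \<omega> \<and> \<rho> t \<omega> \<le> ennreal (\<tau> t)} \<omega> :: ennreal)" for t \<omega>
  have [measurable]: "(\<lambda>(\<omega>, t). w t \<omega>) \<in> borel_measurable (P \<Otimes>\<^sub>M lborel)" "w t \<in> borel_measurable P" for t
    unfolding w_def[abs_def] indicator_def by measurable
  have w_mean: "ennreal (\<beta> / 2) \<le> (\<integral>\<^sup>+\<omega>. w t \<omega> \<partial>P)" for t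
  proof -
    let ?m = "measure P {\<omega> \<in> space P. ennreal (\<tau> t) < \<rho> t \<omega>}"
    let ?w = "{\<omega> \<in> space P. 1 \<le> N t \<omega> \<and> \<rho> t \<omega> \<le> ennreal (\<tau> t)}"
    have "ennreal (\<tau> t * ?m) = (\<integral>\<^sup>+\<omega>. ennreal (\<tau> t) * indicator {\<omega> \<in> space P. ennreal (\<tau> t) < \<rho> t \<omega>} \<omega> \<partial>P)"
      using \<tau>[of t] by (subst nn_integral_cmult_indicator) (auto simp: emeasure_eq_measure ennreal_mult)
    also have "\<dots> \<le> (\<integral>\<^sup>+\<omega>. \<rho> t \<omega> \<partial>P)"
      by (intro nn_integral_mono) (auto simp: indicator_def)
    also have "\<dots> \<le> ennreal lam * emeasure lborel (cball (0::'a) (3 * norm t + 3 * D + norm (One::'a)))"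
      unfolding \<rho>_def using mean_cball[of "3 * norm t + 3 * D"] by (simp add: lam(1))
    also have "\<dots> \<le> ennreal lam * emeasure lborel (cball (0::'a) (3 * norm t + 4 * D))"
      by (intro mult_left_mono emeasure_mono) (auto simp: D_def)
    also have "\<dots> = ennreal (lam * (?v * X t))"
      using D lam(2) by (simp add: emeasure_cball X_def ennreal_mult)
    finally have "\<tau> t * ?m \<le> lam * (?v * X t)"
      using lam(2) v X[of t] by (subst (asm) ennreal_le_iff) (auto intro!: mult_nonneg_nonneg simp: less_imp_le)
    then have "(2 * (lam + 1) / \<beta> * ?m) * (?v * X t) \<le> lam * (?v * X t)"
      by (simp add: \<tau>_def C_def mult_ac)
    then have "2 * (lam + 1) / \<beta> * ?m \<le> lam"
      using v X[of t] by (simp only: mult_le_cancel_right) (auto simp: zero_less_mult_iff)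
    then have "(lam + 1) * (2 * ?m) \<le> lam * \<beta>" using \<beta> by (simp add: field_simps)
    also have "\<dots> \<le> (lam + 1) * \<beta>" using \<beta> by (intro mult_right_mono) auto
    finally have m: "2 * ?m \<le> \<beta>" using lam(2) by (simp add: mult_le_cancel_left)
    have "\<beta> = measure P {\<omega> \<in> space P. 1 \<le> N t \<omega>}" by (rule \<beta>_eq[symmetric])
    also have "\<dots> \<le> measure P (?w \<union> {\<omega> \<in> space P. ennreal (\<tau> t) < \<rho> t \<omega>})"
      by (intro finite_measure_mono) (auto simp: not_le)
    also have "\<dots> \<le> measure P ?w + ?m"
      by (intro measure_Un_le) measurable
    finally have "\<beta> / 2 \<le> measure P ?w" using m by simp
    then have "ennreal (\<beta> / 2) \<le> emeasure P ?w" by (simp add: emeasure_eq_measure ennreal_leI)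
    also have "\<dots> = (\<integral>\<^sup>+\<omega>. w t \<omega> \<partial>P)"
    proof -
      have "(\<integral>\<^sup>+\<omega>. w t \<omega> \<partial>P) = (\<integral>\<^sup>+\<omega>. indicator ?w \<omega> \<partial>P)"
        by (intro nn_integral_cong) (auto simp: w_def indicator_def)
      also have "\<dots> = emeasure P ?w" by (rule nn_integral_indicator) measurable
      finally show ?thesis ..
    qed
    finally show ?thesis .
  qed
  have gw_le: "(\<integral>\<^sup>+t. g t * w t \<omega> \<partial>lborel) \<le> s \<omega>" if \<omega>: "\<omega> \<in> space P" for \<omega>
  proof -
    note z = Zs[OF \<omega>]
    have sB: "sets (B (Z \<omega>)) = sets borel" by (rule sets_configs[OF B_configs[OF z]])
    have sR: "sets (R (Z \<omega>)) = sets borel" by (rule sets_configs[OF R_configs[OF z]])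
    define c where "c y = emeasure (R (Z \<omega>)) {x. norm x \<le> 3 * norm y}" for y :: 'a
    have [measurable]: "c \<in> borel_measurable borel"
      unfolding c_def[abs_def]
      by (rule measurable_emeasure_configs[OF configs_const[OF R_configs[OF z]]]) measurable
    have "(\<integral>\<^sup>+t. g t * w t \<omega> \<partial>lborel) \<le>
        (\<integral>\<^sup>+t. (\<integral>\<^sup>+y. indicator ?A (y - t) * tail q (c y) \<partial>B (Z \<omega>)) \<partial>lborel)"
    proof (rule nn_integral_mono)
      fix t :: 'a
      have At: "{y. y - t \<in> ?A} \<in> sets (B (Z \<omega>))"
        using measurable_sets[of "\<lambda>x. x - t" borel borel ?A] by (simp add: sB vimage_def)
      show "g t * w t \<omega> \<le> (\<integral>\<^sup>+y. indicator ?A (y - t) * tail q (c y) \<partial>B (Z \<omega>))"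
      proof (cases "1 \<le> N t \<omega> \<and> \<rho> t \<omega> \<le> ennreal (\<tau> t)")
        case False
        then show ?thesis by (simp add: w_def)
      next
        case True
        \<comment> \<open>The threshold of every \<open>y\<close> in the cube is at most
          \<open>\<rho> t \<omega>\<close>, hence at most \<open>\<tau> t\<close>, and tails
          decrease in the threshold. One blue point in the cube thus contributes at least
          \<open>g t\<close>.\<close>
        have le: "g t \<le> tail q (c y)" if "y - t \<in> ?A" for y
        proof -
          have "norm y \<le> norm t + D"
            using norm_unit_cube[OF that] norm_triangle_sub[of y t] by (simp add: D_def)
          then have "c y \<le> \<rho> t \<omega>"
            unfolding c_def \<rho>_def by (intro emeasure_mono) (auto simp: sR)
          also have "\<dots> \<le> ennreal (\<tau> t)" using True by simp
          finally show ?thesis unfolding g_def by (rule tail_antimono)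
        qed
        have "g t * w t \<omega> = g t * 1" using True by (simp add: w_def)
        also have "\<dots> \<le> g t * N t \<omega>" using True by (intro mult_left_mono) auto
        also have "\<dots> = (\<integral>\<^sup>+y. g t * indicator {y. y - t \<in> ?A} y \<partial>B (Z \<omega>))"
          unfolding N_def using At by (rule nn_integral_cmult_indicator[symmetric])
        also have "\<dots> \<le> (\<integral>\<^sup>+y. indicator ?A (y - t) * tail q (c y) \<partial>B (Z \<omega>))"
          using le by (intro nn_integral_mono) (auto simp: indicator_def)
        finally show ?thesis .
      qed
    qed
    also have "\<dots> = (\<integral>\<^sup>+y. tail q (c y) \<partial>B (Z \<omega>))"
      by (rule sw.nn_integral_cubes[OF z, symmetric]) measurable
    finally show ?thesis by (simp add: s_def c_def)
  qed
  \<comment> \<open>\<open>\<beta> / 4\<close> is half of the lower bound \<open>\<beta> / 2\<close>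
    for the mean of \<open>w\<close>, so that the event where the sum exceeds \<open>K\<close> can
    be absorbed.\<close>
  obtain K :: nat where K: "measure P {\<omega> \<in> space P. of_nat K < s \<omega>} < \<beta> / 4"
  proof -
    let ?E = "\<lambda>k::nat. {\<omega> \<in> space P. of_nat k < s \<omega>}"
    have "decseq ?E"
      by (auto simp: decseq_def intro: le_less_trans[OF of_nat_mono])
    then have "(\<lambda>k. measure P (?E k)) \<longlonglongrightarrow> measure P (\<Inter>k. ?E k)"
      by (intro finite_Lim_measure_decseq) auto
    moreover have "measure P (\<Inter>k. ?E k) = 0"
    proof -
      have "AE \<omega> in P. \<omega> \<notin> (\<Inter>k. ?E k)"
        using s_fin
      proof eventually_elim
        case (elim \<omega>)
        then obtain k::nat where "s \<omega> < of_nat k" using ennreal_Ex_less_of_nat[of "s \<omega>"] by auto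
        then show ?case by (auto intro: less_asym)
      qed
      then show ?thesis by (subst prob_eq_0) auto
    qed
    ultimately have "eventually (\<lambda>k. measure P (?E k) < \<beta> / 4) sequentially"
      using \<beta> by (intro order_tendstoD(2)) auto
    then show ?thesis using that by (auto simp: eventually_sequentially)
  qed
  \<comment> \<open>Cutting off at balls makes \<open>m n\<close> finite. The inequality
    \<open>m n * (\<beta> / 2) \<le> K + m n * (\<beta> / 4)\<close> can then be solved for
    \<open>m n\<close>, with a bound independent of \<open>n\<close>.\<close>
  define m where "m n = (\<integral>\<^sup>+t. g t * indicator (cball 0 (real n)) t \<partial>lborel)" for n :: nat
  have m_le: "m n \<le> ennreal (4 * real K / \<beta>)" for n
  proof -
    have "m n \<le> (\<integral>\<^sup>+t. indicator (cball 0 (real n)) (t::'a) \<partial>lborel)"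
      unfolding m_def using g1 by (intro nn_integral_mono) (auto simp: indicator_def)
    also have "\<dots> < \<infinity>" by (simp add: emeasure_cball)
    finally obtain r where r: "m n = ennreal r" "r \<ge> 0" by (cases "m n") auto
    have "ennreal (r * (\<beta> / 2)) = (\<integral>\<^sup>+t. g t * indicator (cball 0 (real n)) t * ennreal (\<beta> / 2) \<partial>lborel)"
    proof -
      have "ennreal (r * (\<beta> / 2)) = m n * ennreal (\<beta> / 2)" using \<beta> r by (simp only: ennreal_mult r(1))
      then show ?thesis unfolding m_def by (subst nn_integral_multc) measurable
    qed
    also have "\<dots> \<le> (\<integral>\<^sup>+t. g t * indicator (cball 0 (real n)) t * (\<integral>\<^sup>+\<omega>. w t \<omega> \<partial>P) \<partial>lborel)"
      by (intro nn_integral_mono mult_left_mono w_mean) auto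
    also have "\<dots> = (\<integral>\<^sup>+t. (\<integral>\<^sup>+\<omega>. g t * indicator (cball 0 (real n)) t * w t \<omega> \<partial>P) \<partial>lborel)"
      by (intro nn_integral_cong nn_integral_cmult[symmetric]) measurable
    also have "\<dots> = (\<integral>\<^sup>+\<omega>. (\<integral>\<^sup>+t. g t * indicator (cball 0 (real n)) t * w t \<omega> \<partial>lborel) \<partial>P)"
      by (rule nn_integral_swap[OF sigma_finite_measure_axioms lborel.sigma_finite_measure_axioms refl refl, symmetric]) measurable
    also have "\<dots> \<le> (\<integral>\<^sup>+\<omega>. of_nat K + m n * indicator {\<omega> \<in> space P. of_nat K < s \<omega>} \<omega> \<partial>P)"
    proof (rule nn_integral_mono)
      fix \<omega> assume \<omega>: "\<omega> \<in> space P"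
      show "(\<integral>\<^sup>+t. g t * indicator (cball 0 (real n)) t * w t \<omega> \<partial>lborel) \<le>
          of_nat K + m n * indicator {\<omega> \<in> space P. of_nat K < s \<omega>} \<omega>"
      proof (cases "of_nat K < s \<omega>")
        case True
        have "(\<integral>\<^sup>+t. g t * indicator (cball 0 (real n)) t * w t \<omega> \<partial>lborel) \<le> m n"
          unfolding m_def by (intro nn_integral_mono) (auto simp: w_def indicator_def)
        then show ?thesis using True \<omega> by (simp add: add_increasing)
      next
        case False
        have "(\<integral>\<^sup>+t. g t * indicator (cball 0 (real n)) t * w t \<omega> \<partial>lborel) \<le> (\<integral>\<^sup>+t. g t * w t \<omega> \<partial>lborel)"
          by (intro nn_integral_mono) (auto simp: indicator_def)
        also have "\<dots> \<le> s \<omega>" by (rule gw_le[OF \<omega>])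
        also have "\<dots> \<le> of_nat K" using False by simp
        finally show ?thesis using False by simp
      qed
    qed
    also have "\<dots> = of_nat K + m n * emeasure P {\<omega> \<in> space P. of_nat K < s \<omega>}"
      by (subst nn_integral_add) (auto simp: nn_integral_cmult_indicator emeasure_space_1)
    also have "\<dots> \<le> of_nat K + m n * ennreal (\<beta> / 4)"
      using K by (intro add_left_mono mult_left_mono) (auto simp: emeasure_eq_measure ennreal_leI)
    also have "\<dots> = ennreal (real K + r * (\<beta> / 4))"
      using r \<beta> by (simp add: ennreal_of_nat_eq_real_of_nat ennreal_mult[symmetric] ennreal_plus[symmetric] del: ennreal_plus)
    finally have "r * (\<beta> / 2) \<le> real K + r * (\<beta> / 4)"
      using r \<beta> by (subst (asm) ennreal_le_iff) auto
    then have "r \<le> 4 * real K / \<beta>" using \<beta> by (simp add: field_simps)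
    then show ?thesis unfolding r(1) by (rule ennreal_leI)
  qed
  have "(\<integral>\<^sup>+t. g t \<partial>lborel) = (\<integral>\<^sup>+t. (SUP n. g t * indicator (cball 0 (real n)) t) \<partial>lborel)"
  proof (rule nn_integral_cong)
    fix t :: 'a
    obtain n::nat where "norm t \<le> real n" using real_arch_simple by blast
    then have "g t = g t * indicator (cball 0 (real n)) t" by simp
    also have "\<dots> \<le> (SUP n. g t * indicator (cball 0 (real n)) t)" by (rule SUP_upper) simp
    finally have "g t \<le> (SUP n. g t * indicator (cball 0 (real n)) t)" .
    moreover have "(SUP n. g t * indicator (cball 0 (real n)) t) \<le> g t"
      by (intro SUP_least) (auto simp: indicator_def)
    ultimately show "g t = (SUP n. g t * indicator (cball 0 (real n)) t)" by (rule antisym)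
  qed
  also have "\<dots> = (SUP n. m n)"
    unfolding m_def
    by (rule nn_integral_monotone_convergence_SUP)
       (auto simp: incseq_def le_fun_def indicator_def)
  also have "\<dots> \<le> ennreal (4 * real K / \<beta>)" by (intro SUP_least m_le)
  finally show False using g_inf by (simp add: top_unique)
qed

end

text \<open>If red points stay unsaturated, almost surely only finitely many blue marks exceed their
  thresholds. Conditionally on the ground processes this forces the sum of the tails to converge,
  against \<open>tail_sum_infinite\<close>.\<close>

lemma (in matching_problem) saturated_infinite:
  fixes q :: "nat pmf"
  assumes cm: "color_marks P q R B \<eta>B"
    and finR: "intensity P R < \<infinity>" and posB: "0 < intensity P B"
    and mean: "(\<integral>\<^sup>+k. of_nat k \<partial>measure_pmf q) = \<infinity>"
  shows "AE \<omega> in P. unsat_mass (Z \<omega>) = 0"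
proof (rule ccontr)
  assume "\<not> ?thesis"
  then have unsat: "AE \<omega> in P. unsat_mass (Z \<omega>) \<noteq> 0" using zero_one by blast
  interpret cm: color_marks P q R B \<eta>B by (rule cm)
  interpret st: stationary_kernels P configs4 translate4 Z red_of blue_of by (rule stationary)
  define big where "big r b h = {y \<in> atoms b. emeasure r {x. norm x \<le> 3 * norm y} < emeasure h {y}}"
    for r b h :: "'a measure"
  \<comment> \<open>Flags infinitely many big points. Under a simple blue measure the mass of
    \<open>big\<close> is its cardinality, so the flag is a Borel function of a mass.\<close>
  define u :: "('a measure \<times> 'a measure) \<times> 'a measure \<Rightarrow> ennreal"
    where "u p = indicator {\<infinity>} (emeasure (snd (fst p)) (big (fst (fst p)) (snd (fst p)) (snd p)))" for p
  have u [measurable]: "u \<in> borel_measurable ((configs \<Otimes>\<^sub>M configs) \<Otimes>\<^sub>M configs)"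
  proof -
    note [measurable] = measurable_emeasure_singleton measurable_atoms
    show ?thesis unfolding u_def[abs_def] big_def by measurable
  qed
  have cball: "{x. norm x \<le> 3 * norm y} = cball 0 (3 * norm y)" for y :: 'a by auto
  \<comment> \<open>The conditional probability of infinitely many big points in a measurable
    version: a vanishing integral forces it to vanish almost surely, which could not be concluded
    from a lower integral.\<close>
  obtain \<phi> where \<phi> [measurable]: "\<phi> \<in> borel_measurable P"
    and \<phi>_AE: "AE \<omega> in P. \<phi> \<omega> = (\<integral>\<^sup>+h. u ((R \<omega>, B \<omega>), h) \<partial>color_mark_law q (B \<omega>))"
    and \<phi>_int: "(\<integral>\<^sup>+\<omega>. u ((R \<omega>, B \<omega>), \<eta>B \<omega>) \<partial>P) = integral\<^sup>N P \<phi>"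
    using cm.disintegrates_measurable[OF u] unfolding cm.disintegrates_def by blast
  have "AE \<omega> in P. u ((R \<omega>, B \<omega>), \<eta>B \<omega>) = 0"
    using unsat good
  proof eventually_elim
    case (elim \<omega>)
    then interpret bicolored_points "R \<omega>" "\<eta>R \<omega>" "B \<omega>" "\<eta>B \<omega>" by simp
    have "finite (big (R \<omega>) (B \<omega>) (\<eta>B \<omega>))"
    proof (rule ccontr)
      assume "infinite (big (R \<omega>) (B \<omega>) (\<eta>B \<omega>))"
      then have "\<forall>x\<in>atoms (R \<omega>). emeasure (B \<omega>) {y. mtch x y} = emeasure (\<eta>R \<omega>) {x}"
        using saturated_of_infinite unfolding big_def cball by blast
      then show False using elim saturated_iff[OF elim(2)] by simp
    qed
    moreover have "emeasure (B \<omega>) (big (R \<omega>) (B \<omega>) (\<eta>B \<omega>)) =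
        emeasure (count_space UNIV) (big (R \<omega>) (B \<omega>) (\<eta>B \<omega>))"
      by (rule emeasure_b) (auto simp: big_def)
    ultimately show ?case by (simp add: u_def)
  qed
  then have "integral\<^sup>N P \<phi> = (\<integral>\<^sup>+\<omega>. 0 \<partial>P)"
    unfolding \<phi>_int[symmetric] by (rule nn_integral_cong_AE)
  then have "AE \<omega> in P. \<phi> \<omega> = 0" by (simp add: nn_integral_0_iff_AE)
  then have "AE \<omega> in P. (\<integral>\<^sup>+y. tail q (emeasure (R \<omega>) (cball 0 (3 * norm y))) \<partial>B \<omega>) < \<infinity>"
    using \<phi>_AE good AE_space
  proof eventually_elim
    case (elim \<omega>)
    then interpret bicolored_points "R \<omega>" "\<eta>R \<omega>" "B \<omega>" "\<eta>B \<omega>" by simp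
    let ?M = "\<Pi>\<^sub>M y\<in>atoms (B \<omega>). measure_pmf q"
    interpret M: prob_space ?M by (rule prob_space_PiM) (rule measure_pmf.prob_space_axioms)
    define c where "c y = emeasure (R \<omega>) {x. norm x \<le> 3 * norm y}" for y :: 'a
    have c: "c \<in> borel_measurable borel"
      unfolding c_def[abs_def] by (rule measurable_emeasure_configs[OF configs_const[OF r]]) measurable
    have "(\<integral>\<^sup>+y. tail q (c y) \<partial>B \<omega>) < \<infinity>"
    proof (rule ccontr)
      assume "\<not> ?thesis"
      moreover have "(\<integral>\<^sup>+y. tail q (c y) \<partial>B \<omega>) =
          (\<integral>\<^sup>+y. tail q (c y) * emeasure (B \<omega>) {y} \<partial>count_space (atoms (B \<omega>)))"
        by (rule nn_integral_point_measure[OF b measurable_compose[OF c measurable_tail]])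
      moreover have "\<dots> = (\<integral>\<^sup>+y. tail q (c y) \<partial>count_space (atoms (B \<omega>)))"
        by (intro nn_integral_cong) (simp add: emeasure_b)
      ultimately have "(\<integral>\<^sup>+y. tail q (c y) \<partial>count_space (atoms (B \<omega>))) = \<infinity>"
        by (simp add: less_top[symmetric])
      \<comment> \<open>Divergence would make this conditional probability 1, while it equals
        \<open>\<phi> \<omega> = 0\<close>.\<close>
      from second_borel_cantelli_marks[OF b this]
      have "AE f in ?M. u ((R \<omega>, B \<omega>), attach_marks (B \<omega>) f) = 1"
      proof eventually_elim
        case (elim f)
        have "big (R \<omega>) (B \<omega>) (attach_marks (B \<omega>) f) = {y \<in> atoms (B \<omega>). c y < of_nat (f y)}"
          by (auto simp: big_def c_def attach_marks_singleton)
        then show ?case using elim by (simp add: u_def emeasure_b)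
      qed
      then have "(\<integral>\<^sup>+f. u ((R \<omega>, B \<omega>), attach_marks (B \<omega>) f) \<partial>?M) = (\<integral>\<^sup>+f. 1 \<partial>?M)"
        by (rule nn_integral_cong_AE)
      moreover have "(\<integral>\<^sup>+h. u ((R \<omega>, B \<omega>), h) \<partial>color_mark_law q (B \<omega>)) =
          (\<integral>\<^sup>+f. u ((R \<omega>, B \<omega>), attach_marks (B \<omega>) f) \<partial>?M)"
      proof -
        have "(R \<omega>, B \<omega>) \<in> space (configs \<Otimes>\<^sub>M configs)" using r b by (simp add: space_pair_measure)
        from measurable_Pair2[OF u this]
        have "(\<lambda>h. u ((R \<omega>, B \<omega>), h)) \<in> borel_measurable configs" .
        then show ?thesis
          unfolding color_mark_law_def by (intro nn_integral_distr measurable_attach_marks[OF b]) simp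
      qed
      ultimately show False using elim by (simp add: M.emeasure_space_1)
    qed
    then show ?case by (simp add: c_def cball)
  qed
  then show False
    using st.tail_sum_infinite[of q] finR posB mean by simp
qed

theorem theorem1:
  fixes P :: "'w measure"
    and R \<eta>R B \<eta>B :: "'w \<Rightarrow> ('a::euclidean_space) measure"
    and X Y :: "nat pmf"
    and lamR lamB :: real
  assumes "prob_space P"
    and "R \<in> P \<rightarrow>\<^sub>M configs" and "\<eta>R \<in> P \<rightarrow>\<^sub>M configs"
    and "B \<in> P \<rightarrow>\<^sub>M configs" and "\<eta>B \<in> P \<rightarrow>\<^sub>M configs"
    and "AE \<omega> in P. atoms (R \<omega>) \<inter> atoms (B \<omega>) = {}"
    and "ergodic P configs4 translate4 (\<lambda>\<omega>. (R \<omega>, \<eta>R \<omega>, B \<omega>, \<eta>B \<omega>))"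
    and "AE \<omega> in P. simple_measure (R \<omega>)" and "AE \<omega> in P. simple_measure (B \<omega>)"
    and "lamR > 0" and "intensity P R = ennreal lamR"
    and "lamB > 0" and "intensity P B = ennreal lamB"
    and "0 \<notin> set_pmf X" and "0 \<notin> set_pmf Y"
    and "iid_marks P X Y R \<eta>R B \<eta>B"
    and "AE \<omega> in P. non_equidistant (atoms (R \<omega>) \<union> atoms (B \<omega>))"
    and "AE \<omega> in P. \<not> (\<exists>x. descending_chain (atoms (R \<omega>) \<union> atoms (B \<omega>)) x)"
  shows "scheme_exists P R \<eta>R B \<eta>B \<longleftrightarrow>
    ennreal lamR * (\<integral>\<^sup>+k. of_nat k \<partial>measure_pmf X) = ennreal lamB * (\<integral>\<^sup>+k. of_nat k \<partial>measure_pmf Y)"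
proof -
  let ?EX = "\<integral>\<^sup>+k. of_nat k \<partial>measure_pmf X" and ?EY = "\<integral>\<^sup>+k. of_nat k \<partial>measure_pmf Y"
  have marks: "AE \<omega> in P. atoms (\<eta>R \<omega>) = atoms (R \<omega>)" "AE \<omega> in P. atoms (\<eta>B \<omega>) = atoms (B \<omega>)"
    using assms(16) by (auto simp: iid_marks_def)
  interpret red: matching_problem P R \<eta>R B \<eta>B
    by (intro matching_problem.intro matching_problem_axioms.intro) (fact assms marks)+
  interpret blue: matching_problem P B \<eta>B R \<eta>R by (rule red.swap)
  interpret red: bicolored_matching_problem P R \<eta>R B \<eta>B ..
  interpret blue: bicolored_matching_problem P B \<eta>B R \<eta>R ..
  have cmB: "color_marks P Y R B \<eta>B" and cmR: "color_marks P X B R \<eta>R"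
    using color_marks_of_iid_marks assms by blast+
  \<comment> \<open>The two sides of the criterion are the intensities of the mark measures, and
    these are what mass transport compares.\<close>
  have intR: "intensity P \<eta>R = ennreal lamR * ?EX"
    using color_marks.intensity_marks_mean[OF cmR assms(8)] assms(11) by (simp add: mult.commute)
  have intB: "intensity P \<eta>B = ennreal lamB * ?EY"
    using color_marks.intensity_marks_mean[OF cmB assms(9)] assms(13) by (simp add: mult.commute)
  show ?thesis
  proof
    assume "scheme_exists P R \<eta>R B \<eta>B"
    then have "intensity P \<eta>R = intensity P \<eta>B"
      using assms(3,5,6,8,9) marks by (rule scheme_exists_intensity)
    then show "ennreal lamR * ?EX = ennreal lamB * ?EY" by (simp add: intR intB)
  next
    assume eq: "ennreal lamR * ?EX = ennreal lamB * ?EY"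
    have sat: "(AE \<omega> in P. red.unsat_mass (red.Z \<omega>) = 0) \<and> (AE \<omega> in P. blue.unsat_mass (blue.Z \<omega>) = 0)"
    proof (cases "ennreal lamR * ?EX < \<infinity>")
      case True
      then show ?thesis
        using red.saturated_finite blue.saturated_finite eq by (simp add: intR intB)
    next
      case False
      then have "ennreal lamR * ?EX = \<infinity>" "ennreal lamB * ?EY = \<infinity>" using eq by (simp_all add: less_top[symmetric])
      \<comment> \<open>The ground intensities are finite, so an infinite product comes from an
        infinite mean.\<close>
      then have "?EX = \<infinity>" "?EY = \<infinity>" by (simp_all add: ennreal_mult_eq_top_iff)
      \<comment> \<open>The colors cross over: the blue marks saturate the red points and the red
        marks the blue ones.\<close>
      then show ?thesis
        using red.saturated_infinite[OF cmB] blue.saturated_infinite[OF cmR] assms(10-13) by simp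
    qed
    show "scheme_exists P R \<eta>R B \<eta>B"
    proof (rule scheme_existsI)
      show "prob_space P" by fact
      show "translation_invariant P configs4 translate4 (\<lambda>\<omega>. (R \<omega>, \<eta>R \<omega>, B \<omega>, \<eta>B \<omega>))"
        using assms(7) by (simp add: ergodic_def)
      show "AE \<omega> in P. simple_measure (matching (R \<omega>) (\<eta>R \<omega>) (B \<omega>) (\<eta>B \<omega>))"
        using red.good by eventually_elim (rule bicolored_points.simple_matching)
      show "AE \<omega> in P. two_color_multi_matching (matching (R \<omega>) (\<eta>R \<omega>) (B \<omega>) (\<eta>B \<omega>))
          (R \<omega>) (\<eta>R \<omega>) (B \<omega>) (\<eta>B \<omega>)"
        using sat[THEN conjunct1] sat[THEN conjunct2] red.good blue.good
      proof eventually_elim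
        case (elim \<omega>)
        show ?case
        proof (rule bicolored_points.two_color_multi_matching_matching[OF elim(3)])
          fix x assume "x \<in> atoms (R \<omega>)"
          then show "emeasure (B \<omega>) {y. matched (R \<omega>) (\<eta>R \<omega>) (B \<omega>) (\<eta>B \<omega>) x y} = emeasure (\<eta>R \<omega>) {x}"
            using red.saturated_iff[OF elim(3)] elim(1) by simp
        next
          fix y assume "y \<in> atoms (B \<omega>)"
          then show "emeasure (R \<omega>) {x. matched (R \<omega>) (\<eta>R \<omega>) (B \<omega>) (\<eta>B \<omega>) x y} = emeasure (\<eta>B \<omega>) {y}"
            using blue.saturated_iff[OF elim(4)] elim(2) by (simp add: matched_swap[of "B \<omega>"])
        qed
      qed
    qed
  qed
qed

end
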